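(* Let $(\mathfrak{A},\mathsf{L}_{\mathfrak{A}})$ and $(\mathfrak{B},\mathsf{L}_{\mathfrak{B}})$ be Leibniz quantum compact metric spaces, $\gamma=(\mathfrak{D},\omega,\pi_{\mathfrak{A}},\pi_{\mathfrak{B}})$ a bridge from $\mathfrak{A}$ to $\mathfrak{B}$ with length $\lambda=\lambda(\gamma\mid\mathsf{L}_{\mathfrak{A}},\mathsf{L}_{\mathfrak{B}})$, and $\varepsilon\ge0$ with $\lambda+\varepsilon>0$. Define for $(a,b)\in\mathfrak{sa}(\mathfrak{A}\oplus\mathfrak{B})$: $$\mathsf{L}_\varepsilon(a,b)=\max\left\{\mathsf{L}_{\mathfrak{A}}(a),\ \mathsf{L}_{\mathfrak{B}}(b),\ \frac{1}{\lambda+\varepsilon}\|\pi_{\mathfrak{A}}(a)\omega-\omega\pi_{\mathfrak{B}}(b)\|_{\mathfrak{D}}\right\}.$$ Then $\mathsf{L}_\varepsilon$ is a Lip-norm on $\mathfrak{A}\oplus\mathfrak{B}$ which is admissible for $(\mathsf{L}_{\mathfrak{A}},\mathsf{L}_{\mathfrak{B}})$ and satisfies the Leibniz inequalities (for the Jordan product $\frac{xy+yx}{2}$ and the Lie product $\frac{xy-yx}{2i}$ on $\mathfrak{sa}(\mathfrak{A}\oplus\mathfrak{B})$), and, identifying $\mathscr{S}(\mathfrak{A})$ and $\mathscr{S}(\mathfrak{B})$ with their canonical images in $\mathscr{S}(\mathfrak{A}\oplus\mathfrak{B})$, $$\mathrm{Haus}_{\mathrm{mk}_{\mathsf{L}_\varepsilon}}(\mathscr{S}(\mathfrak{A}),\mathscr{S}(\mathfrak{B}))\le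 2\lambda+\varepsilon.$$ Consequently $\mathrm{dist}_q((\mathfrak{A},\mathsf{L}_{\mathfrak{A}}),(\mathfrak{B},\mathsf{L}_{\mathfrak{B}}))\le 2\lambda$.
   Context: Notation: $\mathfrak{sa}(\mathfrak{A})$ self-adjoint part, $\mathscr{S}(\mathfrak{A})$ state space; $\mathrm{Haus}_d$ is the Hausdorff distance for the metric $d$. Quantum compact metric space $(\mathfrak{A},\mathsf{L})$: unital C*-algebra with a seminorm $\mathsf{L}$ (a Lip-norm) on a dense subspace $\mathrm{dom}(\mathsf{L})\subseteq\mathfrak{sa}(\mathfrak{A})$ ($\mathsf{L}=\infty$ elsewhere), vanishing exactly on $\mathbb{R}1_{\mathfrak{A}}$, such that $\mathrm{mk}_{\mathsf{L}}(\varphi,\psi)=\sup\{|\varphi(a)-\psi(a)|:a\in\mathfrak{sa}(\mathfrak{A}),\mathsf{L}(a)\le1\}$ metrizes the weak* topology on $\mathscr{S}(\mathfrak{A})$. A Leibniz quantum compact metric space is a quantum compact metric space with $\mathsf{L}$ lower semi-continuous for the norm and, for all $a,b\in\mathfrak{sa}(\mathfrak{A})$, $\mathsf{L}(\frac{ab+ba}{2})\le\|a\|\mathsf{L}(b)+\|b\|\mathsf{L}(a)$ and $\mathsf{L}(\frac{ab-ba}{2i})\le\|a\|\mathsf{L}(b)+\|b\|\mathsf{L}(a)$. $\mathrm{Lip}_1(\mathfrak{A},\mathsf{L})=\{a\in\mathfrak{sa}(\mathfrak{A}):\mathsf{L}(a)\le1\}$. $1$-level: $\mathscr{S}_1(\omega)=\{\varphi\in\mathscr{S}(\mathfrak{D}):\varphi((1-\omega)^*(1-\omega))=0=\varphi((1-\omega)(1-\omega)^*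 )\}$. Bridge from $\mathfrak{A}$ to $\mathfrak{B}$: $\gamma=(\mathfrak{D},\omega,\pi_{\mathfrak{A}},\pi_{\mathfrak{B}})$ with $\mathfrak{D}$ a unital C*-algebra, $\omega\in\mathfrak{D}$ with $\mathscr{S}_1(\omega)\ne\emptyset$, $\pi_{\mathfrak{A}},\pi_{\mathfrak{B}}$ unital injective *-homomorphisms into $\mathfrak{D}$. Reach: norm-Hausdorff distance in $\mathfrak{D}$ between $\pi_{\mathfrak{A}}(\mathrm{Lip}_1(\mathfrak{A},\mathsf{L}_{\mathfrak{A}}))\omega$ and $\omega\pi_{\mathfrak{B}}(\mathrm{Lip}_1(\mathfrak{B},\mathsf{L}_{\mathfrak{B}}))$. Height: $\max\{\mathrm{Haus}_{\mathrm{mk}_{\mathsf{L}_{\mathfrak{A}}}}(\mathscr{S}(\mathfrak{A}),\{\varphi\circ\pi_{\mathfrak{A}}:\varphi\in\mathscr{S}_1(\omega)\}),\mathrm{Haus}_{\mathrm{mk}_{\mathsf{L}_{\mathfrak{B}}}}(\mathscr{S}(\mathfrak{B}),\{\varphi\circ\pi_{\mathfrak{B}}:\varphi\in\mathscr{S}_1(\omega)\})\}$. Length $\lambda(\gamma\mid\mathsf{L}_{\mathfrak{A}},\mathsf{L}_{\mathfrak{B}})$: maximum of reach and height. A Lip-norm $\mathsf{L}$ on $\mathfrak{A}\oplus\mathfrak{B}$ (i.e. $(\mathfrak{A}\oplus\mathfrak{B},\mathsf{L})$ is a quantum compact metric space) is admissible for $(\mathsf{L}_{\mathfrak{A}},\mathsf{L}_{\mathfrak{B}})$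 if $\mathsf{L}_{\mathfrak{A}}(a)=\inf\{\mathsf{L}(a,b):b\in\mathfrak{sa}(\mathfrak{B})\}$ for all $a\in\mathfrak{sa}(\mathfrak{A})$ and $\mathsf{L}_{\mathfrak{B}}(b)=\inf\{\mathsf{L}(a,b):a\in\mathfrak{sa}(\mathfrak{A})\}$ for all $b\in\mathfrak{sa}(\mathfrak{B})$. Rieffel's quantum Gromov-Hausdorff distance $\mathrm{dist}_q$ is the infimum, over all admissible Lip-norms $\mathsf{L}$, of $\mathrm{Haus}_{\mathrm{mk}_{\mathsf{L}}}(\mathscr{S}(\mathfrak{A}),\mathscr{S}(\mathfrak{B}))$, where $\mathscr{S}(\mathfrak{A})$, $\mathscr{S}(\mathfrak{B})$ are identified with states of $\mathfrak{A}\oplus\mathfrak{B}$ via $\varphi\mapsto((a,b)\mapsto\varphi(a))$ and $\psi\mapsto((a,b)\mapsto\psi(b))$. *)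

theory Defs
  imports "HOL-Analysis.Analysis"
begin

record 'a cstar_alg =
  czero :: 'a
  cone  :: 'a
  cadd  :: "'a \<Rightarrow> 'a \<Rightarrow> 'a"
  csmult :: "complex \<Rightarrow> 'a \<Rightarrow> 'a"
  cmult :: "'a \<Rightarrow> 'a \<Rightarrow> 'a"
  cstar :: "'a \<Rightarrow> 'a"
  cnorm :: "'a \<Rightarrow> real"

definition csub :: "('a,'m) cstar_alg_scheme \<Rightarrow> 'a \<Rightarrow> 'a \<Rightarrow> 'a" where
  "csub A x y = cadd A x (csmult A (-1) y)"

definition unital_cstar_algebra :: "('a,'m) cstar_alg_scheme \<Rightarrow> bool" where
  "unital_cstar_algebra A \<longleftrightarrow>
     \<comment> \<open>complex vector space\<close>
     (\<forall>x y z. cadd A (cadd A x y) z = cadd A x (cadd A y z)) \<and>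
     (\<forall>x y. cadd A x y = cadd A y x) \<and>
     (\<forall>x. cadd A (czero A) x = x) \<and>
     (\<forall>x. cadd A x (csmult A (-1) x) = czero A) \<and>
     (\<forall>c x y. csmult A c (cadd A x y) = cadd A (csmult A c x) (csmult A c y)) \<and>
     (\<forall>c d x. csmult A (c + d) x = cadd A (csmult A c x) (csmult A d x)) \<and>
     (\<forall>c d x. csmult A c (csmult A d x) = csmult A (c * d) x) \<and>
     (\<forall>x. csmult A 1 x = x) \<and>
     \<comment> \<open>unital associative algebra\<close>
     (\<forall>x y z. cmult A (cmult A x y) z = cmult A x (cmult A y z)) \<and>
     (\<forall>x y z. cmult A x (cadd A y z) = cadd A (cmult A x y) (cmult A x z)) \<and>
     (\<forall>x y z. cmult A (cadd A x y) z = cadd A (cmult A x z) (cmult A y z)) \<and>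
     (\<forall>c x y. cmult A (csmult A c x) y = csmult A c (cmult A x y)) \<and>
     (\<forall>c x y. cmult A x (csmult A c y) = csmult A c (cmult A x y)) \<and>
     (\<forall>x. cmult A (cone A) x = x \<and> cmult A x (cone A) = x) \<and>
     \<comment> \<open>involution\<close>
     (\<forall>x. cstar A (cstar A x) = x) \<and>
     (\<forall>x y. cstar A (cadd A x y) = cadd A (cstar A x) (cstar A y)) \<and>
     (\<forall>c x. cstar A (csmult A c x) = csmult A (cnj c) (cstar A x)) \<and>
     (\<forall>x y. cstar A (cmult A x y) = cmult A (cstar A y) (cstar A x)) \<and>
     \<comment> \<open>norm\<close>
     (\<forall>x. 0 \<le> cnorm A x) \<and>
     (\<forall>x. cnorm A x = 0 \<longleftrightarrow> x = czero A) \<and>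
     (\<forall>x y. cnorm A (cadd A x y) \<le> cnorm A x + cnorm A y) \<and>
     (\<forall>c x. cnorm A (csmult A c x) = cmod c * cnorm A x) \<and>
     (\<forall>x y. cnorm A (cmult A x y) \<le> cnorm A x * cnorm A y) \<and>
     (\<forall>x. cnorm A (cmult A (cstar A x) x) = (cnorm A x)\<^sup>2) \<and>
     \<comment> \<open>completeness\<close>
     (\<forall>f :: nat \<Rightarrow> 'a.
        (\<forall>e>0. \<exists>N. \<forall>m\<ge>N. \<forall>n\<ge>N. cnorm A (csub A (f m) (f n)) < e) \<longrightarrow>
        (\<exists>x. \<forall>e>0. \<exists>N. \<forall>n\<ge>N. cnorm A (csub A (f n) x) < e))"

definition sa :: "('a,'m) cstar_alg_scheme \<Rightarrow> 'a set" where
  "sa A = {a. cstar A a = a}"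

definition states :: "('a,'m) cstar_alg_scheme \<Rightarrow> ('a \<Rightarrow> complex) set" where
  "states A = {\<phi>.
     (\<forall>x y. \<phi> (cadd A x y) = \<phi> x + \<phi> y) \<and>
     (\<forall>c x. \<phi> (csmult A c x) = c * \<phi> x) \<and>
     (\<forall>x. Im (\<phi> (cmult A (cstar A x) x)) = 0 \<and> 0 \<le> Re (\<phi> (cmult A (cstar A x) x))) \<and>
     \<phi> (cone A) = 1}"

definition dsum :: "('a,'m) cstar_alg_scheme \<Rightarrow> ('b,'n) cstar_alg_scheme \<Rightarrow> ('a \<times> 'b) cstar_alg" where
  "dsum A B = \<lparr> czero = (czero A, czero B), cone = (cone A, cone B),
     cadd = (\<lambda>(a,b) (a',b'). (cadd A a a', cadd B b b')),
     csmult = (\<lambda>c (a,b). (csmult A c a, csmult B c b)),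
     cmult = (\<lambda>(a,b) (a',b'). (cmult A a a', cmult B b b')),
     cstar = (\<lambda>(a,b). (cstar A a, cstar B b)),
     cnorm = (\<lambda>(a,b). max (cnorm A a) (cnorm B b)) \<rparr>"

definition inclA :: "('a \<Rightarrow> complex) \<Rightarrow> ('a \<times> 'b \<Rightarrow> complex)" where
  "inclA \<phi> = (\<lambda>(a,b). \<phi> a)"
definition inclB :: "('b \<Rightarrow> complex) \<Rightarrow> ('a \<times> 'b \<Rightarrow> complex)" where
  "inclB \<psi> = (\<lambda>(a,b). \<psi> b)"

definition unital_inj_star_hom ::
  "('a,'m) cstar_alg_scheme \<Rightarrow> ('d,'n) cstar_alg_scheme \<Rightarrow> ('a \<Rightarrow> 'd) \<Rightarrow> bool" where
  "unital_inj_star_hom A D \<pi> \<longleftrightarrow>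
     (\<forall>x y. \<pi> (cadd A x y) = cadd D (\<pi> x) (\<pi> y)) \<and>
     (\<forall>c x. \<pi> (csmult A c x) = csmult D c (\<pi> x)) \<and>
     (\<forall>x y. \<pi> (cmult A x y) = cmult D (\<pi> x) (\<pi> y)) \<and>
     (\<forall>x. \<pi> (cstar A x) = cstar D (\<pi> x)) \<and>
     \<pi> (cone A) = cone D \<and> inj \<pi>"

definition haus :: "('x \<Rightarrow> 'x \<Rightarrow> ereal) \<Rightarrow> 'x set \<Rightarrow> 'x set \<Rightarrow> ereal" where
  "haus d X Y = max (SUP x\<in>X. INF y\<in>Y. d x y) (SUP y\<in>Y. INF x\<in>X. d x y)"

definition Lip1 :: "('a,'m) cstar_alg_scheme \<Rightarrow> ('a \<Rightarrow> ereal) \<Rightarrow> 'a set" where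
  "Lip1 A L = {a \<in> sa A. L a \<le> 1}"

definition mk :: "('a,'m) cstar_alg_scheme \<Rightarrow> ('a \<Rightarrow> ereal) \<Rightarrow> ('a \<Rightarrow> complex) \<Rightarrow> ('a \<Rightarrow> complex) \<Rightarrow> ereal" where
  "mk A L \<phi> \<psi> = (SUP a\<in>Lip1 A L. ereal (cmod (\<phi> a - \<psi> a)))"

definition weak_star_states :: "('a,'m) cstar_alg_scheme \<Rightarrow> ('a \<Rightarrow> complex) topology" where
  "weak_star_states A = subtopology (product_topology (\<lambda>_. euclidean) UNIV) (states A)"

definition qcms :: "('a,'m) cstar_alg_scheme \<Rightarrow> ('a \<Rightarrow> ereal) \<Rightarrow> bool" where
  "qcms A L \<longleftrightarrow>
     unital_cstar_algebra A \<and>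
     (\<forall>a. a \<notin> sa A \<longrightarrow> L a = \<infinity>) \<and>
     (\<forall>a. 0 \<le> L a) \<and>
     (\<forall>a\<in>sa A. \<forall>b\<in>sa A. L (cadd A a b) \<le> L a + L b) \<and>
     (\<forall>a\<in>sa A. \<forall>r::real. L (csmult A (complex_of_real r) a) = ereal \<bar>r\<bar> * L a) \<and>
     (\<forall>a\<in>sa A. \<forall>e>0. \<exists>b. L b < \<infinity> \<and> cnorm A (csub A b a) < e) \<and>
     (\<forall>a\<in>sa A. L a = 0 \<longleftrightarrow> (\<exists>r::real. a = csmult A (complex_of_real r) (cone A))) \<and>
     (\<forall>\<phi>\<in>states A. \<forall>\<psi>\<in>states A. mk A L \<phi> \<psi> \<noteq> \<infinity>) \<and>
     Metric_space (states A) (\<lambda>\<phi> \<psi>. real_of_ereal (mk A L \<phi> \<psi>)) \<and>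
     Metric_space.mtopology (states A) (\<lambda>\<phi> \<psi>. real_of_ereal (mk A L \<phi> \<psi>)) = weak_star_states A"

definition jordan :: "('a,'m) cstar_alg_scheme \<Rightarrow> 'a \<Rightarrow> 'a \<Rightarrow> 'a" where
  "jordan A a b = csmult A (1/2) (cadd A (cmult A a b) (cmult A b a))"

definition lie :: "('a,'m) cstar_alg_scheme \<Rightarrow> 'a \<Rightarrow> 'a \<Rightarrow> 'a" where
  "lie A a b = csmult A (1/(2*\<i>)) (csub A (cmult A a b) (cmult A b a))"

definition leibniz_ineqs :: "('a,'m) cstar_alg_scheme \<Rightarrow> ('a \<Rightarrow> ereal) \<Rightarrow> bool" where
  "leibniz_ineqs A L \<longleftrightarrow>
     (\<forall>a\<in>sa A. \<forall>b\<in>sa A.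
        L (jordan A a b) \<le> ereal (cnorm A a) * L b + ereal (cnorm A b) * L a \<and>
        L (lie A a b) \<le> ereal (cnorm A a) * L b + ereal (cnorm A b) * L a)"

definition norm_lsc :: "('a,'m) cstar_alg_scheme \<Rightarrow> ('a \<Rightarrow> ereal) \<Rightarrow> bool" where
  "norm_lsc A L \<longleftrightarrow>
     (\<forall>t::ereal. \<forall>x. (\<forall>e>0. \<exists>y. L y \<le> t \<and> cnorm A (csub A y x) < e) \<longrightarrow> L x \<le> t)"

definition leibniz_qcms :: "('a,'m) cstar_alg_scheme \<Rightarrow> ('a \<Rightarrow> ereal) \<Rightarrow> bool" where
  "leibniz_qcms A L \<longleftrightarrow> qcms A L \<and> norm_lsc A L \<and> leibniz_ineqs A L"

definition level1 :: "('d,'m) cstar_alg_scheme \<Rightarrow> 'd \<Rightarrow> ('d \<Rightarrow> complex) set" where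
  "level1 D \<omega> = {\<phi> \<in> states D.
     \<phi> (cmult D (cstar D (csub D (cone D) \<omega>)) (csub D (cone D) \<omega>)) = 0 \<and>
     \<phi> (cmult D (csub D (cone D) \<omega>) (cstar D (csub D (cone D) \<omega>))) = 0}"

definition bridge ::
  "('a,'m) cstar_alg_scheme \<Rightarrow> ('b,'n) cstar_alg_scheme \<Rightarrow> ('d,'k) cstar_alg_scheme \<Rightarrow> 'd \<Rightarrow>
   ('a \<Rightarrow> 'd) \<Rightarrow> ('b \<Rightarrow> 'd) \<Rightarrow> bool" where
  "bridge A B D \<omega> \<pi>A \<pi>B \<longleftrightarrow> unital_cstar_algebra D \<and> level1 D \<omega> \<noteq> {} \<and>
     unital_inj_star_hom A D \<pi>A \<and> unital_inj_star_hom B D \<pi>B"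

definition bridge_reach ::
  "('a,'m) cstar_alg_scheme \<Rightarrow> ('a \<Rightarrow> ereal) \<Rightarrow> ('b,'n) cstar_alg_scheme \<Rightarrow> ('b \<Rightarrow> ereal) \<Rightarrow>
   ('d,'k) cstar_alg_scheme \<Rightarrow> 'd \<Rightarrow> ('a \<Rightarrow> 'd) \<Rightarrow> ('b \<Rightarrow> 'd) \<Rightarrow> ereal" where
  "bridge_reach A LA B LB D \<omega> \<pi>A \<pi>B =
     haus (\<lambda>x y. ereal (cnorm D (csub D x y)))
       ((\<lambda>a. cmult D (\<pi>A a) \<omega>) ` Lip1 A LA) ((\<lambda>b. cmult D \<omega> (\<pi>B b)) ` Lip1 B LB)"

definition bridge_height ::
  "('a,'m) cstar_alg_scheme \<Rightarrow> ('a \<Rightarrow> ereal) \<Rightarrow> ('b,'n) cstar_alg_scheme \<Rightarrow> ('b \<Rightarrow> ereal) \<Rightarrow>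
   ('d,'k) cstar_alg_scheme \<Rightarrow> 'd \<Rightarrow> ('a \<Rightarrow> 'd) \<Rightarrow> ('b \<Rightarrow> 'd) \<Rightarrow> ereal" where
  "bridge_height A LA B LB D \<omega> \<pi>A \<pi>B =
     max (haus (mk A LA) (states A) ((\<lambda>\<phi>. \<phi> \<circ> \<pi>A) ` level1 D \<omega>))
         (haus (mk B LB) (states B) ((\<lambda>\<phi>. \<phi> \<circ> \<pi>B) ` level1 D \<omega>))"

definition bridge_length ::
  "('a,'m) cstar_alg_scheme \<Rightarrow> ('a \<Rightarrow> ereal) \<Rightarrow> ('b,'n) cstar_alg_scheme \<Rightarrow> ('b \<Rightarrow> ereal) \<Rightarrow>
   ('d,'k) cstar_alg_scheme \<Rightarrow> 'd \<Rightarrow> ('a \<Rightarrow> 'd) \<Rightarrow> ('b \<Rightarrow> 'd) \<Rightarrow> ereal" where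
  "bridge_length A LA B LB D \<omega> \<pi>A \<pi>B =
     max (bridge_reach A LA B LB D \<omega> \<pi>A \<pi>B) (bridge_height A LA B LB D \<omega> \<pi>A \<pi>B)"

definition admissible ::
  "('a,'m) cstar_alg_scheme \<Rightarrow> ('a \<Rightarrow> ereal) \<Rightarrow> ('b,'n) cstar_alg_scheme \<Rightarrow> ('b \<Rightarrow> ereal) \<Rightarrow>
   ('a \<times> 'b \<Rightarrow> ereal) \<Rightarrow> bool" where
  "admissible A LA B LB L \<longleftrightarrow>
     (\<forall>a\<in>sa A. LA a = (INF b\<in>sa B. L (a, b))) \<and>
     (\<forall>b\<in>sa B. LB b = (INF a\<in>sa A. L (a, b)))"

definition dist_q ::
  "('a,'m) cstar_alg_scheme \<Rightarrow> ('a \<Rightarrow> ereal) \<Rightarrow> ('b,'n) cstar_alg_scheme \<Rightarrow> ('b \<Rightarrow> ereal) \<Rightarrow> ereal" where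
  "dist_q A LA B LB =
     (INF L\<in>{L. qcms (dsum A B) L \<and> admissible A LA B LB L}.
        haus (mk (dsum A B) L) (inclA ` states A) (inclB ` states B))"

definition bridge_lipnorm ::
  "('a,'m) cstar_alg_scheme \<Rightarrow> ('a \<Rightarrow> ereal) \<Rightarrow> ('b,'n) cstar_alg_scheme \<Rightarrow> ('b \<Rightarrow> ereal) \<Rightarrow>
   ('d,'k) cstar_alg_scheme \<Rightarrow> 'd \<Rightarrow> ('a \<Rightarrow> 'd) \<Rightarrow> ('b \<Rightarrow> 'd) \<Rightarrow> real \<Rightarrow> ('a \<times> 'b \<Rightarrow> ereal)" where
  "bridge_lipnorm A LA B LB D \<omega> \<pi>A \<pi>B \<epsilon> = (\<lambda>(a, b).
     if (a, b) \<in> sa (dsum A B) then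
       max (max (LA a) (LB b))
           (ereal (cnorm D (csub D (cmult D (\<pi>A a) \<omega>) (cmult D \<omega> (\<pi>B b))))
              / (bridge_length A LA B LB D \<omega> \<pi>A \<pi>B + ereal \<epsilon>))
     else \<infinity>)"

end

theory Submission
  imports Defs
begin

text \<open>
  Let \<open>\<rho>\<close> be the length of the bridge and \<open>l = \<rho> + \<epsilon>\<close>. If \<open>\<theta>\<close> lies in the 1-level of the pivot \<open>\<omega>\<close>,
  then \<open>\<theta> (x \<omega>) = \<theta> x = \<theta> (\<omega> x)\<close>, so the third term of the Lip-norm bounds the difference between
  \<open>\<theta> \<circ> \<pi>A\<close> at \<open>a\<close> and \<open>\<theta> \<circ> \<pi>B\<close> at \<open>b\<close> by \<open>l\<close>. Together with the height this gives
  the estimate \<open>\<rho> + l\<close> of the Hausdorff distance; the reach gives admissibility, and the Leibniz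
  inequality holds because *-homomorphisms are contractive.

  That the weak* topology is metrized follows from Rieffel's criterion: it amounts to the total boundedness
  in norm of the elements \<open>x\<close> with \<open>L x \<le> 1\<close> and \<open>\<mu> x = 0\<close>, for one state \<open>\<mu>\<close>, and for the direct sum
  this reduces to the two summands. Both the criterion and the finiteness of \<open>\<rho>\<close> need
  that states control the norm of selfadjoint elements. For this, call \<open>h = h\<^sup>\<star>\<close> positive if
  \<open>\<parallel>t - h\<parallel> \<le> t\<close> for some \<open>t\<close>. Squares and elements \<open>y\<^sup>\<star> y\<close> are shown to be positive without any
  spectral theory, using only that \<open>\<parallel>h\<^sup>2\<parallel> = \<parallel>h\<parallel>\<^sup>2\<close>, and the Hahn--Banach theorem for this cone provides the states.
\<close>

text \<open>A constant factor lost in bounding a norm by states is harmless, because boundedness and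
  total boundedness tolerate it; hence the factor 3 in \<open>cnorm_le_of_states\<close>. Two
  estimates do have to be sharp: states must be contractive, or the gap would contribute more than
  \<open>l\<close> to the Hausdorff distance, and the homomorphisms must be contractive, or the
  Leibniz inequality would acquire a constant. Both come from a selfadjoint square root of
  \<open>r - h\<close>.

  Total boundedness is preferred to the equality of topologies because it speaks of elements, so
  that pairs \<open>(a, b)\<close> can be treated one coordinate at a time. Subtracting a scalar
  normalizes only one coordinate, however. The gap term keeps the other one bounded, and it also
  forces the two scalars of a pair in the kernel to agree, since the pivot is nonzero.

  The length must be known to be real before any of this, since division by an infinite length would
  erase the gap term. For the bound on \<open>dist_q\<close>, \<epsilon> is replaced by arbitrary
  positive numbers, so that only twice the length remains in the infimum.\<close>

lemma le_cINF_add_cINF: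
  fixes f :: "'c \<Rightarrow> real" and g :: "'d \<Rightarrow> real"
  assumes "S \<noteq> {}" "T \<noteq> {}" and le: "\<And>s t. s \<in> S \<Longrightarrow> t \<in> T \<Longrightarrow> c \<le> f s + g t"
  shows "c \<le> (INF s\<in>S. f s) + (INF t\<in>T. g t)"
proof -
  have "c - (INF t\<in>T. g t) \<le> f s" if "s \<in> S" for s
  proof -
    have "c - f s \<le> (INF t\<in>T. g t)"
      using le[OF that] by (intro cINF_greatest assms) (simp add: algebra_simps)
    then show ?thesis by simp
  qed
  then have "c - (INF t\<in>T. g t) \<le> (INF s\<in>S. f s)" by (intro cINF_greatest assms)
  then show ?thesis by simp
qed

text \<open>One representative is chosen from each fibre of \<open>g\<close>. They lie in
  \<open>X\<close> itself, so the relation is only ever checked between members of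
  \<open>X\<close>.\<close>

lemma finite_net_of_finite_image:
  assumes "finite (g ` X)" and "\<And>a b. a \<in> X \<Longrightarrow> b \<in> X \<Longrightarrow> g a = g b \<Longrightarrow> R a b"
  shows "\<exists>F. finite F \<and> F \<subseteq> X \<and> (\<forall>a\<in>X. \<exists>b\<in>F. R a b)"
proof (intro exI conjI ballI)
  show "finite (inv_into X g ` g ` X)" using assms(1) by (rule finite_imageI)
  show "inv_into X g ` g ` X \<subseteq> X" by (auto intro: inv_into_into)
  fix a assume "a \<in> X"
  then have "R a (inv_into X g (g a))"
    by (intro assms(2)) (auto intro: inv_into_into simp: f_inv_into_f)
  then show "\<exists>b\<in>inv_into X g ` g ` X. R a b" using \<open>a \<in> X\<close> by blast
qed

section \<open>Unital C*-algebras\<close>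

text \<open>The record axioms admit the zero algebra. Excluding it allows the instance of
  \<open>ring_1\<close> and gives the unit norm 1.\<close>

locale ucstar =
  fixes A :: "('a,'m) cstar_alg_scheme"
  assumes cstar: "unital_cstar_algebra A" and one_neq_zero: "cone A \<noteq> czero A"
begin

abbreviation plus_A (infixl "\<oplus>" 65) where "x \<oplus> y \<equiv> cadd A x y"
abbreviation minus_A (infixl "\<ominus>" 65) where "x \<ominus> y \<equiv> csub A x y"
abbreviation times_A (infixl "\<otimes>" 70) where "x \<otimes> y \<equiv> cmult A x y"
abbreviation scale_A (infixr "\<cdot>" 75) where "c \<cdot> x \<equiv> csmult A c x"
abbreviation one_A ("\<one>") where "\<one> \<equiv> cone A"
abbreviation zero_A ("\<zero>") where "\<zero> \<equiv> czero A"
abbreviation star_A ("_\<^sup>\<star>" [1000] 999) where "x\<^sup>\<star> \<equiv> cstar A x"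
abbreviation norm_A ("\<parallel>_\<parallel>") where "\<parallel>x\<parallel> \<equiv> cnorm A x"

lemma
  shows cadd_assoc: "(x \<oplus> y) \<oplus> z = x \<oplus> (y \<oplus> z)"
    and cadd_commute: "x \<oplus> y = y \<oplus> x"
    and cadd_zero_left: "\<zero> \<oplus> x = x"
    and cadd_uminus: "x \<oplus> (-1) \<cdot> x = \<zero>"
    and csmult_add_right: "c \<cdot> (x \<oplus> y) = c \<cdot> x \<oplus> c \<cdot> y"
    and csmult_add_left: "(c + d) \<cdot> x = c \<cdot> x \<oplus> d \<cdot> x"
    and csmult_csmult [simp]: "c \<cdot> (d \<cdot> x) = (c * d) \<cdot> x"
    and csmult_one [simp]: "1 \<cdot> x = x"
    and cmult_assoc: "(x \<otimes> y) \<otimes> z = x \<otimes> (y \<otimes> z)"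
    and cmult_distrib_left: "x \<otimes> (y \<oplus> z) = x \<otimes> y \<oplus> x \<otimes> z"
    and cmult_distrib_right: "(x \<oplus> y) \<otimes> z = x \<otimes> z \<oplus> y \<otimes> z"
    and csmult_mult_left [simp]: "(c \<cdot> x) \<otimes> y = c \<cdot> (x \<otimes> y)"
    and csmult_mult_right [simp]: "x \<otimes> (c \<cdot> y) = c \<cdot> (x \<otimes> y)"
    and one_cmult: "\<one> \<otimes> x = x"
    and cmult_one: "x \<otimes> \<one> = x"
    and cstar_cstar [simp]: "(x\<^sup>\<star>)\<^sup>\<star> = x"
    and cstar_add: "(x \<oplus> y)\<^sup>\<star> = x\<^sup>\<star> \<oplus> y\<^sup>\<star>"
    and cstar_csmult: "(c \<cdot> x)\<^sup>\<star> = cnj c \<cdot> x\<^sup>\<star>"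
    and cstar_mult: "(x \<otimes> y)\<^sup>\<star> = y\<^sup>\<star> \<otimes> x\<^sup>\<star>"
    and cnorm_ge_0 [simp]: "0 \<le> \<parallel>x\<parallel>"
    and cnorm_eq_0: "\<parallel>x\<parallel> = 0 \<longleftrightarrow> x = \<zero>"
    and cnorm_triangle: "\<parallel>x \<oplus> y\<parallel> \<le> \<parallel>x\<parallel> + \<parallel>y\<parallel>"
    and cnorm_csmult: "\<parallel>c \<cdot> x\<parallel> = cmod c * \<parallel>x\<parallel>"
    and cnorm_mult: "\<parallel>x \<otimes> y\<parallel> \<le> \<parallel>x\<parallel> * \<parallel>y\<parallel>"
    and cnorm_cstar_mult: "\<parallel>x\<^sup>\<star> \<otimes> x\<parallel> = \<parallel>x\<parallel>\<^sup>2"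
  using cstar unfolding unital_cstar_algebra_def by (simp_all, metis+)

lemma cnorm_complete:
  assumes "\<forall>e>0. \<exists>N. \<forall>m\<ge>N. \<forall>n\<ge>N. \<parallel>f m \<ominus> f n\<parallel> < e"
  shows "\<exists>x. \<forall>e>0. \<exists>N. \<forall>n\<ge>N. \<parallel>f (n::nat) \<ominus> x\<parallel> < e"
  using cstar assms unfolding unital_cstar_algebra_def by blast

sublocale rng: ring_1 where times = "cmult A" and plus = "cadd A" and zero = "czero A"
  and one = "cone A" and minus = "csub A" and uminus = "csmult A (-1)"
proof unfold_locales
  show "(-1) \<cdot> a \<oplus> a = \<zero>" for a using cadd_uminus cadd_commute by metis
qed (simp_all add: cadd_assoc cmult_assoc cadd_zero_left cmult_distrib_left cmult_distrib_right
      one_cmult cmult_one csub_def one_neq_zero[symmetric], rule cadd_commute)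

\<comment> \<open>Otherwise unfolding \<open>csub_def\<close> in simp loops.\<close>
declare rng.add_uminus_conv_diff [simp del] rng.uminus_add_conv_diff [simp del]

lemmas ring_simps = rng.distrib_left rng.distrib_right rng.left_diff_distrib rng.right_diff_distrib
  rng.add.assoc rng.add.commute rng.add.left_commute rng.mult.assoc rng.diff_add_eq rng.add_diff_eq
  rng.diff_diff_add rng.diff_diff_eq2 rng.diff_eq_eq rng.eq_diff_eq

lemma csmult_zero_left [simp]: "0 \<cdot> x = \<zero>"
  by (metis rng.right_minus csmult_add_left csmult_one add.right_inverse)

lemma csmult_zero_right [simp]: "c \<cdot> \<zero> = \<zero>"
  by (metis csmult_zero_left csmult_csmult mult_zero_right)

lemma csmult_diff_right: "c \<cdot> (x \<ominus> y) = c \<cdot> x \<ominus> c \<cdot> y"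
  by (simp add: csub_def csmult_add_right mult.commute)

lemma csmult_diff_left: "(c - d) \<cdot> x = c \<cdot> x \<ominus> d \<cdot> x"
  using csmult_add_left[of c "- d" x] by (simp add: csub_def)

lemma csmult_2: "2 \<cdot> x = x \<oplus> x"
  using csmult_add_left[of 1 1 x] by simp

lemma cstar_diff: "(x \<ominus> y)\<^sup>\<star> = x\<^sup>\<star> \<ominus> y\<^sup>\<star>"
  by (simp add: csub_def cstar_add cstar_csmult)

lemma cstar_one [simp]: "\<one>\<^sup>\<star> = \<one>"
  by (metis cstar_cstar cstar_mult cmult_one)

lemma cstar_zero [simp]: "\<zero>\<^sup>\<star> = \<zero>"
  by (metis csmult_zero_left cstar_csmult complex_cnj_zero)

lemma cnorm_zero [simp]: "\<parallel>\<zero>\<parallel> = 0"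
  by (simp add: cnorm_eq_0)

lemma cnorm_minus_commute: "\<parallel>x \<ominus> y\<parallel> = \<parallel>y \<ominus> x\<parallel>"
proof -
  have "x \<ominus> y = (-1) \<cdot> (y \<ominus> x)" by simp
  then show ?thesis using cnorm_csmult[of "-1" "y \<ominus> x"] by simp
qed

lemma cnorm_triangle_diff: "\<parallel>x \<ominus> y\<parallel> \<le> \<parallel>x\<parallel> + \<parallel>y\<parallel>"
  using cnorm_triangle[of x "(-1) \<cdot> y"] cnorm_csmult[of "-1" y] by (simp add: csub_def)

lemma cnorm_triangle_sub: "\<parallel>x \<ominus> z\<parallel> \<le> \<parallel>x \<ominus> y\<parallel> + \<parallel>y \<ominus> z\<parallel>"
  using cnorm_triangle[of "x \<ominus> y" "y \<ominus> z"] by (simp add: ring_simps)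

lemma cnorm_le_diff_add: "\<parallel>x\<parallel> \<le> \<parallel>x \<ominus> y\<parallel> + \<parallel>y\<parallel>"
  using cnorm_triangle[of "x \<ominus> y" y] by simp

lemma cnorm_cstar [simp]: "\<parallel>x\<^sup>\<star>\<parallel> = \<parallel>x\<parallel>"
proof -
  have le: "\<parallel>y\<parallel> \<le> \<parallel>y\<^sup>\<star>\<parallel>" for y
  proof (cases "\<parallel>y\<parallel> = 0")
    case False
    have "\<parallel>y\<parallel> * \<parallel>y\<parallel> \<le> \<parallel>y\<^sup>\<star>\<parallel> * \<parallel>y\<parallel>"
      using cnorm_mult[of "y\<^sup>\<star>" y] cnorm_cstar_mult[of y] by (simp add: power2_eq_square)
    with False show ?thesis
      using cnorm_ge_0[of y] by (metis mult_right_le_imp_le order_le_less)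
  qed simp
  from le[of x] le[of "x\<^sup>\<star>"] show ?thesis by simp
qed

lemma cnorm_one [simp]: "\<parallel>\<one>\<parallel> = 1"
proof -
  have "\<parallel>\<one>\<parallel> * \<parallel>\<one>\<parallel> = \<parallel>\<one>\<parallel> * 1"
    using cnorm_cstar_mult[of \<one>] unfolding power2_eq_square cstar_one cmult_one by simp
  moreover have "\<parallel>\<one>\<parallel> \<noteq> 0" by (simp add: cnorm_eq_0)
  ultimately show ?thesis using mult_left_cancel by blast
qed

lemma sa_iff: "x \<in> sa A \<longleftrightarrow> x\<^sup>\<star> = x"
  by (simp add: sa_def)

definition sc :: "real \<Rightarrow> 'a" where "sc t = complex_of_real t \<cdot> \<one>"

lemma sc_simps [simp]: "sc 0 = \<zero>" "sc 1 = \<one>" "sc s \<otimes> x = complex_of_real s \<cdot> x"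
    "x \<otimes> sc s = complex_of_real s \<cdot> x" "\<parallel>sc s\<parallel> = \<bar>s\<bar>" "(sc s)\<^sup>\<star> = sc s"
    "complex_of_real s \<cdot> sc t = sc (s * t)"
  by (simp_all add: sc_def cnorm_csmult cstar_csmult)

lemma sc_add: "sc (s + t) = sc s \<oplus> sc t" and sc_diff: "sc (s - t) = sc s \<ominus> sc t"
  by (simp_all add: sc_def csmult_add_left csmult_diff_left)

lemma sa_add: "x \<in> sa A \<Longrightarrow> y \<in> sa A \<Longrightarrow> x \<oplus> y \<in> sa A"
  and sa_diff: "x \<in> sa A \<Longrightarrow> y \<in> sa A \<Longrightarrow> x \<ominus> y \<in> sa A"
  and sa_scale: "x \<in> sa A \<Longrightarrow> complex_of_real r \<cdot> x \<in> sa A"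
  and sa_sc [simp]: "sc r \<in> sa A"
  and sa_one [simp]: "\<one> \<in> sa A"
  and sa_zero [simp]: "\<zero> \<in> sa A"
  and sa_cstar_mult: "z\<^sup>\<star> \<otimes> z \<in> sa A"
  and sa_mult_cstar: "z \<otimes> z\<^sup>\<star> \<in> sa A"
  and sa_mult_commute: "x \<in> sa A \<Longrightarrow> y \<in> sa A \<Longrightarrow> x \<otimes> y = y \<otimes> x \<Longrightarrow> x \<otimes> y \<in> sa A"
  by (simp_all add: sa_iff cstar_add cstar_diff cstar_mult cstar_csmult cmult_assoc)

lemma cnorm_sa_square: "x \<in> sa A \<Longrightarrow> \<parallel>x \<otimes> x\<parallel> = \<parallel>x\<parallel>\<^sup>2"
  using cnorm_cstar_mult[of x] by (simp add: sa_iff)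

lemma sa_decomp:
  obtains u v where "u \<in> sa A" "v \<in> sa A" "x = u \<oplus> \<i> \<cdot> v"
proof
  show "(1/2) \<cdot> (x \<oplus> x\<^sup>\<star>) \<in> sa A"
    by (simp add: sa_iff cstar_add cstar_csmult cadd_commute)
  show "(-\<i>/2) \<cdot> (x \<ominus> x\<^sup>\<star>) \<in> sa A"
    by (simp add: sa_iff cstar_diff cstar_csmult)
       (simp add: csub_def csmult_add_right cadd_commute)
  have "(1/2) \<cdot> (x \<oplus> x\<^sup>\<star>) \<oplus> \<i> \<cdot> (-\<i>/2) \<cdot> (x \<ominus> x\<^sup>\<star>) = (1/2) \<cdot> ((x \<oplus> x\<^sup>\<star>) \<oplus> (x \<ominus> x\<^sup>\<star>))"
    by (simp add: csmult_add_right)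
  also have "(x \<oplus> x\<^sup>\<star>) \<oplus> (x \<ominus> x\<^sup>\<star>) = 2 \<cdot> x"
    by (simp add: csmult_2 ring_simps)
  finally show "x = (1/2) \<cdot> (x \<oplus> x\<^sup>\<star>) \<oplus> \<i> \<cdot> ((-\<i>/2) \<cdot> (x \<ominus> x\<^sup>\<star>))" by simp
qed

text \<open>Stands in for uniqueness of limits: equations satisfied by the iterates of a sequence
  pass to its limit through it. \<open>C\<close> may be any real number, so each use keeps the
  constant that its own estimate produces.\<close>

lemma eqI_cnorm_le:
  assumes "\<And>e. e > 0 \<Longrightarrow> \<parallel>x \<ominus> y\<parallel> \<le> C * e"
  shows "x = y"
proof -
  have "\<parallel>x \<ominus> y\<parallel> \<le> 0 + e" if "e > 0" for e
  proof -
    have "\<parallel>x \<ominus> y\<parallel> \<le> C * (e / (\<bar>C\<bar> + 1))"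
      using that by (intro assms divide_pos_pos) auto
    also have "\<dots> \<le> (\<bar>C\<bar> + 1) * (e / (\<bar>C\<bar> + 1))"
      using that by (intro mult_right_mono) auto
    also have "\<dots> = e" by (simp add: add_nonneg_eq_0_iff)
    finally show ?thesis by simp
  qed
  then have "\<parallel>x \<ominus> y\<parallel> \<le> 0" by (rule field_le_epsilon)
  then show ?thesis using cnorm_eq_0[of "x \<ominus> y"] by (simp add: order_antisym)
qed

subsection \<open>Square roots and positivity\<close>

text \<open>The equation for \<open>y\<close> is the fixed-point equation
  \<open>y = (h + y\<^sup>2) / 2\<close>. Let \<open>s\<close> be the smaller root of
  \<open>s\<^sup>2 - 2 s + \<parallel>h\<parallel> = 0\<close>. The right-hand side maps the ball of
  radius \<open>s\<close> into itself and is Lipschitz there with constant \<open>s < 1\<close>, so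
  the iteration from zero converges. Selfadjointness and commutation with the commutant of
  \<open>h\<close> hold for every iterate and pass to the limit.\<close>

lemma sqrt_one_minus:
  assumes h: "h \<in> sa A" and "\<parallel>h\<parallel> < 1"
  shows "\<exists>y. y \<in> sa A \<and> (\<one> \<ominus> y) \<otimes> (\<one> \<ominus> y) = \<one> \<ominus> h \<and>
           (\<forall>z. z \<otimes> h = h \<otimes> z \<longrightarrow> z \<otimes> y = y \<otimes> z)"
proof -
  define s where "s = 1 - sqrt (1 - \<parallel>h\<parallel>)"
  have s: "0 \<le> s" "s < 1" "\<parallel>h\<parallel> + s\<^sup>2 = 2 * s"
    using assms(2) by (auto simp: s_def power2_eq_square algebra_simps)
  define F where "F y = (1/2) \<cdot> (h \<oplus> y \<otimes> y)" for y
  define Y where "Y n = (F ^^ n) \<zero>" for n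
  have Y_Suc: "Y (Suc n) = F (Y n)" and Y_0: "Y 0 = \<zero>" for n
    by (simp_all add: Y_def)
  have F_bound: "\<parallel>F y\<parallel> \<le> s" if "\<parallel>y\<parallel> \<le> s" for y
  proof -
    have "\<parallel>h \<oplus> y \<otimes> y\<parallel> \<le> \<parallel>h\<parallel> + \<parallel>y\<parallel> * \<parallel>y\<parallel>"
      using cnorm_triangle[of h "y \<otimes> y"] cnorm_mult[of y y] by linarith
    also have "\<dots> \<le> \<parallel>h\<parallel> + s * s" using that s by (simp add: mult_mono)
    finally show ?thesis using s(3) by (simp add: F_def cnorm_csmult power2_eq_square)
  qed
  have F_lip: "\<parallel>F y \<ominus> F z\<parallel> \<le> s * \<parallel>y \<ominus> z\<parallel>" if "\<parallel>y\<parallel> \<le> s" "\<parallel>z\<parallel> \<le> s" for y z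
  proof -
    have "F y \<ominus> F z = (1/2) \<cdot> (y \<otimes> (y \<ominus> z) \<oplus> (y \<ominus> z) \<otimes> z)"
      unfolding F_def csmult_diff_right[symmetric] by (simp add: ring_simps)
    moreover have "\<parallel>y \<otimes> (y \<ominus> z) \<oplus> (y \<ominus> z) \<otimes> z\<parallel> \<le> s * \<parallel>y \<ominus> z\<parallel> + \<parallel>y \<ominus> z\<parallel> * s"
      by (intro order_trans[OF cnorm_triangle] add_mono order_trans[OF cnorm_mult]
            mult_right_mono mult_left_mono that cnorm_ge_0)
    ultimately show ?thesis by (simp add: cnorm_csmult)
  qed
  have Yb: "\<parallel>Y n\<parallel> \<le> s" for n
    by (induction n) (auto simp: Y_Suc Y_0 s intro: F_bound)
  have YY: "\<parallel>Y (n + k) \<ominus> Y n\<parallel> \<le> s ^ n" for n k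
  proof (induction n)
    case 0
    show ?case using Yb[of k] s by (simp add: Y_0)
  next
    case (Suc n)
    have "\<parallel>Y (Suc n + k) \<ominus> Y (Suc n)\<parallel> \<le> s * \<parallel>Y (n + k) \<ominus> Y n\<parallel>"
      using F_lip[OF Yb Yb] by (simp add: Y_Suc)
    also have "\<dots> \<le> s * s ^ n" using Suc s by (simp add: mult_left_mono)
    finally show ?case by simp
  qed
  have "\<forall>e>0. \<exists>N. \<forall>m\<ge>N. \<forall>n\<ge>N. \<parallel>Y m \<ominus> Y n\<parallel> < e"
  proof (intro allI impI)
    fix e :: real assume "e > 0"
    then obtain N where N: "s ^ N < e / 2"
      using real_arch_pow_inv[of "e/2" s] s by auto
    have "\<parallel>Y m \<ominus> Y n\<parallel> < e" if "m \<ge> N" "n \<ge> N" for m n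
      using YY[of N "m - N"] YY[of N "n - N"] N cnorm_triangle_sub[of "Y m" "Y n" "Y N"] that
      by (simp add: cnorm_minus_commute[of "Y N"])
    then show "\<exists>N. \<forall>m\<ge>N. \<forall>n\<ge>N. \<parallel>Y m \<ominus> Y n\<parallel> < e" by blast
  qed
  then obtain y where y: "\<And>e. e > 0 \<Longrightarrow> \<exists>N. \<forall>n\<ge>N. \<parallel>Y n \<ominus> y\<parallel> < e"
    using cnorm_complete by blast
  have yb: "\<parallel>y\<parallel> \<le> s"
  proof (rule field_le_epsilon)
    fix e :: real assume "e > 0"
    then obtain n where "\<parallel>Y n \<ominus> y\<parallel> < e" using y by blast
    then show "\<parallel>y\<parallel> \<le> s + e"
      using cnorm_le_diff_add[of y "Y n"] Yb[of n] by (simp add: cnorm_minus_commute)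
  qed
  have fix_y: "F y = y"
  proof (rule eqI_cnorm_le[where C = 2])
    fix e :: real assume "e > 0"
    then obtain N where N: "\<forall>n\<ge>N. \<parallel>Y n \<ominus> y\<parallel> < e" using y by blast
    have "\<parallel>F y \<ominus> Y (Suc N)\<parallel> \<le> s * \<parallel>Y N \<ominus> y\<parallel>"
      using F_lip[OF yb Yb] by (simp add: Y_Suc cnorm_minus_commute)
    also have "\<dots> \<le> 1 * e" using s N by (intro mult_mono) (auto simp: less_imp_le)
    finally have "\<parallel>F y \<ominus> Y (Suc N)\<parallel> \<le> e" by simp
    moreover have "\<parallel>Y (Suc N) \<ominus> y\<parallel> < e" using N by (meson le_Suc_eq order_refl)
    ultimately show "\<parallel>F y \<ominus> y\<parallel> \<le> 2 * e"
      using cnorm_triangle_sub[of "F y" y "Y (Suc N)"] by linarith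
  qed
  have "y\<^sup>\<star> = y"
  proof (rule eqI_cnorm_le[where C = 2])
    fix e :: real assume "e > 0"
    then obtain n where n: "\<parallel>Y n \<ominus> y\<parallel> < e" using y by blast
    have Ysa: "(Y n)\<^sup>\<star> = Y n"
      using h by (induction n) (auto simp: Y_0 Y_Suc F_def sa_iff cstar_csmult cstar_add cstar_mult)
    have "\<parallel>y\<^sup>\<star> \<ominus> Y n\<parallel> = \<parallel>Y n \<ominus> y\<parallel>"
      using cnorm_cstar[of "y \<ominus> Y n"] by (simp add: cstar_diff Ysa cnorm_minus_commute)
    then show "\<parallel>y\<^sup>\<star> \<ominus> y\<parallel> \<le> 2 * e"
      using cnorm_triangle_sub[of "y\<^sup>\<star>" y "Y n"] n by linarith
  qed
  moreover have "z \<otimes> y = y \<otimes> z" if z: "z \<otimes> h = h \<otimes> z" for z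
  proof (rule eqI_cnorm_le[where C = "2 * \<parallel>z\<parallel>"])
    fix e :: real assume "e > 0"
    then obtain n where n: "\<parallel>Y n \<ominus> y\<parallel> < e" using y by blast
    have Yz: "z \<otimes> Y n = Y n \<otimes> z"
    proof (induction n)
      case (Suc n)
      have "z \<otimes> (Y n \<otimes> Y n) = (Y n \<otimes> Y n) \<otimes> z"
        using Suc by (metis cmult_assoc)
      then show ?case
        by (simp add: Y_Suc F_def rng.distrib_left rng.distrib_right z del: rng.mult.assoc)
    qed (simp add: Y_0)
    have "z \<otimes> y \<ominus> y \<otimes> z = (Y n \<ominus> y) \<otimes> z \<ominus> z \<otimes> (Y n \<ominus> y)"
      by (simp add: rng.left_diff_distrib rng.right_diff_distrib Yz) (simp add: ring_simps)
    also have "\<parallel>\<dots>\<parallel> \<le> \<parallel>Y n \<ominus> y\<parallel> * \<parallel>z\<parallel> + \<parallel>z\<parallel> * \<parallel>Y n \<ominus> y\<parallel>"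
      by (intro order_trans[OF cnorm_triangle_diff] add_mono cnorm_mult)
    also have "\<dots> \<le> 2 * \<parallel>z\<parallel> * e"
      using mult_left_mono[OF less_imp_le[OF n] cnorm_ge_0[of z]] by (simp add: mult.commute)
    finally show "\<parallel>z \<otimes> y \<ominus> y \<otimes> z\<parallel> \<le> 2 * \<parallel>z\<parallel> * e" .
  qed
  moreover have "(\<one> \<ominus> y) \<otimes> (\<one> \<ominus> y) = \<one> \<ominus> h"
  proof -
    have "y \<oplus> y = 2 \<cdot> F y" by (simp add: fix_y csmult_2)
    also have "\<dots> = h \<oplus> y \<otimes> y" by (simp add: F_def)
    finally have "y \<oplus> y = h \<oplus> y \<otimes> y" .
    then have "\<one> \<ominus> (y \<oplus> y) \<oplus> y \<otimes> y = \<one> \<ominus> h" by (simp add: ring_simps)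
    then show ?thesis by (simp add: ring_simps)
  qed
  ultimately show ?thesis by (auto simp: sa_iff)
qed

text \<open>Scaling by \<open>1/t\<close> reduces this to the unit case. Keeping track of
  commutation is what later supplies commuting pairs for
  \<open>cnorm_le_of_sum_squares\<close>.\<close>

lemma sqrt_exists:
  assumes h: "h \<in> sa A" and ht: "\<parallel>h\<parallel> < t"
  obtains d where "d \<in> sa A" "d \<otimes> d = sc t \<ominus> h" "\<And>z. z \<otimes> h = h \<otimes> z \<Longrightarrow> z \<otimes> d = d \<otimes> z"
proof -
  have t: "t > 0" using ht cnorm_ge_0[of h] by linarith
  let ?r = "\<lambda>x. complex_of_real x"
  define g where "g = ?r (1/t) \<cdot> h"
  have "g \<in> sa A" using h sa_scale[of h "1/t"] by (simp add: g_def)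
  moreover have "\<parallel>g\<parallel> < 1" using ht t by (simp add: g_def cnorm_csmult norm_divide)
  ultimately obtain y where y: "y \<in> sa A" "(\<one> \<ominus> y) \<otimes> (\<one> \<ominus> y) = \<one> \<ominus> g"
      "\<And>z. z \<otimes> g = g \<otimes> z \<Longrightarrow> z \<otimes> y = y \<otimes> z"
    using sqrt_one_minus by blast
  show ?thesis
  proof
    show "?r (sqrt t) \<cdot> (\<one> \<ominus> y) \<in> sa A" using y by (intro sa_scale sa_diff sa_one)
    have "(?r (sqrt t) \<cdot> (\<one> \<ominus> y)) \<otimes> (?r (sqrt t) \<cdot> (\<one> \<ominus> y)) = ?r t \<cdot> (\<one> \<ominus> g)"
      using t by (simp add: y(2) flip: of_real_mult)
    also have "\<dots> = sc t \<ominus> h" using t by (simp add: csmult_diff_right g_def sc_def)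
    finally show "(?r (sqrt t) \<cdot> (\<one> \<ominus> y)) \<otimes> (?r (sqrt t) \<cdot> (\<one> \<ominus> y)) = sc t \<ominus> h" .
  next
    fix z assume "z \<otimes> h = h \<otimes> z"
    then have "z \<otimes> y = y \<otimes> z" by (intro y) (simp add: g_def)
    then show "z \<otimes> ?r (sqrt t) \<cdot> (\<one> \<ominus> y) = ?r (sqrt t) \<cdot> (\<one> \<ominus> y) \<otimes> z"
      by (simp add: rng.left_diff_distrib rng.right_diff_distrib)
  qed
qed

text \<open>The normal element \<open>x = d + \<i> e\<close> satisfies \<open>x\<^sup>\<star> x = r\<close>, and \<open>d\<close> is its real part.\<close>
lemma cnorm_le_of_sum_squares:
  assumes d: "d \<in> sa A" and e: "e \<in> sa A" and de: "d \<otimes> e = e \<otimes> d"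
    and sum: "d \<otimes> d \<oplus> e \<otimes> e = sc r" and r: "r \<ge> 0"
  shows "\<parallel>d\<parallel>\<^sup>2 \<le> r"
proof -
  define x where "x = d \<oplus> \<i> \<cdot> e"
  have xs: "x\<^sup>\<star> = d \<ominus> \<i> \<cdot> e"
    using d e by (simp add: x_def cstar_add cstar_csmult sa_iff csub_def)
  have "x\<^sup>\<star> \<otimes> x = d \<otimes> d \<oplus> e \<otimes> e"
    unfolding xs unfolding x_def
    by (simp add: rng.distrib_left rng.distrib_right rng.left_diff_distrib de csmult_add_right)
       (simp add: csmult_diff_right ring_simps)
  then have "\<parallel>x\<parallel>\<^sup>2 = r" using cnorm_cstar_mult[of x] r by (simp add: sum)
  have "2 \<cdot> d = x \<oplus> x\<^sup>\<star>" unfolding xs by (simp add: csmult_2 x_def ring_simps)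
  then have "2 * \<parallel>d\<parallel> \<le> \<parallel>x\<parallel> + \<parallel>x\<^sup>\<star>\<parallel>"
    using cnorm_triangle[of x "x\<^sup>\<star>"] cnorm_csmult[of 2 d] by simp
  then have "\<parallel>d\<parallel> \<le> \<parallel>x\<parallel>" by simp
  then have "\<parallel>d\<parallel>\<^sup>2 \<le> \<parallel>x\<parallel>\<^sup>2" by (intro power_mono) auto
  then show ?thesis using \<open>\<parallel>x\<parallel>\<^sup>2 = r\<close> by simp
qed

text \<open>In spectral terms, the spectrum of \<open>h\<close> lies in \<open>[0, 2t]\<close>. In
  this form sums are handled by the triangle inequality alone, and the work is moved to
  squares.\<close>

definition posel :: "'a \<Rightarrow> bool"
  where "posel h \<longleftrightarrow> h \<in> sa A \<and> (\<exists>t. \<parallel>sc t \<ominus> h\<parallel> \<le> t)"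

lemma cnorm_sc_minus_mono:
  assumes "\<parallel>sc t \<ominus> h\<parallel> \<le> t" "t \<le> s"
  shows "\<parallel>sc s \<ominus> h\<parallel> \<le> s"
proof -
  have "sc s \<ominus> h = sc (s - t) \<oplus> (sc t \<ominus> h)" by (simp add: sc_diff ring_simps)
  then show ?thesis using assms cnorm_triangle[of "sc (s - t)" "sc t \<ominus> h"] by simp
qed

lemma posel_add: assumes "posel h" "posel k" shows "posel (h \<oplus> k)"
proof -
  obtain s t where st: "\<parallel>sc s \<ominus> h\<parallel> \<le> s" "\<parallel>sc t \<ominus> k\<parallel> \<le> t" using assms by (auto simp: posel_def)
  have "sc (s + t) \<ominus> (h \<oplus> k) = (sc s \<ominus> h) \<oplus> (sc t \<ominus> k)" by (simp add: sc_add ring_simps)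
  then have "\<parallel>sc (s + t) \<ominus> (h \<oplus> k)\<parallel> \<le> s + t"
    using cnorm_triangle[of "sc s \<ominus> h" "sc t \<ominus> k"] st by simp
  with assms show ?thesis unfolding posel_def by (blast intro: sa_add)
qed

lemma posel_scale: assumes "posel h" "0 \<le> r" shows "posel (complex_of_real r \<cdot> h)"
proof -
  obtain t where t: "\<parallel>sc t \<ominus> h\<parallel> \<le> t" using assms by (auto simp: posel_def)
  have "sc (r * t) \<ominus> complex_of_real r \<cdot> h = complex_of_real r \<cdot> (sc t \<ominus> h)"
    by (simp add: csmult_diff_right)
  then have "\<parallel>sc (r * t) \<ominus> complex_of_real r \<cdot> h\<parallel> \<le> r * t"
    using t assms by (simp add: cnorm_csmult mult_left_mono)
  with assms show ?thesis unfolding posel_def by (blast intro: sa_scale)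
qed

lemma posel_scale_iff: assumes "0 < r" shows "posel (complex_of_real r \<cdot> h) \<longleftrightarrow> posel h"
proof
  assume "posel (complex_of_real r \<cdot> h)"
  from posel_scale[OF this, of "1/r"] assms show "posel h" by simp
qed (use assms in \<open>simp add: posel_scale\<close>)

lemma posel_sc: "0 \<le> r \<Longrightarrow> posel (sc r)"
  unfolding posel_def by (auto intro!: exI[of _ r])

text \<open>For \<open>t > \<parallel>k\<parallel>\<close> let \<open>d\<close> be the root of
  \<open>t\<^sup>2 - k\<^sup>2\<close>. Then \<open>d\<^sup>2 + k\<^sup>2 = t\<^sup>2\<close> with
  commuting summands, so \<open>\<parallel>t\<^sup>2 - k\<^sup>2\<parallel> =
  \<parallel>d\<parallel>\<^sup>2 \<le> t\<^sup>2\<close>.\<close>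

lemma posel_square: assumes "k \<in> sa A" shows "posel (k \<otimes> k)"
proof -
  define t where "t = \<parallel>k\<parallel> + 1"
  have t: "t > 0" "\<parallel>k\<parallel> < t" using cnorm_ge_0[of k] by (auto simp: t_def intro: add_nonneg_pos)
  have "\<parallel>k \<otimes> k\<parallel> < t\<^sup>2" using t assms by (simp add: cnorm_sa_square power_strict_mono)
  moreover have sk: "k \<otimes> k \<in> sa A" using assms by (simp add: sa_mult_commute)
  ultimately obtain d where d: "d \<in> sa A" "d \<otimes> d = sc (t\<^sup>2) \<ominus> k \<otimes> k" "k \<otimes> d = d \<otimes> k"
    using sqrt_exists[of "k \<otimes> k" "t\<^sup>2"] by (metis cmult_assoc)
  have "\<parallel>d\<parallel>\<^sup>2 \<le> t\<^sup>2"
    by (rule cnorm_le_of_sum_squares[of d k]) (use d assms in auto)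
  then have "\<parallel>sc (t\<^sup>2) \<ominus> k \<otimes> k\<parallel> \<le> t\<^sup>2" using d cnorm_sa_square by metis
  with sk show ?thesis unfolding posel_def by blast
qed

text \<open>Square roots are available under a strict norm inequality only. Adding \<delta> provides
  it: \<open>h + \<delta> = (t + \<delta>) - (t - h)\<close>, where
  \<open>\<parallel>t - h\<parallel> \<le> t < t + \<delta>\<close>.\<close>

lemma posel_sqrt:
  assumes "posel h" "\<delta> > 0"
  obtains d where "d \<in> sa A" "d \<otimes> d = h \<oplus> sc \<delta>" "\<And>z. z \<otimes> h = h \<otimes> z \<Longrightarrow> z \<otimes> d = d \<otimes> z"
proof -
  obtain t where t: "\<parallel>sc t \<ominus> h\<parallel> \<le> t" "h \<in> sa A" using assms by (auto simp: posel_def)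
  have "sc t \<ominus> h \<in> sa A" using t by (simp add: sa_diff)
  moreover have "\<parallel>sc t \<ominus> h\<parallel> < t + \<delta>" using t assms by simp
  ultimately obtain d where d: "d \<in> sa A" "d \<otimes> d = sc (t + \<delta>) \<ominus> (sc t \<ominus> h)"
      "\<And>z. z \<otimes> (sc t \<ominus> h) = (sc t \<ominus> h) \<otimes> z \<Longrightarrow> z \<otimes> d = d \<otimes> z"
    using sqrt_exists by blast
  show ?thesis
  proof
    show "d \<in> sa A" by fact
    show "d \<otimes> d = h \<oplus> sc \<delta>" unfolding d(2) by (simp add: sc_add ring_simps)
    show "z \<otimes> d = d \<otimes> z" if "z \<otimes> h = h \<otimes> z" for z
      using that by (intro d) (simp add: rng.left_diff_distrib rng.right_diff_distrib)
  qed
qed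

text \<open>Up to \<delta>, let \<open>d\<close> and \<open>e\<close> be commuting roots of
  \<open>s + a\<close> and \<open>s - a\<close>. Their squares add up to \<open>2 s\<close>, so
  \<open>\<parallel>d\<^sup>2\<parallel> \<le> 2 s\<close>, and passing from
  \<open>d\<^sup>2\<close> to \<open>a = d\<^sup>2 - s\<close> costs another \<open>s\<close>. This
  is the origin of the factor 3.\<close>

lemma cnorm_le_of_posel:
  assumes "posel (sc s \<ominus> a)" "posel (sc s \<oplus> a)" "a \<in> sa A"
  shows "\<parallel>a\<parallel> \<le> 3 * s"
proof -
  have le: "\<parallel>a\<parallel> \<le> 3 * (s + \<delta>)" if \<delta>: "\<delta> > 0" for \<delta>
  proof -
    obtain d where d: "d \<in> sa A" "d \<otimes> d = (sc s \<oplus> a) \<oplus> sc \<delta>"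
        "\<And>z. z \<otimes> (sc s \<oplus> a) = (sc s \<oplus> a) \<otimes> z \<Longrightarrow> z \<otimes> d = d \<otimes> z"
      using posel_sqrt[OF assms(2) \<delta>] by blast
    obtain e where e: "e \<in> sa A" "e \<otimes> e = (sc s \<ominus> a) \<oplus> sc \<delta>"
        "\<And>z. z \<otimes> (sc s \<ominus> a) = (sc s \<ominus> a) \<otimes> z \<Longrightarrow> z \<otimes> e = e \<otimes> z"
      using posel_sqrt[OF assms(1) \<delta>] by blast
    have "a \<otimes> d = d \<otimes> a" by (rule d(3)) (simp add: rng.distrib_left rng.distrib_right)
    then have de: "d \<otimes> e = e \<otimes> d"
      by (intro e(3)) (simp add: rng.left_diff_distrib rng.right_diff_distrib)
    have sum: "d \<otimes> d \<oplus> e \<otimes> e = sc (2 * (s + \<delta>))"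
      unfolding d e using sc_add[of "s + \<delta>" "s + \<delta>"] by (simp add: sc_add ring_simps)
    \<comment> \<open>The sign of \<open>s\<close> is not given; it is read off from a scalar that
      is a sum of two squares and hence positive.\<close>
    have "0 \<le> s + \<delta>"
    proof -
      have "posel (sc (2 * (s + \<delta>)))"
        unfolding sum[symmetric] by (intro posel_add posel_square d e)
      then obtain t where "\<bar>t - 2 * (s + \<delta>)\<bar> \<le> t"
        unfolding posel_def using sc_simps(5) by (metis sc_diff)
      then show ?thesis by (simp add: abs_le_iff)
    qed
    then have "\<parallel>d\<parallel>\<^sup>2 \<le> 2 * (s + \<delta>)"
      using cnorm_le_of_sum_squares[OF d(1) e(1) de sum] by simp
    then have "\<parallel>d \<otimes> d\<parallel> \<le> 2 * (s + \<delta>)" using cnorm_sa_square d(1) by simp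
    moreover have "a = d \<otimes> d \<ominus> sc (s + \<delta>)" unfolding d by (simp add: sc_add ring_simps)
    ultimately show ?thesis
      using cnorm_triangle_diff[of "d \<otimes> d" "sc (s + \<delta>)"] \<open>0 \<le> s + \<delta>\<close> by simp
  qed
  show ?thesis
  proof (rule field_le_epsilon)
    fix e :: real assume "e > 0"
    then show "\<parallel>a\<parallel> \<le> 3 * s + e" using le[of "e / 3"] by simp
  qed
qed

section \<open>Powers and the growth of their norms\<close>

primrec cpow :: "'a \<Rightarrow> nat \<Rightarrow> 'a" where
  "cpow x 0 = \<one>"
| "cpow x (Suc n) = x \<otimes> cpow x n"

lemma cpow_add: "cpow x (m + n) = cpow x m \<otimes> cpow x n"
  by (induction m) (simp_all add: cmult_assoc)

lemma cpow_commute: "z \<otimes> x = x \<otimes> z \<Longrightarrow> z \<otimes> cpow x n = cpow x n \<otimes> z"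
  by (induction n) (auto, metis cmult_assoc)

lemma cpow_sa: "x \<in> sa A \<Longrightarrow> cpow x n \<in> sa A"
  by (induction n) (auto intro!: sa_mult_commute cpow_commute)

lemma cnorm_cpow_le: "\<parallel>cpow x n\<parallel> \<le> \<parallel>x\<parallel> ^ n"
proof (induction n)
  case (Suc n)
  have "\<parallel>cpow x (Suc n)\<parallel> \<le> \<parallel>x\<parallel> * \<parallel>cpow x n\<parallel>" by (simp add: cnorm_mult)
  also have "\<dots> \<le> \<parallel>x\<parallel> * \<parallel>x\<parallel> ^ n" using Suc by (simp add: mult_left_mono)
  finally show ?case by simp
qed simp

text \<open>Repeated squaring, each power being selfadjoint again. Exponents that are powers of two
  suffice, because growth estimates are tested along this subsequence only.\<close>

lemma cnorm_cpow_power2: "x \<in> sa A \<Longrightarrow> \<parallel>cpow x (2 ^ k)\<parallel> = \<parallel>x\<parallel> ^ (2 ^ k)"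
proof (induction k)
  case (Suc k)
  have "cpow x (2 ^ Suc k) = cpow x (2 ^ k) \<otimes> cpow x (2 ^ k)"
    by (simp add: cpow_add[symmetric] mult_2)
  then show ?case
    using Suc cnorm_sa_square[OF cpow_sa[OF Suc.prems]] by (simp add: power_mult[symmetric] mult.commute)
qed simp

text \<open>For selfadjoint elements the norm is the spectral radius, so that polynomial corrections
  to a geometric bound on the powers do not matter.\<close>
lemma cnorm_le_of_power_growth:
  assumes v: "v \<in> sa A" and T: "T > 0"
    and grow: "\<And>n. \<parallel>cpow v n\<parallel> \<le> T ^ n * (1 + real n * C)"
  shows "\<parallel>v\<parallel> \<le> T"
proof (rule ccontr)
  assume "\<not> \<parallel>v\<parallel> \<le> T"
  define q where "q = \<parallel>v\<parallel> / T"
  have q: "q > 1" using \<open>\<not> \<parallel>v\<parallel> \<le> T\<close> T by (simp add: q_def)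
  have "1 \<le> 1 / q ^ (2 ^ k) + C * (real (2 ^ k) / q ^ (2 ^ k))" for k
  proof -
    have "\<parallel>v\<parallel> ^ (2 ^ k) \<le> T ^ (2 ^ k) * (1 + real (2 ^ k) * C)"
      using grow[of "2 ^ k"] cnorm_cpow_power2[OF v] by simp
    then have "q ^ (2 ^ k) \<le> 1 + real (2 ^ k) * C"
      using T by (simp add: q_def power_divide divide_le_eq mult.commute)
    then show ?thesis using q by (simp add: field_simps)
  qed
  moreover have "(\<lambda>n. 1 / q ^ n + C * (real n / q ^ n)) \<longlonglongrightarrow> 0 + C * 0"
    using q by (intro tendsto_intros LIMSEQ_divide_realpow_zero lim_n_over_pown[of q]) auto
  then have "((\<lambda>n. 1 / q ^ n + C * (real n / q ^ n)) \<circ> (\<lambda>k. 2 ^ k)) \<longlonglongrightarrow> 0 + C * 0"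
    by (rule LIMSEQ_subseq_LIMSEQ) (simp add: strict_mono_def)
  ultimately have "1 \<le> 0 + C * 0"
    by (intro LIMSEQ_le_const[where X = "(\<lambda>n. 1 / q ^ n + C * (real n / q ^ n)) \<circ> (\<lambda>k. 2 ^ k)"]) auto
  then show False by simp
qed

text \<open>An inhomogeneous term with the same geometric rate as the recursion adds only a linear
  factor: \<open>\<parallel>cpow v n\<parallel> \<le> T ^ n * (1 + n * C / T)\<close>.\<close>

lemma cnorm_le_of_step_growth:
  assumes v: "v \<in> sa A" and T: "T > 0"
    and step: "\<And>n. \<parallel>cpow v (Suc n)\<parallel> \<le> T * \<parallel>cpow v n\<parallel> + C * T ^ n"
  shows "\<parallel>v\<parallel> \<le> T"
proof (rule cnorm_le_of_power_growth[OF v T])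
  show "\<parallel>cpow v n\<parallel> \<le> T ^ n * (1 + real n * (C / T))" for n
  proof (induction n)
    case (Suc n)
    have "\<parallel>cpow v (Suc n)\<parallel> \<le> T * (T ^ n * (1 + real n * (C / T))) + C * T ^ n"
      using step[of n] mult_left_mono[OF Suc, of T] T by linarith
    also have "\<dots> = T ^ Suc n * (1 + real (Suc n) * (C / T))"
      using T by (simp add: field_simps)
    finally show ?case .
  qed simp
qed

text \<open>This replaces the comparison of the spectra of \<open>x\<^sup>\<star> x\<close> and \<open>x x\<^sup>\<star>\<close>: for a polynomial \<open>p\<close>,
  \<open>p (x x\<^sup>\<star>) x x\<^sup>\<star> = x p (x\<^sup>\<star> x) x\<^sup>\<star>\<close>.\<close>
lemma posel_sc_minus_mult_cstar:
  assumes "posel (sc s \<ominus> x\<^sup>\<star> \<otimes> x)" "0 \<le> s"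
  shows "posel (sc s \<ominus> x \<otimes> x\<^sup>\<star>)"
proof -
  obtain t where t: "\<parallel>sc t \<ominus> (sc s \<ominus> x\<^sup>\<star> \<otimes> x)\<parallel> \<le> t" using assms by (auto simp: posel_def)
  \<comment> \<open>\<open>T\<close> dominates \<open>t\<close>, so that the bound on
    \<open>u\<close> persists, and \<open>s\<close>, so that \<open>\<tau> \<ge> 0\<close>; the 1
    makes it positive.\<close>
  define T where "T = max t (max 1 s)"
  define \<tau> where "\<tau> = T - s"
  define u where "u = sc \<tau> \<oplus> x\<^sup>\<star> \<otimes> x"
  define v where "v = sc \<tau> \<oplus> x \<otimes> x\<^sup>\<star>"
  have "sc T \<ominus> (sc s \<ominus> x\<^sup>\<star> \<otimes> x) = u" and vT: "sc T \<ominus> (sc s \<ominus> x \<otimes> x\<^sup>\<star>) = v"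
    by (simp_all add: u_def v_def \<tau>_def sc_diff ring_simps)
  then have u: "\<parallel>u\<parallel> \<le> T" using cnorm_sc_minus_mono[OF t, of T] by (simp add: T_def)
  have T: "T > 0" "\<tau> \<ge> 0" "\<tau> \<le> T" using assms(2) by (auto simp: T_def \<tau>_def)
  have xu: "x \<otimes> cpow u n = cpow v n \<otimes> x" for n
  proof (induction n)
    case (Suc n)
    have "x \<otimes> cpow u (Suc n) = v \<otimes> (x \<otimes> cpow u n)"
      by (simp add: u_def v_def rng.distrib_left rng.distrib_right cmult_assoc)
    then show ?case by (simp add: Suc cmult_assoc)
  qed simp
  have vsa: "v \<in> sa A" by (simp add: v_def sa_add sa_mult_cstar)
  have "\<parallel>v\<parallel> \<le> T"
  proof (rule cnorm_le_of_step_growth[OF vsa T(1)])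
    fix n
    have "cpow v (Suc n) = cpow v n \<otimes> v" using cpow_commute[of v v n] by simp
    also have "\<dots> = complex_of_real \<tau> \<cdot> cpow v n \<oplus> cpow v n \<otimes> (x \<otimes> x\<^sup>\<star>)"
      by (subst (2) v_def) (simp add: rng.distrib_left)
    also have "cpow v n \<otimes> (x \<otimes> x\<^sup>\<star>) = x \<otimes> cpow u n \<otimes> x\<^sup>\<star>" by (simp add: xu cmult_assoc)
    also have "\<parallel>complex_of_real \<tau> \<cdot> cpow v n \<oplus> x \<otimes> cpow u n \<otimes> x\<^sup>\<star>\<parallel>
        \<le> \<parallel>complex_of_real \<tau> \<cdot> cpow v n\<parallel> + \<parallel>x \<otimes> cpow u n \<otimes> x\<^sup>\<star>\<parallel>" by (rule cnorm_triangle)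
    also have "\<parallel>complex_of_real \<tau> \<cdot> cpow v n\<parallel> \<le> T * \<parallel>cpow v n\<parallel>"
      using T by (simp add: cnorm_csmult mult_right_mono)
    also have "\<parallel>x \<otimes> cpow u n \<otimes> x\<^sup>\<star>\<parallel> \<le> \<parallel>x\<parallel> * \<parallel>cpow u n\<parallel> * \<parallel>x\<parallel>"
      using order_trans[OF cnorm_mult mult_right_mono[OF cnorm_mult]] by (metis cnorm_cstar cnorm_ge_0)
    also have "\<parallel>x\<parallel> * \<parallel>cpow u n\<parallel> * \<parallel>x\<parallel> \<le> \<parallel>x\<parallel> * T ^ n * \<parallel>x\<parallel>"
      using order_trans[OF cnorm_cpow_le power_mono[OF u]]
      by (intro mult_right_mono mult_left_mono) auto
    finally show "\<parallel>cpow v (Suc n)\<parallel> \<le> T * \<parallel>cpow v n\<parallel> + (\<parallel>x\<parallel> * \<parallel>x\<parallel>) * T ^ n"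
      by (simp add: mult_ac)
  qed
  moreover have "sc s \<ominus> x \<otimes> x\<^sup>\<star> \<in> sa A" by (simp add: sa_diff sa_mult_cstar)
  ultimately show ?thesis unfolding posel_def using vT by (intro conjI exI[of _ T]) simp_all
qed

text \<open>Up to a factor, \<open>u\<close> and \<open>v\<close> are the real and imaginary parts
  of \<open>x\<close>; in \<open>u\<^sup>2 + v\<^sup>2\<close> the terms \<open>x\<^sup>2\<close>
  and their adjoints cancel.\<close>

lemma posel_cstar_mult_add_mult_cstar: "posel (x\<^sup>\<star> \<otimes> x \<oplus> x \<otimes> x\<^sup>\<star>)"
proof -
  define u v where "u = x \<oplus> x\<^sup>\<star>" and "v = \<i> \<cdot> (x \<ominus> x\<^sup>\<star>)"
  have "u \<in> sa A" by (simp add: u_def sa_iff cstar_add cadd_commute)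
  moreover have "v \<in> sa A"
    by (simp add: v_def sa_iff cstar_csmult cstar_diff)
       (simp add: csub_def csmult_add_right cadd_commute)
  ultimately have "posel (u \<otimes> u \<oplus> v \<otimes> v)" by (intro posel_add posel_square)
  also have "u \<otimes> u \<oplus> v \<otimes> v = u \<otimes> u \<ominus> (x \<ominus> x\<^sup>\<star>) \<otimes> (x \<ominus> x\<^sup>\<star>)"
    by (simp add: v_def csub_def)
  also have "\<dots> = 2 \<cdot> (x\<^sup>\<star> \<otimes> x \<oplus> x \<otimes> x\<^sup>\<star>)"
    by (simp add: u_def csmult_2 ring_simps)
  finally show ?thesis using posel_scale_iff[of 2] by simp
qed

text \<open>Converts an upper bound for \<open>x\<^sup>\<star> \<otimes> x\<close> into a lower
  bound while its positivity is still unknown: the upper bound passes to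
  \<open>x \<otimes> x\<^sup>\<star>\<close>, and the sum of the two products is positive. With both
  bounds, \<open>cnorm_le_of_posel\<close> applies.\<close>

lemma posel_sc_plus_cstar_mult:
  assumes "posel (sc s \<ominus> x\<^sup>\<star> \<otimes> x)" "0 \<le> s"
  shows "posel (sc s \<oplus> x\<^sup>\<star> \<otimes> x)"
proof -
  have "sc s \<oplus> x\<^sup>\<star> \<otimes> x = (sc s \<ominus> x \<otimes> x\<^sup>\<star>) \<oplus> (x\<^sup>\<star> \<otimes> x \<oplus> x \<otimes> x\<^sup>\<star>)"
    by (simp add: ring_simps)
  then show ?thesis
    using posel_add[OF posel_sc_minus_mult_cstar[OF assms] posel_cstar_mult_add_mult_cstar] by simp
qed

text \<open>With \<open>w = 1 - y\<^sup>\<star> y = d\<^sup>2\<close> and \<open>x = y d\<^sup>m\<close>, the element \<open>1 - x\<^sup>\<star> x = 1 - (1 - w) w\<^sup>m\<close> is the sum of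
  \<open>w\<close> and of the squares of \<open>(1 - w) d\<^sup>j\<close> for \<open>j < m\<close>. Hence \<open>(1 - w) w\<^sup>m\<close> stays bounded as
  \<open>m\<close> grows, which rules out that \<open>w\<close> has norm greater than 1.\<close>
lemma posel_cstar_mult_aux:
  assumes y: "\<parallel>y\<parallel> < 1"
  shows "posel (y\<^sup>\<star> \<otimes> y)"
proof -
  define h where "h = y\<^sup>\<star> \<otimes> y"
  have hsa: "h \<in> sa A" by (simp add: h_def sa_cstar_mult)
  have "\<parallel>h\<parallel> < 1" using y by (simp add: h_def cnorm_cstar_mult power_less_one_iff)
  then obtain d where d: "d \<in> sa A" "d \<otimes> d = \<one> \<ominus> h" and "h \<otimes> d = d \<otimes> h"
    using sqrt_exists[OF hsa, of 1] by (metis sc_simps(2))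
  define w where "w = d \<otimes> d"
  have wh: "h = \<one> \<ominus> w" by (simp add: w_def d ring_simps)
  have wsa: "w \<in> sa A" using d(1) by (simp add: w_def sa_mult_commute)
  have dpow: "cpow d m \<otimes> cpow d m = cpow w m" for m
  proof (induction m)
    case (Suc m)
    have "cpow d (Suc m) \<otimes> cpow d (Suc m) = d \<otimes> (cpow d m \<otimes> d) \<otimes> cpow d m"
      by (simp add: cmult_assoc)
    also have "\<dots> = w \<otimes> (cpow d m \<otimes> cpow d m)"
      by (simp add: cpow_commute[of d d m, symmetric] w_def cmult_assoc)
    finally show ?case by (simp add: Suc)
  qed simp
  have hd: "h \<otimes> cpow d m = cpow d m \<otimes> h" for m by (rule cpow_commute) fact
  have xx: "(y \<otimes> cpow d m)\<^sup>\<star> \<otimes> (y \<otimes> cpow d m) = h \<otimes> cpow w m" for m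
  proof -
    have "(y \<otimes> cpow d m)\<^sup>\<star> \<otimes> (y \<otimes> cpow d m) = (cpow d m \<otimes> h) \<otimes> cpow d m"
      using cpow_sa[OF d(1), of m] by (simp add: cstar_mult h_def sa_iff cmult_assoc)
    also have "\<dots> = h \<otimes> cpow w m" by (simp add: hd[symmetric] cmult_assoc dpow)
    finally show ?thesis .
  qed
  have pos: "posel (\<one> \<ominus> h \<otimes> cpow w m)" for m
  proof (induction m)
    case 0
    show ?case using posel_square[OF d(1)] d(2) by simp
  next
    case (Suc m)
    have "(h \<otimes> cpow d m) \<otimes> (h \<otimes> cpow d m) = h \<otimes> (cpow d m \<otimes> h) \<otimes> cpow d m"
      by (simp add: cmult_assoc)
    also have "\<dots> = h \<otimes> (h \<otimes> cpow w m)" by (simp add: hd[symmetric] cmult_assoc dpow)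
    finally have sq: "h \<otimes> (h \<otimes> cpow w m) = (h \<otimes> cpow d m) \<otimes> (h \<otimes> cpow d m)" ..
    have "\<one> \<ominus> h \<otimes> cpow w (Suc m) = (\<one> \<ominus> h \<otimes> cpow w m) \<oplus> h \<otimes> ((\<one> \<ominus> w) \<otimes> cpow w m)"
      by (simp add: ring_simps)
    also have "h \<otimes> ((\<one> \<ominus> w) \<otimes> cpow w m) = (h \<otimes> cpow d m) \<otimes> (h \<otimes> cpow d m)"
      by (simp add: sq flip: wh)
    finally show ?case
      using posel_add[OF Suc posel_square[of "h \<otimes> cpow d m"]] hsa cpow_sa[OF d(1)] hd
      by (simp add: sa_mult_commute)
  qed
  have bound: "\<parallel>h \<otimes> cpow w m\<parallel> \<le> 3" for m
  proof -
    have "posel (sc 1 \<ominus> h \<otimes> cpow w m)" using pos by simp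
    moreover from this have "posel (sc 1 \<oplus> h \<otimes> cpow w m)"
      unfolding xx[symmetric] by (rule posel_sc_plus_cstar_mult) simp
    moreover have "h \<otimes> cpow w m \<in> sa A" unfolding xx[symmetric] by (rule sa_cstar_mult)
    ultimately show ?thesis using cnorm_le_of_posel[of 1] by simp
  qed
  \<comment> \<open>Consecutive powers of \<open>w\<close> differ by
    \<open>h \<otimes> cpow w n\<close>, which is bounded by 3, so their norms grow at most
    linearly. As \<open>w = 1 - h\<close>, the conclusion is positivity of \<open>h\<close> with
    witness \<open>t = 1\<close>.\<close>
  have "\<parallel>w\<parallel> \<le> 1"
  proof (rule cnorm_le_of_step_growth[OF wsa, where C = 3])
    fix n
    have "cpow w (Suc n) = cpow w n \<ominus> h \<otimes> cpow w n" by (simp add: wh ring_simps)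
    then show "\<parallel>cpow w (Suc n)\<parallel> \<le> 1 * \<parallel>cpow w n\<parallel> + 3 * 1 ^ n"
      using cnorm_triangle_diff[of "cpow w n" "h \<otimes> cpow w n"] bound[of n] by simp
  qed simp
  then have "\<parallel>sc 1 \<ominus> h\<parallel> \<le> 1" by (simp add: wh ring_simps)
  with hsa show ?thesis unfolding posel_def h_def by blast
qed

theorem posel_cstar_mult: "posel (y\<^sup>\<star> \<otimes> y)"
proof -
  define r where "r = 1 / (\<parallel>y\<parallel> + 1)"
  have r: "0 < r" by (simp add: r_def add_nonneg_pos)
  have "r * \<parallel>y\<parallel> < 1"
    using add_nonneg_pos[OF cnorm_ge_0[of y], of 1] by (simp add: r_def divide_less_eq)
  then have "\<parallel>complex_of_real r \<cdot> y\<parallel> < 1" using r by (simp add: cnorm_csmult)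
  from posel_cstar_mult_aux[OF this] have "posel (complex_of_real (r * r) \<cdot> (y\<^sup>\<star> \<otimes> y))"
    by (simp add: cstar_csmult)
  then show ?thesis using posel_scale_iff[of "r * r"] r by simp
qed

subsection \<open>States\<close>

context
  fixes \<phi> assumes \<phi>: "\<phi> \<in> states A"
begin

lemma state_add: "\<phi> (x \<oplus> y) = \<phi> x + \<phi> y"
  and state_csmult: "\<phi> (c \<cdot> x) = c * \<phi> x"
  and state_one: "\<phi> \<one> = 1"
  and state_pos: "Im (\<phi> (x\<^sup>\<star> \<otimes> x)) = 0" "0 \<le> Re (\<phi> (x\<^sup>\<star> \<otimes> x))"
  using \<phi> by (auto simp: states_def)

lemma state_diff: "\<phi> (x \<ominus> y) = \<phi> x - \<phi> y"
  by (simp add: csub_def state_add state_csmult)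

lemma state_sc: "\<phi> (sc r) = complex_of_real r"
  by (simp add: sc_def state_csmult state_one)

lemma state_zero: "\<phi> \<zero> = 0"
  using state_csmult[of 0 \<zero>] by simp

text \<open>Positivity speaks of the elements \<open>y\<^sup>\<star> \<otimes> y\<close> only;
  taking \<open>y = 1 + h\<close> brings in \<open>h\<close> as the cross term.\<close>

lemma state_sa_real: assumes "h \<in> sa A" shows "Im (\<phi> h) = 0"
proof -
  have "(\<one> \<oplus> h)\<^sup>\<star> \<otimes> (\<one> \<oplus> h) = \<one> \<oplus> 2 \<cdot> h \<oplus> h\<^sup>\<star> \<otimes> h"
    using assms by (simp add: sa_iff cstar_add csmult_2 ring_simps)
  then have "Im (\<phi> (\<one> \<oplus> 2 \<cdot> h \<oplus> h\<^sup>\<star> \<otimes> h)) = 0" using state_pos(1) by metis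
  then show ?thesis using state_pos(1)[of h] by (simp add: state_add state_csmult state_one)
qed

lemma state_cstar: "\<phi> (x\<^sup>\<star>) = cnj (\<phi> x)"
proof -
  obtain u v where uv: "u \<in> sa A" "v \<in> sa A" "x = u \<oplus> \<i> \<cdot> v" by (rule sa_decomp)
  then have "x\<^sup>\<star> = u \<oplus> (-\<i>) \<cdot> v" by (simp add: cstar_add cstar_csmult sa_iff)
  then show ?thesis
    using state_sa_real[OF uv(1)] state_sa_real[OF uv(2)]
    by (simp add: uv(3) state_add state_csmult complex_eq_iff)
qed

text \<open>The Cauchy-Schwarz inequality against the unit: apply positivity to
  \<open>x - \<phi> x\<close>.\<close>

lemma state_cstar_mult_ge: "(cmod (\<phi> x))\<^sup>2 \<le> Re (\<phi> (x\<^sup>\<star> \<otimes> x))"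
proof -
  define c where "c = \<phi> x"
  have "(x \<ominus> c \<cdot> \<one>)\<^sup>\<star> \<otimes> (x \<ominus> c \<cdot> \<one>) = x\<^sup>\<star> \<otimes> x \<ominus> c \<cdot> x\<^sup>\<star> \<ominus> cnj c \<cdot> x \<oplus> (c * cnj c) \<cdot> \<one>"
    by (simp add: cstar_diff cstar_csmult rng.left_diff_distrib rng.right_diff_distrib
        csmult_diff_right mult.commute) (simp add: ring_simps)
  then have "\<phi> ((x \<ominus> c \<cdot> \<one>)\<^sup>\<star> \<otimes> (x \<ominus> c \<cdot> \<one>)) = \<phi> (x\<^sup>\<star> \<otimes> x) - c * cnj c"
    by (simp add: state_add state_diff state_csmult state_one state_cstar c_def[symmetric])
  with state_pos(2)[of "x \<ominus> c \<cdot> \<one>"] show ?thesis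
    by (simp add: c_def[symmetric] complex_mult_cnj cmod_def)
qed

text \<open>The element \<open>\<parallel>x\<parallel>\<^sup>2 + e - x\<^sup>\<star> \<otimes>
  x\<close> is a square of a selfadjoint element, so \<phi> is nonnegative on it. Together with the
  Cauchy-Schwarz bound this gives the sharp constant 1.\<close>

lemma state_le_cnorm: "cmod (\<phi> x) \<le> \<parallel>x\<parallel>"
proof -
  have "(cmod (\<phi> x))\<^sup>2 \<le> \<parallel>x\<parallel>\<^sup>2 + e" if "e > 0" for e
  proof -
    have "\<parallel>x\<^sup>\<star> \<otimes> x\<parallel> < \<parallel>x\<parallel>\<^sup>2 + e" using that by (simp add: cnorm_cstar_mult)
    then obtain d where "d \<in> sa A" "d \<otimes> d = sc (\<parallel>x\<parallel>\<^sup>2 + e) \<ominus> x\<^sup>\<star> \<otimes> x"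
      using sqrt_exists[OF sa_cstar_mult[of x]] by metis
    then have "\<phi> (d\<^sup>\<star> \<otimes> d) = complex_of_real (\<parallel>x\<parallel>\<^sup>2 + e) - \<phi> (x\<^sup>\<star> \<otimes> x)"
      by (simp only: sa_iff state_diff state_sc)
    with state_pos(2)[of d] state_cstar_mult_ge[of x] show ?thesis by simp
  qed
  then have "(cmod (\<phi> x))\<^sup>2 \<le> \<parallel>x\<parallel>\<^sup>2" by (rule field_le_epsilon)
  then show ?thesis by (rule power2_le_imp_le) simp
qed

text \<open>The degenerate case of Cauchy-Schwarz. Positivity at
  \<open>y\<^sup>\<star> + c z\<close> has no quadratic term in \<open>c\<close>, so the linear term
  must vanish; otherwise a multiple of \<open>- cnj k\<close> for \<open>c\<close> makes the
  expression negative.\<close>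

lemma state_mult_null: assumes z: "\<phi> (z\<^sup>\<star> \<otimes> z) = 0" shows "\<phi> (y \<otimes> z) = 0"
proof (rule ccontr)
  define k where "k = \<phi> (y \<otimes> z)"
  assume "\<phi> (y \<otimes> z) \<noteq> 0"
  then have k: "(cmod k)\<^sup>2 > 0" by (simp add: k_def)
  have *: "0 \<le> Re (\<phi> (y \<otimes> y\<^sup>\<star>)) - 2 * t * (cmod k)\<^sup>2" for t :: real
  proof -
    define c where "c = - of_real t * cnj k"
    have "(y\<^sup>\<star> \<oplus> c \<cdot> z)\<^sup>\<star> \<otimes> (y\<^sup>\<star> \<oplus> c \<cdot> z)
        = y \<otimes> y\<^sup>\<star> \<oplus> c \<cdot> (y \<otimes> z) \<oplus> cnj c \<cdot> (y \<otimes> z)\<^sup>\<star> \<oplus> (c * cnj c) \<cdot> (z\<^sup>\<star> \<otimes> z)"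
      by (simp add: cstar_add cstar_csmult cstar_mult rng.distrib_left rng.distrib_right
          csmult_add_right mult.commute) (simp add: ring_simps)
    then have "\<phi> ((y\<^sup>\<star> \<oplus> c \<cdot> z)\<^sup>\<star> \<otimes> (y\<^sup>\<star> \<oplus> c \<cdot> z)) = \<phi> (y \<otimes> y\<^sup>\<star>) + c * k + cnj (c * k)"
      by (simp add: state_add state_csmult state_cstar z k_def)
    moreover have "c * k = - of_real (t * (cmod k)\<^sup>2)"
      unfolding c_def of_real_mult complex_norm_square by simp
    ultimately show ?thesis
      using state_pos(2)[of "y\<^sup>\<star> \<oplus> c \<cdot> z"] by simp
  qed
  define R where "R = Re (\<phi> (y \<otimes> y\<^sup>\<star>))"
  from *[of "(R + 1) / (2 * (cmod k)\<^sup>2)"] k show False by (simp add: R_def)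
qed

lemma state_null_mult: assumes z: "\<phi> (z \<otimes> z\<^sup>\<star>) = 0" shows "\<phi> (z \<otimes> y) = 0"
proof -
  have "\<phi> (y\<^sup>\<star> \<otimes> z\<^sup>\<star>) = 0" by (rule state_mult_null) (simp add: z)
  then show ?thesis using state_cstar[of "z \<otimes> y"] by (simp add: cstar_mult)
qed

end

section \<open>The Hahn-Banach theorem\<close>

text \<open>Homogeneity is required as an inequality for positive \<open>r\<close> only, which is
  what is easy to check for infima. Applying it to \<open>1/r\<close> as well gives
  equality.\<close>

definition sublinear :: "('a \<Rightarrow> real) \<Rightarrow> bool" where
  "sublinear q \<longleftrightarrow> (\<forall>x y. q (x \<oplus> y) \<le> q x + q y) \<and> (\<forall>r>0. \<forall>x. q (complex_of_real r \<cdot> x) \<le> r * q x)"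

lemma sublinear_scale: assumes "sublinear q" "0 \<le> r" shows "q (complex_of_real r \<cdot> x) = r * q x"
proof -
  have le: "q (complex_of_real r \<cdot> x) \<le> r * q x" if "r > 0" for r x
    using assms that by (auto simp: sublinear_def)
  have "q (\<zero> \<oplus> \<zero>) \<le> q \<zero> + q \<zero>" using assms(1) unfolding sublinear_def by blast
  then have q0: "q \<zero> = 0" using le[of "1/2" \<zero>] by simp
  show ?thesis
  proof (cases "r = 0")
    case False
    then have r: "r > 0" using assms by simp
    have "q x \<le> 1 / r * q (complex_of_real r \<cdot> x)"
      using le[of "1/r" "complex_of_real r \<cdot> x"] r by simp
    then show ?thesis using le[OF r, of x] r by (simp add: field_simps)
  qed (simp add: q0)
qed

lemma sublinear_zero: "sublinear q \<Longrightarrow> q \<zero> = 0"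
  using sublinear_scale[of q 0 \<zero>] by simp

lemma sublinear_uminus: assumes "sublinear q" shows "- q ((-1) \<cdot> x) \<le> q x"
proof -
  have "q (x \<oplus> (-1) \<cdot> x) \<le> q x + q ((-1) \<cdot> x)" using assms unfolding sublinear_def by blast
  then show ?thesis using sublinear_zero[OF assms] by simp
qed

text \<open>The largest sublinear functional below \<open>q\<close> that is at most \<open>- q y\<close> at \<open>- y\<close>.\<close>
definition sublin_tilt :: "('a \<Rightarrow> real) \<Rightarrow> 'a \<Rightarrow> 'a \<Rightarrow> real" where
  "sublin_tilt q y x = (INF t\<in>{0..}. q (x \<oplus> complex_of_real t \<cdot> y) - t * q y)"

text \<open>The infimum is bounded below because
  \<open>t * q y = q (t y) \<le> q (x + t y) + q (- x)\<close>, so \<open>- q (- x)\<close> is a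
  lower bound for every \<open>t\<close>.\<close>

lemma sublin_tilt_le:
  assumes q: "sublinear q" and t: "0 \<le> t"
  shows "sublin_tilt q y x \<le> q (x \<oplus> complex_of_real t \<cdot> y) - t * q y"
  unfolding sublin_tilt_def
proof (rule cINF_lower)
  show "bdd_below ((\<lambda>t. q (x \<oplus> complex_of_real t \<cdot> y) - t * q y) ` {0..})"
  proof (rule bdd_belowI2[where m = "- q ((-1) \<cdot> x)"])
    fix t :: real assume "t \<in> {0..}"
    then have "t * q y = q (complex_of_real t \<cdot> y)" using sublinear_scale[OF q] by simp
    also have "complex_of_real t \<cdot> y = (x \<oplus> complex_of_real t \<cdot> y) \<oplus> (-1) \<cdot> x"
      by (metis cadd_assoc cadd_commute cadd_uminus cadd_zero_left)
    also have "q \<dots> \<le> q (x \<oplus> complex_of_real t \<cdot> y) + q ((-1) \<cdot> x)"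
      using q unfolding sublinear_def by blast
    finally show "- q ((-1) \<cdot> x) \<le> q (x \<oplus> complex_of_real t \<cdot> y) - t * q y" by simp
  qed
qed (use t in simp)

lemma sublinear_tilt: assumes q: "sublinear q" shows "sublinear (sublin_tilt q y)"
  unfolding sublinear_def
proof (intro conjI allI impI)
  fix x z
  show "sublin_tilt q y (x \<oplus> z) \<le> sublin_tilt q y x + sublin_tilt q y z"
    unfolding sublin_tilt_def[of q y x] sublin_tilt_def[of q y z]
  proof (rule le_cINF_add_cINF)
    fix s t :: real assume st: "s \<in> {0..}" "t \<in> {0..}"
    have "sublin_tilt q y (x \<oplus> z) \<le> q ((x \<oplus> z) \<oplus> complex_of_real (s + t) \<cdot> y) - (s + t) * q y"
      using st by (intro sublin_tilt_le q) simp
    also have "(x \<oplus> z) \<oplus> complex_of_real (s + t) \<cdot> y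
        = (x \<oplus> complex_of_real s \<cdot> y) \<oplus> (z \<oplus> complex_of_real t \<cdot> y)"
      by (simp add: csmult_add_left ring_simps)
    also have "q \<dots> \<le> q (x \<oplus> complex_of_real s \<cdot> y) + q (z \<oplus> complex_of_real t \<cdot> y)"
      using q unfolding sublinear_def by blast
    finally show "sublin_tilt q y (x \<oplus> z) \<le> (q (x \<oplus> complex_of_real s \<cdot> y) - s * q y)
        + (q (z \<oplus> complex_of_real t \<cdot> y) - t * q y)" by (simp add: algebra_simps)
  qed auto
next
  fix r :: real and x assume r: "r > 0"
  have "sublin_tilt q y (complex_of_real r \<cdot> x) / r \<le> sublin_tilt q y x"
    unfolding sublin_tilt_def[of q y x]
  proof (rule cINF_greatest)
    fix t :: real assume t: "t \<in> {0..}"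
    have "sublin_tilt q y (complex_of_real r \<cdot> x)
        \<le> q (complex_of_real r \<cdot> x \<oplus> complex_of_real (r * t) \<cdot> y) - (r * t) * q y"
      using t r by (intro sublin_tilt_le q) simp
    also have "complex_of_real r \<cdot> x \<oplus> complex_of_real (r * t) \<cdot> y
        = complex_of_real r \<cdot> (x \<oplus> complex_of_real t \<cdot> y)" by (simp add: csmult_add_right)
    also have "q \<dots> = r * q (x \<oplus> complex_of_real t \<cdot> y)" using r by (intro sublinear_scale q) simp
    finally show "sublin_tilt q y (complex_of_real r \<cdot> x) / r
        \<le> q (x \<oplus> complex_of_real t \<cdot> y) - t * q y" using r by (simp add: field_simps)
  qed auto
  then show "sublin_tilt q y (complex_of_real r \<cdot> x) \<le> r * sublin_tilt q y x"
    using r by (simp add: field_simps)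
qed

text \<open>Being a chain matters for subadditivity: of two members the smaller one lies below both,
  so a single functional bounds the sum. The infima exist since every member is at least
  \<open>- p (- x)\<close> at \<open>x\<close>.\<close>

lemma sublinear_INF_chain:
  assumes ne: "C \<noteq> {}" and C: "\<And>q. q \<in> C \<Longrightarrow> sublinear q \<and> q \<le> p"
    and chain: "\<And>q r. q \<in> C \<Longrightarrow> r \<in> C \<Longrightarrow> q \<le> r \<or> r \<le> q"
  shows "sublinear (\<lambda>x. INF q\<in>C. q x)" and "\<And>q x. q \<in> C \<Longrightarrow> (INF q\<in>C. q x) \<le> q x"
proof -
  show low: "(INF q\<in>C. q x) \<le> q x" if "q \<in> C" for q x
  proof (rule cINF_lower[OF _ that], rule bdd_belowI2[where m = "- p ((-1) \<cdot> x)"])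
    fix q assume "q \<in> C"
    then show "- p ((-1) \<cdot> x) \<le> q x"
      using C[of q] sublinear_uminus[of q x] le_funD[of q p "(-1) \<cdot> x"] by linarith
  qed
  show "sublinear (\<lambda>x. INF q\<in>C. q x)" unfolding sublinear_def
  proof (intro conjI allI impI)
    fix x y
    show "(INF q\<in>C. q (x \<oplus> y)) \<le> (INF q\<in>C. q x) + (INF q\<in>C. q y)"
    proof (rule le_cINF_add_cINF[OF ne ne])
      fix q r assume qr: "q \<in> C" "r \<in> C"
      define s where "s = (if q \<le> r then q else r)"
      have s: "s \<in> C" "s \<le> q" "s \<le> r" using qr chain[of q r] by (auto simp: s_def)
      have "(INF q\<in>C. q (x \<oplus> y)) \<le> s (x \<oplus> y)" using low s by blast
      also have "\<dots> \<le> s x + s y" using C[OF s(1)] unfolding sublinear_def by blast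
      also have "\<dots> \<le> q x + r y" using le_funD[OF s(2), of x] le_funD[OF s(3), of y] by linarith
      finally show "(INF q\<in>C. q (x \<oplus> y)) \<le> q x + r y" .
    qed
  next
    fix r :: real and x assume r: "r > 0"
    have "(INF q\<in>C. q (complex_of_real r \<cdot> x)) / r \<le> (INF q\<in>C. q x)"
    proof (rule cINF_greatest[OF ne])
      fix q assume q: "q \<in> C"
      have "(INF q\<in>C. q (complex_of_real r \<cdot> x)) \<le> r * q x"
        using low[OF q] C[OF q] r sublinear_scale[of q r x] by (metis less_imp_le)
      then show "(INF q\<in>C. q (complex_of_real r \<cdot> x)) / r \<le> q x" using r by (simp add: field_simps)
    qed
    then show "(INF q\<in>C. q (complex_of_real r \<cdot> x)) \<le> r * (INF q\<in>C. q x)"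
      using r by (simp add: field_simps)
  qed
qed

text \<open>A minimal sublinear functional is linear. Its tilt by \<open>y\<close> is sublinear and,
  by \<open>t = 0\<close>, not larger, hence equal to it; then \<open>t = 1\<close> reads
  \<open>f x \<le> f (x + y) - f y\<close>, the missing half of additivity.\<close>

theorem hahn_banach:
  assumes p: "sublinear p"
  obtains f where "\<And>x. f x \<le> p x" "\<And>x y. f (x \<oplus> y) = f x + f y"
    "\<And>r x. f (complex_of_real r \<cdot> x) = r * f x"
proof -
  define S where "S = {q. sublinear q \<and> q \<le> p}"
  \<comment> \<open>\<open>predicate_Zorn\<close> yields maximal elements, so it is applied to the
    reversed order.\<close>
  have "\<exists>f\<in>S. \<forall>q\<in>S. q \<le> f \<longrightarrow> q = f"
  proof (rule predicate_Zorn[where P = "\<lambda>q r. r \<le> q"])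
    show "partial_order_on S (relation_of (\<lambda>q r. r \<le> q) S)"
      by (rule partial_order_on_relation_ofI) auto
    fix C assume C: "C \<in> Chains (relation_of (\<lambda>q r. r \<le> q) S)"
    have CS: "sublinear q \<and> q \<le> p" if "q \<in> C" for q
      using C that by (auto simp: Chains_def relation_of_def S_def)
    have chain: "q \<le> r \<or> r \<le> q" if "q \<in> C" "r \<in> C" for q r
      using C that by (auto simp: Chains_def relation_of_def)
    show "\<exists>u\<in>S. \<forall>q\<in>C. u \<le> q"
    proof (cases "C = {}")
      case True
      then show ?thesis using p by (auto simp: S_def)
    next
      case False
      have inf: "sublinear (\<lambda>x. INF q\<in>C. q x)"
        using False CS chain by (rule sublinear_INF_chain(1))
      have low: "(INF q\<in>C. q x) \<le> q x" if "q \<in> C" for q x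
        using False CS chain that by (rule sublinear_INF_chain(2))
      obtain q where q: "q \<in> C" using False by blast
      have "(\<lambda>x. INF q\<in>C. q x) \<le> p"
        using low[OF q] CS[OF q] by (auto simp: le_fun_def intro: order_trans)
      then show ?thesis
        using inf low by (intro bexI[of _ "\<lambda>x. INF q\<in>C. q x"]) (auto simp: S_def le_fun_def)
    qed
  qed
  then obtain f where f: "sublinear f" "f \<le> p" and min: "\<And>q. sublinear q \<Longrightarrow> q \<le> f \<Longrightarrow> q = f"
    unfolding S_def by (metis (mono_tags, lifting) mem_Collect_eq order_trans)
  have tilt: "sublin_tilt f y = f" for y
  proof (rule min[OF sublinear_tilt[OF f(1)]])
    show "sublin_tilt f y \<le> f"
      using sublin_tilt_le[OF f(1), of 0 y] by (auto simp: le_fun_def)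
  qed
  have add: "f (x \<oplus> y) = f x + f y" for x y
  proof (rule antisym)
    show "f (x \<oplus> y) \<le> f x + f y" using f(1) unfolding sublinear_def by blast
    show "f x + f y \<le> f (x \<oplus> y)"
      using sublin_tilt_le[OF f(1), of 1 y x] by (simp add: tilt)
  qed
  have neg: "f ((-1) \<cdot> x) = - f x" for x
    using add[of x "(-1) \<cdot> x"] sublinear_zero[OF f(1)] by simp
  show ?thesis
  proof
    show "f x \<le> p x" for x using f(2) by (rule le_funD)
    show "f (x \<oplus> y) = f x + f y" for x y by (rule add)
    show "f (complex_of_real r \<cdot> x) = r * f x" for r x
    proof (cases "r \<ge> 0")
      case False
      have "f (complex_of_real r \<cdot> x) = - f (complex_of_real (- r) \<cdot> x)"
        using neg[of "complex_of_real (-r) \<cdot> x"] by simp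
      then show ?thesis using False sublinear_scale[OF f(1), of "- r" x] by simp
    qed (use sublinear_scale[OF f(1)] in simp)
  qed
qed

section \<open>States that attain the upper bound of an element\<close>

lemma posel_sc_iff: "posel (sc r) \<longleftrightarrow> 0 \<le> r"
proof
  assume "posel (sc r)"
  then obtain t where "\<bar>t - r\<bar> \<le> t" unfolding posel_def using sc_simps(5) by (metis sc_diff)
  then show "0 \<le> r" by (simp add: abs_le_iff)
qed (rule posel_sc)

lemma posel_zero [simp]: "posel \<zero>"
  using posel_sc_iff[of 0] by simp

lemma posel_sc_cnorm:
  assumes "k \<in> sa A" shows "posel (sc \<parallel>k\<parallel> \<ominus> k)" "posel (sc \<parallel>k\<parallel> \<oplus> k)"
proof -
  have "sc \<parallel>k\<parallel> \<ominus> (sc \<parallel>k\<parallel> \<ominus> k) = k" "sc \<parallel>k\<parallel> \<ominus> (sc \<parallel>k\<parallel> \<oplus> k) = (-1) \<cdot> k"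
    by (simp add: ring_simps) (simp add: rng.diff_diff_add[symmetric])
  then show "posel (sc \<parallel>k\<parallel> \<ominus> k)" "posel (sc \<parallel>k\<parallel> \<oplus> k)"
    using assms cnorm_csmult[of "-1" k] unfolding posel_def
    by (auto intro!: sa_diff sa_add exI[of _ "\<parallel>k\<parallel>"])
qed

definition real_part :: "'a \<Rightarrow> 'a" where "real_part x = (1/2) \<cdot> (x \<oplus> x\<^sup>\<star>)"

lemma real_part_sa: "real_part x \<in> sa A"
  by (simp add: real_part_def sa_iff cstar_csmult cstar_add cadd_commute)

lemma real_part_of_sa: "x \<in> sa A \<Longrightarrow> real_part x = x"
  by (simp add: real_part_def sa_iff csmult_2[symmetric])

lemma real_part_add: "real_part (x \<oplus> y) = real_part x \<oplus> real_part y"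
  by (simp add: real_part_def cstar_add csmult_add_right ring_simps)

lemma real_part_scale: "real_part (complex_of_real r \<cdot> x) = complex_of_real r \<cdot> real_part x"
  by (simp add: real_part_def cstar_csmult csmult_add_right mult.commute)

text \<open>In spectral terms, the top of the spectrum of the real part. Passing to the real part
  extends the functional from selfadjoint elements to the whole type, on which
  \<open>hahn_banach\<close> operates.\<close>

definition upper :: "'a \<Rightarrow> real" where "upper x = Inf {t. posel (sc t \<ominus> real_part x)}"

lemma upper_le: assumes "posel (sc t \<ominus> real_part x)" shows "upper x \<le> t"
  unfolding upper_def
proof (rule cInf_lower)
  show "bdd_below {t. posel (sc t \<ominus> real_part x)}"
  proof (rule bdd_belowI[where m = "- \<parallel>real_part x\<parallel>"])
    fix t assume "t \<in> {t. posel (sc t \<ominus> real_part x)}"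
    then have "posel ((sc t \<ominus> real_part x) \<oplus> (sc \<parallel>real_part x\<parallel> \<oplus> real_part x))"
      by (intro posel_add posel_sc_cnorm real_part_sa) simp
    also have "(sc t \<ominus> real_part x) \<oplus> (sc \<parallel>real_part x\<parallel> \<oplus> real_part x) = sc (t + \<parallel>real_part x\<parallel>)"
      by (simp add: sc_add ring_simps)
    finally show "- \<parallel>real_part x\<parallel> \<le> t" by (simp add: posel_sc_iff)
  qed
qed (use assms in simp)

lemma posel_of_upper_less: assumes "upper x < t" shows "posel (sc t \<ominus> real_part x)"
proof -
  have "\<parallel>real_part x\<parallel> \<in> {t. posel (sc t \<ominus> real_part x)}"
    using posel_sc_cnorm(1)[OF real_part_sa] by simp
  then have "{t. posel (sc t \<ominus> real_part x)} \<noteq> {}" by (metis empty_iff)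
  from cInf_lessD[OF this, of t] assms obtain s where s: "posel (sc s \<ominus> real_part x)" "s < t"
    by (auto simp: upper_def)
  have "posel ((sc s \<ominus> real_part x) \<oplus> sc (t - s))" using s by (intro posel_add posel_sc) auto
  also have "(sc s \<ominus> real_part x) \<oplus> sc (t - s) = sc t \<ominus> real_part x"
    by (simp add: sc_diff ring_simps)
  finally show ?thesis .
qed

lemma sublinear_upper: "sublinear upper"
  unfolding sublinear_def
proof (intro conjI allI impI)
  fix x y
  show "upper (x \<oplus> y) \<le> upper x + upper y"
  proof (rule field_le_epsilon)
    fix e :: real assume e: "e > 0"
    have "posel ((sc (upper x + e/2) \<ominus> real_part x) \<oplus> (sc (upper y + e/2) \<ominus> real_part y))"
      using e by (intro posel_add posel_of_upper_less) auto
    also have "(sc (upper x + e/2) \<ominus> real_part x) \<oplus> (sc (upper y + e/2) \<ominus> real_part y)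
        = sc ((upper x + e/2) + (upper y + e/2)) \<ominus> real_part (x \<oplus> y)"
      unfolding sc_add[of "upper x + e/2"] real_part_add by (simp add: ring_simps)
    finally show "upper (x \<oplus> y) \<le> upper x + upper y + e" using upper_le by fastforce
  qed
next
  fix r :: real and x assume r: "r > 0"
  have "upper (complex_of_real r \<cdot> x) / r \<le> upper x"
  proof (rule field_le_epsilon)
    fix e :: real assume e: "e > 0"
    then have "posel (complex_of_real r \<cdot> (sc (upper x + e) \<ominus> real_part x))"
      using r by (intro posel_scale posel_of_upper_less) auto
    then have "upper (complex_of_real r \<cdot> x) \<le> r * (upper x + e)"
      by (intro upper_le) (simp add: csmult_diff_right real_part_scale)
    then show "upper (complex_of_real r \<cdot> x) / r \<le> upper x + e" using r by (simp add: field_simps)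
  qed
  then show "upper (complex_of_real r \<cdot> x) \<le> r * upper x" using r by (simp add: field_simps)
qed

text \<open>The functional is dominated by the tilt of \<open>upper\<close> at \<open>a\<close>, not
  by \<open>upper\<close> alone: the tilt is at most \<open>- upper a\<close> at \<open>- a\<close>,
  which forces \<open>f a \<ge> upper a\<close>. Domination by \<open>upper\<close> gives the rest.
  Both \<open>1\<close> and \<open>-1\<close> have the expected upper bounds, so \<open>f\<close> is
  1 at the unit; \<open>\<i> \<cdot> h\<close> has real part zero, so \<open>f\<close> vanishes
  there; and \<open>upper (- y\<^sup>\<star> y) \<le> 0\<close> gives positivity.\<close>

theorem exists_state_ge_upper:
  assumes a: "a \<in> sa A" obtains \<phi> where "\<phi> \<in> states A" "upper a \<le> Re (\<phi> a)"
proof -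
  obtain f where f: "\<And>x. f x \<le> sublin_tilt upper a x" and add: "\<And>x y. f (x \<oplus> y) = f x + f y"
    and scale: "\<And>r x. f (complex_of_real r \<cdot> x) = r * f x"
    using hahn_banach[OF sublinear_tilt[OF sublinear_upper]] by metis
  have f_le: "f x \<le> upper x" for x
    using f[of x] sublin_tilt_le[OF sublinear_upper, of 0 a x] by simp
  have neg: "f ((-1) \<cdot> x) = - f x" for x using scale[of "-1" x] by simp
  have "f ((-1) \<cdot> a) \<le> - upper a"
    using f[of "(-1) \<cdot> a"] sublin_tilt_le[OF sublinear_upper, of 1 a "(-1) \<cdot> a"]
      sublinear_zero[OF sublinear_upper] by simp
  then have fa: "upper a \<le> f a" by (simp add: neg)
  have imag: "f (\<i> \<cdot> h) = 0" if "h \<in> sa A" for h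
  proof -
    have "real_part (\<i> \<cdot> h) = \<zero>" "real_part ((-1) \<cdot> (\<i> \<cdot> h)) = \<zero>"
      using that by (simp_all add: real_part_def cstar_csmult sa_iff csmult_add_left[symmetric])
    then have "upper (\<i> \<cdot> h) \<le> 0" "upper ((-1) \<cdot> (\<i> \<cdot> h)) \<le> 0"
      by (auto intro!: upper_le simp: posel_sc_iff)
    then show ?thesis using f_le[of "\<i> \<cdot> h"] f_le[of "(-1) \<cdot> (\<i> \<cdot> h)"] neg[of "\<i> \<cdot> h"] by simp
  qed
  have one: "f \<one> = 1"
  proof -
    have "sc (-1) \<oplus> \<one> = \<zero>" using sc_add[of "-1" 1] by simp
    then have "upper \<one> \<le> 1" "upper ((-1) \<cdot> \<one>) \<le> -1"
      using sa_scale[OF sa_one, of "-1"] by (auto intro!: upper_le simp: real_part_of_sa)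
    then show ?thesis using f_le[of \<one>] f_le[of "(-1) \<cdot> \<one>"] neg[of \<one>] by simp
  qed
  have pos: "0 \<le> f (y\<^sup>\<star> \<otimes> y)" for y
  proof -
    have "(-1) \<cdot> (y\<^sup>\<star> \<otimes> y) \<in> sa A" using sa_scale[OF sa_cstar_mult, of "-1" y] by simp
    then have "upper ((-1) \<cdot> (y\<^sup>\<star> \<otimes> y)) \<le> 0"
      by (intro upper_le) (simp add: real_part_of_sa posel_cstar_mult)
    then show ?thesis using f_le[of "(-1) \<cdot> (y\<^sup>\<star> \<otimes> y)"] neg[of "y\<^sup>\<star> \<otimes> y"] by simp
  qed
  \<comment> \<open>The usual complexification of a real functional. As
    \<open>f (\<i> \<cdot> h) = 0\<close> for selfadjoint \<open>h\<close>, it agrees with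
    \<open>f\<close> on such elements.\<close>
  define \<phi> where "\<phi> x = complex_of_real (f x) - \<i> * complex_of_real (f (\<i> \<cdot> x))" for x
  have "\<phi> (c \<cdot> x) = c * \<phi> x" for c x
  proof -
    have c: "c = complex_of_real (Re c) + complex_of_real (Im c) * \<i>" by (simp add: complex_eq_iff)
    have "c \<cdot> x = complex_of_real (Re c) \<cdot> x \<oplus> complex_of_real (Im c) \<cdot> (\<i> \<cdot> x)"
      by (subst c) (simp only: csmult_add_left csmult_csmult)
    then have 1: "f (c \<cdot> x) = Re c * f x + Im c * f (\<i> \<cdot> x)" by (simp only: add scale)
    have "\<i> * c = complex_of_real (Re c) * \<i> + complex_of_real (- Im c)" by (simp add: complex_eq_iff)
    then have "\<i> \<cdot> (c \<cdot> x) = complex_of_real (Re c) \<cdot> (\<i> \<cdot> x) \<oplus> complex_of_real (- Im c) \<cdot> x"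
      by (simp only: csmult_add_left csmult_csmult)
    then have 2: "f (\<i> \<cdot> (c \<cdot> x)) = Re c * f (\<i> \<cdot> x) - Im c * f x" by (simp only: add scale)
    show ?thesis unfolding \<phi>_def 1 2 by (simp add: complex_eq_iff)
  qed
  moreover have "\<phi> (x \<oplus> y) = \<phi> x + \<phi> y" for x y
    by (simp add: \<phi>_def csmult_add_right add algebra_simps)
  moreover have sa: "\<phi> h = complex_of_real (f h)" if "h \<in> sa A" for h
    using imag[OF that] by (simp add: \<phi>_def)
  ultimately have "\<phi> \<in> states A"
    using pos one by (simp add: states_def sa_cstar_mult)
  moreover have "upper a \<le> Re (\<phi> a)" using fa sa[OF a] by simp
  ultimately show ?thesis using that by blast
qed

text \<open>States attaining the upper bounds of \<open>a\<close> and of \<open>- a\<close> show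
  that both are at most \<open>s\<close>; the factor is the one of
  \<open>cnorm_le_of_posel\<close>.\<close>

corollary cnorm_le_of_states:
  assumes a: "a \<in> sa A" and s: "\<And>\<phi>. \<phi> \<in> states A \<Longrightarrow> cmod (\<phi> a) \<le> s"
  shows "\<parallel>a\<parallel> \<le> 3 * s"
proof (rule field_le_epsilon)
  fix e :: real assume e: "e > 0"
  have na: "(-1) \<cdot> a \<in> sa A" using sa_scale[OF a, of "-1"] by simp
  obtain \<phi> where "\<phi> \<in> states A" "upper a \<le> Re (\<phi> a)" using exists_state_ge_upper[OF a] .
  then have "upper a \<le> s" using s[of \<phi>] complex_Re_le_cmod[of "\<phi> a"] by linarith
  obtain \<psi> where \<psi>: "\<psi> \<in> states A" "upper ((-1) \<cdot> a) \<le> Re (\<psi> ((-1) \<cdot> a))"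
    using exists_state_ge_upper[OF na] .
  then have "upper ((-1) \<cdot> a) \<le> s"
    using s[of \<psi>] abs_Re_le_cmod[of "\<psi> a"] state_csmult[OF \<psi>(1), of "-1" a] by simp
  have "posel (sc (s + e/3) \<ominus> a)"
    using posel_of_upper_less[of a "s + e/3"] \<open>upper a \<le> s\<close> e by (simp add: real_part_of_sa a)
  moreover have "posel (sc (s + e/3) \<oplus> a)"
    using posel_of_upper_less[of "(-1) \<cdot> a" "s + e/3"] \<open>upper ((-1) \<cdot> a) \<le> s\<close> e
    by (simp add: real_part_of_sa na)
  ultimately have "\<parallel>a\<parallel> \<le> 3 * (s + e/3)" using a by (rule cnorm_le_of_posel)
  then show "\<parallel>a\<parallel> \<le> 3 * s + e" by simp
qed

end

section \<open>Contractivity of *-homomorphisms\<close>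

text \<open>For \<open>r\<close> slightly above \<open>\<parallel>a\<parallel>\<^sup>2\<close> there
  is \<open>d\<close> commuting with \<open>a\<close> such that
  \<open>a\<^sup>2 + d\<^sup>2 = r\<close>. These relations are algebraic, so \<pi> preserves them,
  and in \<open>D\<close> they bound the norm of \<open>\<pi> a\<close>.\<close>

lemma star_hom_cnorm_le:
  assumes "ucstar A" "ucstar D" and hom: "unital_inj_star_hom A D \<pi>" and a: "a \<in> sa A"
  shows "cnorm D (\<pi> a) \<le> cnorm A a"
proof -
  interpret A: ucstar A by fact
  interpret D: ucstar D by fact
  have h: "\<pi> (cadd A x y) = cadd D (\<pi> x) (\<pi> y)" "\<pi> (csmult A c x) = csmult D c (\<pi> x)"
    "\<pi> (cmult A x y) = cmult D (\<pi> x) (\<pi> y)" "\<pi> (cstar A x) = cstar D (\<pi> x)" "\<pi> (cone A) = cone D"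
    for x y c using hom by (auto simp: unital_inj_star_hom_def)
  have "(cnorm D (\<pi> a))\<^sup>2 \<le> (cnorm A a)\<^sup>2 + e" if e: "e > 0" for e
  proof -
    have "cnorm A (cmult A a a) < (cnorm A a)\<^sup>2 + e" using e by (simp add: A.cnorm_sa_square a)
    then obtain d where d: "d \<in> sa A" "cmult A d d = csub A (A.sc ((cnorm A a)\<^sup>2 + e)) (cmult A a a)"
        "cmult A a d = cmult A d a"
      using A.sqrt_exists[of "cmult A a a"] A.sa_mult_commute[OF a a] by (metis A.cmult_assoc)
    have "cadd A (cmult A a a) (cmult A d d) = A.sc ((cnorm A a)\<^sup>2 + e)"
      unfolding d by (simp add: A.ring_simps)
    then have "\<pi> (cadd A (cmult A a a) (cmult A d d)) = D.sc ((cnorm A a)\<^sup>2 + e)"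
      by (simp add: h A.sc_def D.sc_def)
    then have "cadd D (cmult D (\<pi> a) (\<pi> a)) (cmult D (\<pi> d) (\<pi> d)) = D.sc ((cnorm A a)\<^sup>2 + e)"
      by (simp add: h)
    moreover have "\<pi> a \<in> sa D" "\<pi> d \<in> sa D"
      using a d by (auto simp: A.sa_iff D.sa_iff h(4)[symmetric])
    moreover have "cmult D (\<pi> a) (\<pi> d) = cmult D (\<pi> d) (\<pi> a)" using d(3) by (metis h(3))
    ultimately show ?thesis using e by (intro D.cnorm_le_of_sum_squares) auto
  qed
  then have "(cnorm D (\<pi> a))\<^sup>2 \<le> (cnorm A a)\<^sup>2" by (rule field_le_epsilon)
  then show ?thesis by (rule power2_le_imp_le) simp
qed

context ucstar begin

subsection \<open>Total boundedness and the weak* topology\<close>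

lemma weak_star_states_eq: "weak_star_states A = top_of_set (states A)"
  by (simp add: weak_star_states_def euclidean_product_topology)

text \<open>The Banach-Alaoglu argument: contractivity places the states in a product of discs,
  compact by Tychonoff, and the defining conditions are closed under pointwise limits.\<close>

lemma compact_states: "compact (states A)"
proof -
  have "compactin (product_topology (\<lambda>x. euclidean) UNIV) (\<Pi>\<^sub>E x\<in>UNIV. cball (0::complex) \<parallel>x\<parallel>)"
    by (auto simp: compactin_PiE)
  then have "compact (\<Pi>\<^sub>E x\<in>UNIV. cball (0::complex) \<parallel>x\<parallel>)"
    by (simp add: euclidean_product_topology)
  moreover have "closed (states A)"
    unfolding states_def
    by (intro closed_Collect_all closed_Collect_conj closed_Collect_eq closed_Collect_le
        continuous_intros continuous_on_product_coordinates)
  moreover have "states A \<subseteq> (\<Pi>\<^sub>E x\<in>UNIV. cball (0::complex) \<parallel>x\<parallel>)"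
    by (auto simp: state_le_cnorm)
  ultimately show ?thesis using compact_Int_closed by (metis inf.absorb_iff2)
qed

lemma mk_ge: "a \<in> Lip1 A L \<Longrightarrow> ereal (cmod (\<phi> a - \<psi> a)) \<le> mk A L \<phi> \<psi>"
  unfolding mk_def by (rule SUP_upper)

lemma le_real_mk:
  assumes "a \<in> Lip1 A L" "mk A L \<phi> \<psi> \<noteq> \<infinity>"
  shows "cmod (\<phi> a - \<psi> a) \<le> real_of_ereal (mk A L \<phi> \<psi>)"
  using real_of_ereal_positive_mono[OF _ mk_ge[OF assms(1)] assms(2)] by simp

lemma state_sa_eq: "\<phi> \<in> states A \<Longrightarrow> a \<in> sa A \<Longrightarrow> \<phi> a = complex_of_real (Re (\<phi> a))"
  by (simp add: complex_eq_iff state_sa_real)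

lemma
  assumes "qcms A L"
  shows qcms_outside: "\<And>a. a \<notin> sa A \<Longrightarrow> L a = \<infinity>"
    and qcms_nonneg: "\<And>a. 0 \<le> L a"
    and qcms_add: "\<And>a b. a \<in> sa A \<Longrightarrow> b \<in> sa A \<Longrightarrow> L (a \<oplus> b) \<le> L a + L b"
    and qcms_scale: "\<And>a r. a \<in> sa A \<Longrightarrow> L (complex_of_real r \<cdot> a) = ereal \<bar>r\<bar> * L a"
    and qcms_dense: "\<And>a e. a \<in> sa A \<Longrightarrow> e > 0 \<Longrightarrow> \<exists>b. L b < \<infinity> \<and> \<parallel>b \<ominus> a\<parallel> < e"
    and qcms_kernel: "\<And>a. a \<in> sa A \<Longrightarrow> L a = 0 \<longleftrightarrow> (\<exists>r. a = sc r)"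
    and qcms_finite: "\<And>\<phi> \<psi>. \<phi> \<in> states A \<Longrightarrow> \<psi> \<in> states A \<Longrightarrow> mk A L \<phi> \<psi> \<noteq> \<infinity>"
    and qcms_metric: "Metric_space (states A) (\<lambda>\<phi> \<psi>. real_of_ereal (mk A L \<phi> \<psi>))"
    and qcms_topology: "Metric_space.mtopology (states A) (\<lambda>\<phi> \<psi>. real_of_ereal (mk A L \<phi> \<psi>))
      = weak_star_states A"
  using assms unfolding qcms_def sc_def by blast+

lemma qcms_compact:
  assumes q: "qcms A L"
  shows "compactin (Metric_space.mtopology (states A) (\<lambda>\<phi> \<psi>. real_of_ereal (mk A L \<phi> \<psi>))) (states A)"
  unfolding qcms_topology[OF q] weak_star_states_eq
  using compact_states by (simp add: compactin_subtopology)

text \<open>The states are weak* compact, hence compact for \<open>mk\<close> by the equality of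
  topologies, and a compact metric space has finite diameter.\<close>

lemma mk_bounded:
  assumes q: "qcms A L"
  obtains K where "K \<ge> 0" "\<And>\<phi> \<psi>. \<phi> \<in> states A \<Longrightarrow> \<psi> \<in> states A \<Longrightarrow> mk A L \<phi> \<psi> \<le> ereal K"
proof -
  interpret M: Metric_space "states A" "\<lambda>\<phi> \<psi>. real_of_ereal (mk A L \<phi> \<psi>)"
    by (rule qcms_metric[OF q])
  have "M.mbounded (states A)" by (rule M.compactin_imp_mbounded[OF qcms_compact[OF q]])
  then obtain B where B: "B > 0" "\<And>\<phi> \<psi>. \<phi> \<in> states A \<Longrightarrow> \<psi> \<in> states A \<Longrightarrow> real_of_ereal (mk A L \<phi> \<psi>) \<le> B"
    unfolding M.mbounded_alt_pos by blast
  show ?thesis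
  proof
    show "B \<ge> 0" using B by simp
    fix \<phi> \<psi> assume "\<phi> \<in> states A" "\<psi> \<in> states A"
    then show "mk A L \<phi> \<psi> \<le> ereal B"
      using B(2)[of \<phi> \<psi>] qcms_finite[OF q, of \<phi> \<psi>] by (cases "mk A L \<phi> \<psi>") auto
  qed
qed

text \<open>Subtracting the value at \<mu> turns the bound on differences of states into a bound at
  each state, by the diameter of the state space.\<close>

lemma Lip1_cnorm_bounded:
  assumes q: "qcms A L" and \<mu>: "\<mu> \<in> states A"
  obtains K where "\<And>a. a \<in> Lip1 A L \<Longrightarrow> \<parallel>a \<ominus> sc (Re (\<mu> a))\<parallel> \<le> K"
proof -
  obtain K where K: "\<And>\<phi> \<psi>. \<phi> \<in> states A \<Longrightarrow> \<psi> \<in> states A \<Longrightarrow> mk A L \<phi> \<psi> \<le> ereal K"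
    using mk_bounded[OF q] by metis
  show ?thesis
  proof (rule that[of "3 * K"])
    fix a assume a: "a \<in> Lip1 A L"
    then have sa: "a \<in> sa A" by (simp add: Lip1_def)
    show "\<parallel>a \<ominus> sc (Re (\<mu> a))\<parallel> \<le> 3 * K"
    proof (rule cnorm_le_of_states)
      show "a \<ominus> sc (Re (\<mu> a)) \<in> sa A" using sa by (simp add: sa_diff)
      fix \<phi> assume \<phi>: "\<phi> \<in> states A"
      have "\<phi> (a \<ominus> sc (Re (\<mu> a))) = \<phi> a - \<mu> a"
        using state_sa_eq[OF \<mu> sa] by (simp add: state_diff[OF \<phi>] state_sc[OF \<phi>])
      then show "cmod (\<phi> (a \<ominus> sc (Re (\<mu> a)))) \<le> K"
        using order_trans[OF mk_ge[OF a] K[OF \<phi> \<mu>]] by simp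
    qed
  qed
qed

text \<open>An Arzela--Ascoli argument: elements of \<open>Lip1\<close> are 1-Lipschitz functions on the compact metric
  space of states, so they are determined up to a small error by their rounded values on a
  finite net of states.\<close>
theorem Lip1_totally_bounded:
  assumes q: "qcms A L" and \<mu>: "\<mu> \<in> states A" and e: "e > 0"
  shows "\<exists>F. finite F \<and> (\<forall>a\<in>Lip1 A L. cmod (\<mu> a) \<le> C \<longrightarrow> (\<exists>b\<in>F. \<parallel>a \<ominus> b\<parallel> < e))"
proof -
  interpret M: Metric_space "states A" "\<lambda>\<phi> \<psi>. real_of_ereal (mk A L \<phi> \<psi>)"
    by (rule qcms_metric[OF q])
  obtain K where K: "K \<ge> 0" "\<And>\<phi> \<psi>. \<phi> \<in> states A \<Longrightarrow> \<psi> \<in> states A \<Longrightarrow> mk A L \<phi> \<psi> \<le> ereal K"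
    using mk_bounded[OF q] by metis
  \<comment> \<open>At each state three errors of size \<delta> arise: moving to the net for
    \<open>a\<close> and for \<open>b\<close>, and rounding. The factor between states and norm
    makes this \<open>9 * \<delta>\<close>, which is below \<open>e\<close>.\<close>
  define \<delta> where "\<delta> = e / 10"
  have \<delta>: "\<delta> > 0" using e by (simp add: \<delta>_def)
  have "M.mtotally_bounded (states A)" by (rule M.compactin_imp_mtotally_bounded[OF qcms_compact[OF q]])
  from this[unfolded M.mtotally_bounded_def, rule_format, OF \<delta>]
  obtain \<Phi> where \<Phi>: "finite \<Phi>" "\<Phi> \<subseteq> states A" "states A \<subseteq> (\<Union>\<phi>\<in>\<Phi>. M.mball \<phi> \<delta>)"
    by (elim exE conjE)
  define X where "X = {a \<in> Lip1 A L. cmod (\<mu> a) \<le> C}"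
  have Xsa: "a \<in> sa A" if "a \<in> X" for a using that by (simp add: X_def Lip1_def)
  define g where "g a = (\<lambda>\<phi>\<in>\<Phi>. \<lfloor>Re (\<phi> a) / \<delta>\<rfloor>)" for a
  \<comment> \<open>On the net the values are at most the diameter \<open>K\<close> plus
    \<open>C\<close> in modulus; the extra 1 absorbs the loss from taking the floor.\<close>
  define N where "N = \<lceil>(K + C) / \<delta>\<rceil> + 1"
  have "g ` X \<subseteq> (\<Pi>\<^sub>E \<phi>\<in>\<Phi>. {-N..N})"
  proof (rule image_subsetI)
    fix a assume a: "a \<in> X"
    have "\<lfloor>Re (\<phi> a) / \<delta>\<rfloor> \<in> {-N..N}" if "\<phi> \<in> \<Phi>" for \<phi>
    proof -
      have "\<phi> \<in> states A" using that \<Phi> by blast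
      then have "cmod (\<phi> a - \<mu> a) \<le> K"
        using order_trans[OF mk_ge K(2)[OF _ \<mu>]] a by (auto simp: X_def)
      then have "cmod (\<phi> a) \<le> K + C"
        using a norm_triangle_sub[of "\<phi> a" "\<mu> a"] by (simp add: X_def)
      then have "\<bar>Re (\<phi> a)\<bar> \<le> K + C" using abs_Re_le_cmod order_trans by blast
      then have "\<bar>Re (\<phi> a) / \<delta>\<bar> \<le> (K + C) / \<delta>" using \<delta> by (simp add: divide_right_mono)
      then show ?thesis unfolding N_def atLeastAtMost_iff by linarith
    qed
    then show "g a \<in> (\<Pi>\<^sub>E \<phi>\<in>\<Phi>. {-N..N})" by (simp add: g_def)
  qed
  then have "finite (g ` X)" using \<Phi>(1) finite_PiE finite_subset by (metis finite_atLeastAtMost_int)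
  moreover have "\<parallel>a \<ominus> b\<parallel> < e" if a: "a \<in> X" and b: "b \<in> X" and ab: "g a = g b" for a b
  proof -
    have "\<parallel>a \<ominus> b\<parallel> \<le> 3 * (3 * \<delta>)"
    proof (rule cnorm_le_of_states)
      show "a \<ominus> b \<in> sa A" using a b by (simp add: sa_diff Xsa)
      fix \<psi> assume \<psi>: "\<psi> \<in> states A"
      then obtain \<phi> where \<phi>: "\<phi> \<in> \<Phi>" "real_of_ereal (mk A L \<phi> \<psi>) < \<delta>" "\<phi> \<in> states A"
        using \<Phi>(3) by auto
      have close: "cmod (\<phi> c - \<psi> c) \<le> \<delta>" if "c \<in> X" for c
        using le_real_mk[of c L \<phi> \<psi>] that qcms_finite[OF q \<phi>(3) \<psi>] \<phi>(2) by (simp add: X_def)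
      have "\<lfloor>Re (\<phi> a) / \<delta>\<rfloor> = \<lfloor>Re (\<phi> b) / \<delta>\<rfloor>"
        using fun_cong[OF ab, of \<phi>] \<phi>(1) by (simp add: g_def)
      then have "\<bar>Re (\<phi> a) / \<delta> - Re (\<phi> b) / \<delta>\<bar> \<le> 1" by linarith
      then have "\<bar>Re (\<phi> a) - Re (\<phi> b)\<bar> \<le> \<delta>" using \<delta> by (simp add: diff_divide_distrib[symmetric])
      then have "cmod (\<phi> a - \<phi> b) \<le> \<delta>"
        using state_sa_real[OF \<phi>(3) Xsa[OF a]] state_sa_real[OF \<phi>(3) Xsa[OF b]] by (simp add: cmod_eq_Re)
      moreover have "\<psi> (a \<ominus> b) = (\<phi> b - \<psi> b) - (\<phi> a - \<psi> a) + (\<phi> a - \<phi> b)"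
        by (simp add: state_diff[OF \<psi>])
      moreover have "cmod ((\<phi> b - \<psi> b) - (\<phi> a - \<psi> a) + (\<phi> a - \<phi> b)) \<le>
          cmod (\<phi> b - \<psi> b) + cmod (\<phi> a - \<psi> a) + cmod (\<phi> a - \<phi> b)"
        by (intro order_trans[OF norm_triangle_ineq] add_mono norm_triangle_ineq4) simp
      ultimately show "cmod (\<psi> (a \<ominus> b)) \<le> 3 * \<delta>" using close[OF a] close[OF b] by simp
    qed
    then show ?thesis using e by (simp add: \<delta>_def)
  qed
  ultimately obtain F where "finite F" "\<forall>a\<in>X. \<exists>b\<in>F. \<parallel>a \<ominus> b\<parallel> < e"
    using finite_net_of_finite_image[of g X "\<lambda>a b. \<parallel>a \<ominus> b\<parallel> < e"] by blast
  then show ?thesis unfolding X_def by blast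
qed

text \<open>The two inclusions between the topologies have different sources. Density of the
  elements of finite \<open>L\<close> makes every evaluation continuous for \<open>mk\<close>, so
  \<open>mk\<close> is at least as fine as the weak* topology. Total boundedness reduces closeness
  on all of \<open>Lip1 A L\<close> to closeness at finitely many elements, so every ball contains a
  weak* neighbourhood of its centre.\<close>

theorem qcms_of_totally_bounded:
  assumes out: "\<And>a. a \<notin> sa A \<Longrightarrow> L a = \<infinity>"
    and nonneg: "\<And>a. 0 \<le> L a"
    and add: "\<And>a b. a \<in> sa A \<Longrightarrow> b \<in> sa A \<Longrightarrow> L (a \<oplus> b) \<le> L a + L b"
    and scale: "\<And>a r. a \<in> sa A \<Longrightarrow> L (complex_of_real r \<cdot> a) = ereal \<bar>r\<bar> * L a"
    and dense: "\<And>a e. a \<in> sa A \<Longrightarrow> e > 0 \<Longrightarrow> \<exists>b. L b < \<infinity> \<and> \<parallel>b \<ominus> a\<parallel> < e"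
    and kernel: "\<And>a. a \<in> sa A \<Longrightarrow> L a = 0 \<longleftrightarrow> (\<exists>r. a = sc r)"
    and \<mu>: "\<mu> \<in> states A"
    and tb: "\<And>e. e > 0 \<Longrightarrow> \<exists>F. finite F \<and> (\<forall>a\<in>Lip1 A L. \<mu> a = 0 \<longrightarrow> (\<exists>b\<in>F. \<parallel>a \<ominus> b\<parallel> < e))"
  shows "qcms A L"
proof -
  let ?d = "\<lambda>\<phi> \<psi>. real_of_ereal (mk A L \<phi> \<psi>)"
  \<comment> \<open>Adding a scalar does not increase \<open>L a\<close> and leaves
    \<open>\<phi> a - \<psi> a\<close> unchanged, so a net for the elements with
    \<open>\<mu> a = 0\<close> serves all of \<open>Lip1 A L\<close>.\<close>
  have net: "\<exists>F. finite F \<and> (\<forall>a\<in>Lip1 A L. \<exists>b\<in>F. \<forall>\<phi>\<in>states A. \<forall>\<psi>\<in>states A.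
      cmod (\<phi> a - \<psi> a) \<le> cmod (\<phi> b - \<psi> b) + 2 * e)" if e: "e > 0" for e
  proof -
    obtain F where F: "finite F" "\<And>a. a \<in> Lip1 A L \<Longrightarrow> \<mu> a = 0 \<Longrightarrow> \<exists>b\<in>F. \<parallel>a \<ominus> b\<parallel> < e"
      using tb[OF e] by blast
    have "\<exists>b\<in>F. \<forall>\<phi>\<in>states A. \<forall>\<psi>\<in>states A. cmod (\<phi> a - \<psi> a) \<le> cmod (\<phi> b - \<psi> b) + 2 * e"
      if a: "a \<in> Lip1 A L" for a
    proof -
      define a' where "a' = a \<oplus> sc (- Re (\<mu> a))"
      have sa: "a \<in> sa A" and La: "L a \<le> 1" using a by (auto simp: Lip1_def)
      have "L a' \<le> L a + 0"
        using add[OF sa sa_sc, of "- Re (\<mu> a)"] kernel[OF sa_sc] unfolding a'_def by metis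
      then have "a' \<in> Lip1 A L" using La sa by (simp add: Lip1_def a'_def sa_add)
      moreover have "\<mu> a' = 0"
        using state_sa_eq[OF \<mu> sa] by (simp add: a'_def state_add[OF \<mu>] state_sc[OF \<mu>])
      ultimately obtain b where b: "b \<in> F" "\<parallel>a' \<ominus> b\<parallel> < e" using F(2) by blast
      have "cmod (\<phi> a - \<psi> a) \<le> cmod (\<phi> b - \<psi> b) + 2 * e"
        if \<phi>: "\<phi> \<in> states A" and \<psi>: "\<psi> \<in> states A" for \<phi> \<psi>
      proof -
        have "\<phi> a - \<psi> a = \<phi> a' - \<psi> a'"
          by (simp add: a'_def state_add[OF \<phi>] state_add[OF \<psi>] state_sc[OF \<phi>] state_sc[OF \<psi>])
        also have "\<dots> = (\<phi> b - \<psi> b) + (\<phi> (a' \<ominus> b) - \<psi> (a' \<ominus> b))"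
          by (simp add: state_diff[OF \<phi>] state_diff[OF \<psi>])
        also have "cmod \<dots> \<le> cmod (\<phi> b - \<psi> b) + (cmod (\<phi> (a' \<ominus> b)) + cmod (\<psi> (a' \<ominus> b)))"
          by (intro order_trans[OF norm_triangle_ineq] add_mono norm_triangle_ineq4) simp
        finally show ?thesis
          using b(2) state_le_cnorm[OF \<phi>, of "a' \<ominus> b"] state_le_cnorm[OF \<psi>, of "a' \<ominus> b"] by linarith
      qed
      with b show ?thesis by blast
    qed
    with F(1) show ?thesis by blast
  qed
  have "L \<zero> = 0" using kernel[OF sa_zero] sc_simps(1) by metis
  then have zero: "\<zero> \<in> Lip1 A L" by (simp add: Lip1_def)
  have mk_nonneg: "0 \<le> mk A L \<phi> \<psi>" for \<phi> \<psi>
    by (rule order_trans[OF _ mk_ge[OF zero]]) simp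
  have mk_fin: "mk A L \<phi> \<psi> \<noteq> \<infinity>" if \<phi>: "\<phi> \<in> states A" and \<psi>: "\<psi> \<in> states A" for \<phi> \<psi>
  proof -
    obtain F where F: "finite F" "\<And>a. a \<in> Lip1 A L \<Longrightarrow>
        \<exists>b\<in>F. \<forall>\<phi>\<in>states A. \<forall>\<psi>\<in>states A. cmod (\<phi> a - \<psi> a) \<le> cmod (\<phi> b - \<psi> b) + 2 * 1"
      using net[of 1] by (metis zero_less_one)
    have "cmod (\<phi> a - \<psi> a) \<le> (\<Sum>b\<in>F. cmod (\<phi> b - \<psi> b)) + 2" if a: "a \<in> Lip1 A L" for a
    proof -
      obtain b where b: "b \<in> F" "cmod (\<phi> a - \<psi> a) \<le> cmod (\<phi> b - \<psi> b) + 2"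
        using F(2)[OF a] \<phi> \<psi> by auto
      then show ?thesis using member_le_sum[of b F "\<lambda>b. cmod (\<phi> b - \<psi> b)"] F(1) by simp
    qed
    then have "mk A L \<phi> \<psi> \<le> ereal ((\<Sum>b\<in>F. cmod (\<phi> b - \<psi> b)) + 2)"
      unfolding mk_def by (intro SUP_least) simp
    then show ?thesis by auto
  qed
  have mk_le: "?d \<phi> \<psi> \<le> c" if "\<And>a. a \<in> Lip1 A L \<Longrightarrow> cmod (\<phi> a - \<psi> a) \<le> c" "0 \<le> c" for \<phi> \<psi> c
  proof -
    have "mk A L \<phi> \<psi> \<le> ereal c" unfolding mk_def using that by (intro SUP_least) simp
    then show ?thesis using mk_nonneg[of \<phi> \<psi>] by (cases "mk A L \<phi> \<psi>") auto
  qed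
  have mk_app: "cmod (\<phi> a - \<psi> a) \<le> ?d \<phi> \<psi>"
    if "\<phi> \<in> states A" "\<psi> \<in> states A" "a \<in> Lip1 A L" for \<phi> \<psi> a
    using le_real_mk that mk_fin by blast
  have dom_est: "\<exists>c>0. \<forall>\<phi>\<in>states A. \<forall>\<psi>\<in>states A. cmod (\<phi> b - \<psi> b) \<le> c * ?d \<phi> \<psi>" if b: "L b < \<infinity>" for b
  proof -
    have sb: "b \<in> sa A" using out b by fastforce
    obtain l where l: "L b = ereal l" "l \<ge> 0" using b nonneg[of b] by (cases "L b") auto
    \<comment> \<open>The added 1 keeps the divisor positive when \<open>L b = 0\<close>.\<close>
    define c where "c = l + 1"
    have c: "c > 0" "l / c \<le> 1" using l by (simp_all add: c_def)
    have "L (complex_of_real (1/c) \<cdot> b) \<le> 1" using scale[OF sb, of "1/c"] c l by simp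
    then have Lb: "complex_of_real (1/c) \<cdot> b \<in> Lip1 A L" using sa_scale[OF sb, of "1/c"] by (simp add: Lip1_def)
    have "cmod (\<phi> b - \<psi> b) \<le> c * ?d \<phi> \<psi>" if \<phi>: "\<phi> \<in> states A" and \<psi>: "\<psi> \<in> states A" for \<phi> \<psi>
    proof -
      have "cmod (complex_of_real (1/c) * (\<phi> b - \<psi> b)) \<le> ?d \<phi> \<psi>"
        using mk_app[OF \<phi> \<psi> Lb] by (simp only: state_csmult[OF \<phi>] state_csmult[OF \<psi>] right_diff_distrib)
      then have "cmod (\<phi> b - \<psi> b) / c \<le> ?d \<phi> \<psi>"
        using c by (simp add: norm_mult norm_divide)
      then show ?thesis using c by (simp add: field_simps)
    qed
    with c show ?thesis by blast
  qed
  \<comment> \<open>An approximant \<open>b\<close> of finite \<open>L\<close> is Lipschitz for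
    \<open>mk\<close>; replacing \<open>a\<close> by \<open>b\<close> costs \<open>e / 3\<close> at
    each of the two states.\<close>
  have sa_cont: "\<exists>r>0. \<forall>\<psi>\<in>states A. ?d \<phi> \<psi> < r \<longrightarrow> cmod (\<phi> a - \<psi> a) < e"
    if \<phi>: "\<phi> \<in> states A" and a: "a \<in> sa A" and e: "e > 0" for \<phi> a e
  proof -
    obtain b where b: "L b < \<infinity>" "\<parallel>b \<ominus> a\<parallel> < e / 3" using dense[OF a, of "e / 3"] e by auto
    obtain c where c: "c > 0" "\<forall>\<phi>\<in>states A. \<forall>\<psi>\<in>states A. cmod (\<phi> b - \<psi> b) \<le> c * ?d \<phi> \<psi>"
      using dom_est[OF b(1)] by blast
    have "cmod (\<phi> a - \<psi> a) < e" if \<psi>: "\<psi> \<in> states A" and d: "?d \<phi> \<psi> < e / (3 * c)" for \<psi>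
    proof -
      have "c * ?d \<phi> \<psi> < e / 3" using d c by (simp add: field_simps)
      then have 1: "cmod (\<phi> b - \<psi> b) < e / 3" using c(2) \<phi> \<psi> by (meson le_less_trans)
      have "\<phi> a - \<psi> a = (\<phi> b - \<psi> b) + (\<psi> (b \<ominus> a) - \<phi> (b \<ominus> a))"
        by (simp add: state_diff[OF \<phi>] state_diff[OF \<psi>])
      also have "cmod \<dots> \<le> cmod (\<phi> b - \<psi> b) + (cmod (\<psi> (b \<ominus> a)) + cmod (\<phi> (b \<ominus> a)))"
        by (intro order_trans[OF norm_triangle_ineq] add_mono norm_triangle_ineq4) simp
      finally show ?thesis
        using 1 b(2) state_le_cnorm[OF \<phi>, of "b \<ominus> a"] state_le_cnorm[OF \<psi>, of "b \<ominus> a"] by linarith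
    qed
    then show ?thesis using c e by (intro exI[of _ "e / (3 * c)"]) auto
  qed
  have cont: "\<exists>r>0. \<forall>\<psi>\<in>states A. ?d \<phi> \<psi> < r \<longrightarrow> cmod (\<phi> x - \<psi> x) < e"
    if \<phi>: "\<phi> \<in> states A" and e: "e > 0" for \<phi> x e
  proof -
    obtain u v where uv: "u \<in> sa A" "v \<in> sa A" "x = u \<oplus> \<i> \<cdot> v" by (rule sa_decomp)
    obtain r where r: "r > 0" "\<And>\<psi>. \<psi> \<in> states A \<Longrightarrow> ?d \<phi> \<psi> < r \<Longrightarrow> cmod (\<phi> u - \<psi> u) < e / 2"
      using sa_cont[OF \<phi> uv(1), of "e / 2"] e by auto
    obtain s where s: "s > 0" "\<And>\<psi>. \<psi> \<in> states A \<Longrightarrow> ?d \<phi> \<psi> < s \<Longrightarrow> cmod (\<phi> v - \<psi> v) < e / 2"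
      using sa_cont[OF \<phi> uv(2), of "e / 2"] e by auto
    have "cmod (\<phi> x - \<psi> x) < e" if \<psi>: "\<psi> \<in> states A" and d: "?d \<phi> \<psi> < min r s" for \<psi>
    proof -
      have "\<phi> x - \<psi> x = (\<phi> u - \<psi> u) + \<i> * (\<phi> v - \<psi> v)"
        by (simp add: uv(3) state_add[OF \<phi>] state_add[OF \<psi>] state_csmult[OF \<phi>] state_csmult[OF \<psi>]
            algebra_simps)
      also have "cmod \<dots> \<le> cmod (\<phi> u - \<psi> u) + cmod (\<i> * (\<phi> v - \<psi> v))" by (rule norm_triangle_ineq)
      finally show ?thesis using r(2)[OF \<psi>] s(2)[OF \<psi>] d by (simp add: norm_mult)
    qed
    then show ?thesis using r(1) s(1) by (intro exI[of _ "min r s"]) auto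
  qed
  have metric: "Metric_space (states A) ?d"
  proof
    fix \<phi> \<psi> \<theta>
    show "0 \<le> ?d \<phi> \<psi>" by (rule real_of_ereal_pos) (rule mk_nonneg)
    show "?d \<phi> \<psi> = ?d \<psi> \<phi>" by (simp add: mk_def norm_minus_commute)
    assume \<phi>: "\<phi> \<in> states A" and \<psi>: "\<psi> \<in> states A"
    show "?d \<phi> \<psi> = 0 \<longleftrightarrow> \<phi> = \<psi>"
    proof
      assume d0: "?d \<phi> \<psi> = 0"
      \<comment> \<open>\<open>mk\<close> tests only elements of \<open>Lip1 A L\<close>; that
        distance zero separates states at all \<open>x\<close> comes from continuity of the
        evaluation, with the putative difference itself as tolerance.\<close>
      have "cmod (\<phi> x - \<psi> x) \<le> 0" for x
      proof (rule ccontr)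
        assume "\<not> cmod (\<phi> x - \<psi> x) \<le> 0"
        then obtain r where "r > 0" "\<forall>\<psi>'\<in>states A. ?d \<phi> \<psi>' < r \<longrightarrow> cmod (\<phi> x - \<psi>' x) < cmod (\<phi> x - \<psi> x)"
          using cont[OF \<phi>, of "cmod (\<phi> x - \<psi> x)" x] by auto
        then show False using \<psi> d0 by fastforce
      qed
      then show "\<phi> = \<psi>" by auto
    next
      assume "\<phi> = \<psi>"
      then have "?d \<phi> \<psi> \<le> 0" by (intro mk_le) auto
      then show "?d \<phi> \<psi> = 0" using real_of_ereal_pos[OF mk_nonneg] by (simp add: order_antisym)
    qed
    assume \<theta>: "\<theta> \<in> states A"
    show "?d \<phi> \<theta> \<le> ?d \<phi> \<psi> + ?d \<psi> \<theta>"
    proof (rule mk_le)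
      fix a assume a: "a \<in> Lip1 A L"
      have "cmod (\<phi> a - \<theta> a) \<le> cmod (\<phi> a - \<psi> a) + cmod (\<psi> a - \<theta> a)"
        using norm_triangle_ineq[of "\<phi> a - \<psi> a" "\<psi> a - \<theta> a"] by simp
      then show "cmod (\<phi> a - \<theta> a) \<le> ?d \<phi> \<psi> + ?d \<psi> \<theta>"
        using mk_app[OF \<phi> \<psi> a] mk_app[OF \<psi> \<theta> a] by linarith
    qed (intro add_nonneg_nonneg real_of_ereal_pos mk_nonneg)
  qed
  interpret M: Metric_space "states A" ?d by (rule metric)
  have "openin M.mtopology U" if U: "openin (top_of_set (states A)) U" for U
  proof -
    have "continuous_map M.mtopology euclidean (\<lambda>\<phi>. \<phi> x)" for x
      unfolding continuous_map_def
    proof (intro conjI allI impI)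
      fix V :: "complex set" assume "openin euclidean V"
      then have V: "open V" by simp
      show "openin M.mtopology {\<phi> \<in> topspace M.mtopology. \<phi> x \<in> V}"
        unfolding M.openin_mtopology
      proof (intro conjI allI impI)
        fix \<phi> assume "\<phi> \<in> {\<phi> \<in> topspace M.mtopology. \<phi> x \<in> V}"
        then have \<phi>: "\<phi> \<in> states A" "\<phi> x \<in> V" by auto
        then obtain e where e: "e > 0" "ball (\<phi> x) e \<subseteq> V" using V by (meson openE)
        obtain r where "r > 0" "\<forall>\<psi>\<in>states A. ?d \<phi> \<psi> < r \<longrightarrow> cmod (\<phi> x - \<psi> x) < e"
          using cont[OF \<phi>(1) e(1)] by blast
        then show "\<exists>r>0. M.mball \<phi> r \<subseteq> {\<phi> \<in> topspace M.mtopology. \<phi> x \<in> V}"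
          using e(2) by (intro exI[of _ r]) (auto simp: M.in_mball dist_norm subset_iff)
      qed auto
    qed auto
    then have "continuous_map M.mtopology euclidean (\<lambda>\<phi>. \<phi>)"
      unfolding euclidean_product_topology[symmetric]
      by (intro continuous_map_coordinatewise_then_product) auto
    moreover obtain V where V: "open V" "U = states A \<inter> V" using U by (auto simp: openin_open)
    ultimately have "openin M.mtopology {\<phi> \<in> topspace M.mtopology. \<phi> \<in> V}"
      by (intro openin_continuous_map_preimage) auto
    also have "{\<phi> \<in> topspace M.mtopology. \<phi> \<in> V} = U" by (auto simp: V)
    finally show ?thesis .
  qed
  moreover have "openin (top_of_set (states A)) U" if U: "openin M.mtopology U" for U
  proof (subst openin_subopen, intro ballI)
    fix \<phi> assume "\<phi> \<in> U"
    then obtain r where r: "r > 0" "M.mball \<phi> r \<subseteq> U" and \<phi>: "\<phi> \<in> states A"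
      using U unfolding M.openin_mtopology by blast
    obtain F where F: "finite F" "\<And>a. a \<in> Lip1 A L \<Longrightarrow> \<exists>b\<in>F. \<forall>\<phi>\<in>states A. \<forall>\<psi>\<in>states A.
        cmod (\<phi> a - \<psi> a) \<le> cmod (\<phi> b - \<psi> b) + 2 * (r / 6)"
      using net[of "r / 6"] r by (metis zero_less_divide_iff zero_less_numeral)
    \<comment> \<open>A difference below \<open>r / 3\<close> at the net elements plus the net error
      \<open>2 * (r / 6)\<close> leaves at most \<open>2 r / 3\<close>, strictly below
      \<open>r\<close>.\<close>
    define W where "W = (\<Inter>b\<in>F. {\<psi>. cmod (\<phi> b - \<psi> b) < r / 3})"
    have "open W"
      unfolding W_def using F(1)
      by (intro open_INT ballI open_Collect_less continuous_intros continuous_on_product_coordinates) auto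
    have "states A \<inter> W \<subseteq> U"
    proof
      fix \<psi> assume \<psi>: "\<psi> \<in> states A \<inter> W"
      have "?d \<phi> \<psi> \<le> r / 3 + 2 * (r / 6)"
      proof (rule mk_le)
        fix a assume "a \<in> Lip1 A L"
        then obtain b where b: "b \<in> F" "cmod (\<phi> a - \<psi> a) \<le> cmod (\<phi> b - \<psi> b) + 2 * (r / 6)"
          using F(2)[of a] \<phi> \<psi> by blast
        then have "cmod (\<phi> b - \<psi> b) < r / 3" using \<psi> by (auto simp: W_def)
        then show "cmod (\<phi> a - \<psi> a) \<le> r / 3 + 2 * (r / 6)" using b(2) by linarith
      qed (use r in simp)
      then have "?d \<phi> \<psi> < r" using r by simp
      then show "\<psi> \<in> U" using r(2) \<phi> \<psi> by (auto simp: subset_iff M.in_mball)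
    qed
    moreover have "\<phi> \<in> states A \<inter> W" using \<phi> r by (auto simp: W_def)
    ultimately show "\<exists>T. openin (top_of_set (states A)) T \<and> \<phi> \<in> T \<and> T \<subseteq> U"
      using \<open>open W\<close> by (intro exI[of _ "states A \<inter> W"]) (auto simp: openin_open)
  qed
  ultimately have "M.mtopology = weak_star_states A"
    unfolding weak_star_states_eq by (auto simp: topology_eq)
  then show ?thesis
    unfolding qcms_def sc_def[symmetric]
    using cstar out nonneg add scale dense kernel mk_fin metric by blast
qed

end

section \<open>Direct sums and the Hausdorff distance\<close>

lemma dsum_simps [simp]:
  "czero (dsum A B) = (czero A, czero B)" "cone (dsum A B) = (cone A, cone B)"
  "cadd (dsum A B) (a, b) (a', b') = (cadd A a a', cadd B b b')"
  "csmult (dsum A B) c (a, b) = (csmult A c a, csmult B c b)"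
  "cmult (dsum A B) (a, b) (a', b') = (cmult A a a', cmult B b b')"
  "cstar (dsum A B) (a, b) = (cstar A a, cstar B b)"
  "cnorm (dsum A B) (a, b) = max (cnorm A a) (cnorm B b)"
  "csub (dsum A B) (a, b) (a', b') = (csub A a a', csub B b b')"
  by (simp_all add: dsum_def csub_def)

lemma sa_dsum_iff [simp]: "(a, b) \<in> sa (dsum A B) \<longleftrightarrow> a \<in> sa A \<and> b \<in> sa B"
  by (simp add: sa_def)

lemma dsum_complete:
  fixes A :: "'a cstar_alg" and B :: "'b cstar_alg" and f :: "nat \<Rightarrow> 'a \<times> 'b"
  assumes "ucstar A" "ucstar B"
    and f: "\<forall>e>0. \<exists>N. \<forall>m\<ge>N. \<forall>n\<ge>N. cnorm (dsum A B) (csub (dsum A B) (f m) (f n)) < e"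
  shows "\<exists>x. \<forall>e>0. \<exists>N. \<forall>n\<ge>N. cnorm (dsum A B) (csub (dsum A B) (f n) x) < e"
proof -
  interpret A: ucstar A by fact
  interpret B: ucstar B by fact
  have norm: "cnorm (dsum A B) (csub (dsum A B) x y)
      = max (cnorm A (csub A (fst x) (fst y))) (cnorm B (csub B (snd x) (snd y)))" for x y
    by (cases x; cases y) simp
  have "\<exists>x. \<forall>e>0. \<exists>N. \<forall>n\<ge>N. cnorm A (csub A (fst (f n)) x) < e"
    by (rule A.cnorm_complete) (use f[unfolded norm max_less_iff_conj] in meson)
  then obtain x where x: "\<And>e. e > 0 \<Longrightarrow> \<exists>N. \<forall>n\<ge>N. cnorm A (csub A (fst (f n)) x) < e" by blast
  have "\<exists>y. \<forall>e>0. \<exists>N. \<forall>n\<ge>N. cnorm B (csub B (snd (f n)) y) < e"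
    by (rule B.cnorm_complete) (use f[unfolded norm max_less_iff_conj] in meson)
  then obtain y where y: "\<And>e. e > 0 \<Longrightarrow> \<exists>N. \<forall>n\<ge>N. cnorm B (csub B (snd (f n)) y) < e" by blast
  have "\<exists>N. \<forall>n\<ge>N. cnorm (dsum A B) (csub (dsum A B) (f n) (x, y)) < e" if e: "e > 0" for e
  proof -
    obtain M N where "\<forall>n\<ge>M. cnorm A (csub A (fst (f n)) x) < e" "\<forall>n\<ge>N. cnorm B (csub B (snd (f n)) y) < e"
      using x[OF e] y[OF e] by blast
    then show ?thesis by (intro exI[of _ "max M N"]) (simp add: norm)
  qed
  then show ?thesis by blast
qed

lemma ucstar_dsum:
  fixes A :: "'a cstar_alg" and B :: "'b cstar_alg"
  assumes "ucstar A" "ucstar B"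
  shows "ucstar (dsum A B)"
proof -
  interpret A: ucstar A by fact
  interpret B: ucstar B by fact
  have sq: "max (x\<^sup>2) (y\<^sup>2) = (max x y)\<^sup>2" if "0 \<le> x" "0 \<le> y" for x y :: real
    using that by (auto simp: max_def power2_le_iff_abs_le power_mono)
  have tri: "max (cnorm A (cadd A a a')) (cnorm B (cadd B b b'))
      \<le> max (cnorm A a) (cnorm B b) + max (cnorm A a') (cnorm B b')" for a a' b b'
    using A.cnorm_triangle[of a a'] B.cnorm_triangle[of b b'] by linarith
  have mult: "max (cnorm A (cmult A a a')) (cnorm B (cmult B b b'))
      \<le> max (cnorm A a) (cnorm B b) * max (cnorm A a') (cnorm B b')" for a a' b b'
    by (intro max.boundedI order_trans[OF A.cnorm_mult] order_trans[OF B.cnorm_mult] mult_mono)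
      (auto simp: le_max_iff_disj)
  have scale: "max (c * x) (c * y) = c * max x y" if "0 \<le> c" for c x y :: real
    by (rule max_of_mono) (simp add: mono_def mult_left_mono that)
  have "unital_cstar_algebra (dsum A B)"
    unfolding unital_cstar_algebra_def
  proof (intro conjI)
    show "\<forall>f::nat \<Rightarrow> _. (\<forall>e>0. \<exists>N. \<forall>m\<ge>N. \<forall>n\<ge>N. cnorm (dsum A B) (csub (dsum A B) (f m) (f n)) < e) \<longrightarrow>
        (\<exists>x. \<forall>e>0. \<exists>N. \<forall>n\<ge>N. cnorm (dsum A B) (csub (dsum A B) (f n) x) < e)"
      using dsum_complete[OF assms] by (intro allI impI)
    show "\<forall>x y. cadd (dsum A B) x y = cadd (dsum A B) y x"
      by (auto intro: A.cadd_commute B.cadd_commute)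
    show "\<forall>x. (cnorm (dsum A B) x = 0) = (x = czero (dsum A B))"
    proof (simp add: split_paired_All, intro allI)
      fix a b
      show "max (cnorm A a) (cnorm B b) = 0 \<longleftrightarrow> a = czero A \<and> b = czero B"
        using A.cnorm_ge_0[of a] B.cnorm_ge_0[of b]
        unfolding A.cnorm_eq_0[symmetric] B.cnorm_eq_0[symmetric] by linarith
    qed
  qed (auto simp: A.cadd_assoc B.cadd_assoc A.cadd_zero_left B.cadd_zero_left
        A.cadd_uminus B.cadd_uminus A.csmult_add_right B.csmult_add_right
        A.csmult_add_left B.csmult_add_left A.cmult_assoc B.cmult_assoc
        A.cmult_distrib_left B.cmult_distrib_left A.cmult_distrib_right B.cmult_distrib_right
        A.one_cmult B.one_cmult A.cmult_one B.cmult_one A.cstar_add B.cstar_add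
        A.cstar_csmult B.cstar_csmult A.cstar_mult B.cstar_mult A.cnorm_csmult B.cnorm_csmult
        A.cnorm_cstar_mult B.cnorm_cstar_mult sq scale le_max_iff_disj
        simp del: max.bounded_iff intro: tri mult)
  then show ?thesis using A.one_neq_zero by (simp add: ucstar_def)
qed

lemma inclA_state: "\<phi> \<in> states A \<Longrightarrow> inclA \<phi> \<in> states (dsum A B)"
  by (auto simp: states_def inclA_def)

text \<open>The slack \<open>r\<close> is there because the infimum over \<open>Y\<close> need not
  be attained.\<close>

lemma haus_leD1:
  assumes "haus d X Y \<le> ereal c" "x \<in> X" "r > 0"
  shows "\<exists>y\<in>Y. d x y < ereal (c + r)"
proof -
  have "(INF y\<in>Y. d x y) \<le> (SUP x\<in>X. INF y\<in>Y. d x y)" using assms(2) by (rule SUP_upper)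
  also have "\<dots> \<le> ereal c" using assms(1) by (simp add: haus_def)
  also have "\<dots> < ereal (c + r)" using assms(3) by simp
  finally show ?thesis by (simp add: INF_less_iff)
qed

lemma haus_leD2:
  assumes "haus d X Y \<le> ereal c" "y \<in> Y" "r > 0"
  shows "\<exists>x\<in>X. d x y < ereal (c + r)"
proof -
  have "(INF x\<in>X. d x y) \<le> (SUP y\<in>Y. INF x\<in>X. d x y)" using assms(2) by (rule SUP_upper)
  also have "\<dots> \<le> ereal c" using assms(1) by (simp add: haus_def)
  also have "\<dots> < ereal (c + r)" using assms(3) by simp
  finally show ?thesis by (simp add: INF_less_iff)
qed

lemma haus_leI:
  assumes "\<And>x r. x \<in> X \<Longrightarrow> r > 0 \<Longrightarrow> \<exists>y\<in>Y. d x y \<le> ereal (c + r)"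
    and "\<And>y r. y \<in> Y \<Longrightarrow> r > 0 \<Longrightarrow> \<exists>x\<in>X. d x y \<le> ereal (c + r)"
  shows "haus d X Y \<le> ereal c"
  unfolding haus_def
proof (rule max.boundedI; rule SUP_least; rule ereal_le_epsilon2)
  show "(INF y\<in>Y. d x y) \<le> ereal c + ereal r" if "x \<in> X" "0 < r" for x r
    using assms(1)[OF that] by (auto intro: INF_lower2)
  show "(INF x\<in>X. d x y) \<le> ereal c + ereal r" if "y \<in> Y" "0 < r" for y r
    using assms(2)[OF that] by (auto intro: INF_lower2)
qed

section \<open>Bridges\<close>

locale lip_bridge =
  fixes A :: "'a cstar_alg" and LA :: "'a \<Rightarrow> ereal"
    and B :: "'b cstar_alg" and LB :: "'b \<Rightarrow> ereal"
    and D :: "'d cstar_alg" and \<omega> :: 'd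
    and \<pi>A :: "'a \<Rightarrow> 'd" and \<pi>B :: "'b \<Rightarrow> 'd"
  assumes qA: "qcms A LA" and qB: "qcms B LB" and bridge: "bridge A B D \<omega> \<pi>A \<pi>B"
begin

lemma homA: "unital_inj_star_hom A D \<pi>A" and homB: "unital_inj_star_hom B D \<pi>B"
  and level1_nonempty: "level1 D \<omega> \<noteq> {}"
  using bridge by (auto simp: bridge_def)

lemma hom_simps [simp]:
  "\<pi>A (cadd A x y) = cadd D (\<pi>A x) (\<pi>A y)" "\<pi>A (csmult A c x) = csmult D c (\<pi>A x)"
  "\<pi>A (cmult A x y) = cmult D (\<pi>A x) (\<pi>A y)" "\<pi>A (cstar A x) = cstar D (\<pi>A x)" "\<pi>A (cone A) = cone D"
  "\<pi>B (cadd B x' y') = cadd D (\<pi>B x') (\<pi>B y')" "\<pi>B (csmult B c x') = csmult D c (\<pi>B x')"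
  "\<pi>B (cmult B x' y') = cmult D (\<pi>B x') (\<pi>B y')" "\<pi>B (cstar B x') = cstar D (\<pi>B x')" "\<pi>B (cone B) = cone D"
  "\<pi>A (csub A x y) = csub D (\<pi>A x) (\<pi>A y)" "\<pi>B (csub B x' y') = csub D (\<pi>B x') (\<pi>B y')"
  using homA homB by (auto simp: unital_inj_star_hom_def csub_def)

text \<open>A state is 0 at zero and 1 at the unit, so a nonempty 1-level excludes the zero algebra.
  Unital homomorphisms carry this over to \<open>A\<close> and \<open>B\<close>.\<close>

lemma ucstar_D: "ucstar D"
proof
  show D: "unital_cstar_algebra D" using bridge by (simp add: bridge_def)
  obtain \<theta> where "\<theta> \<in> states D" using level1_nonempty by (auto simp: level1_def)
  then have "\<theta> (cone D) = 1" "\<theta> (cadd D (czero D) (czero D)) = \<theta> (czero D) + \<theta> (czero D)"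
    by (auto simp: states_def)
  moreover have "cadd D (czero D) (czero D) = czero D" using D by (simp add: unital_cstar_algebra_def)
  ultimately show "cone D \<noteq> czero D" by auto
qed

sublocale D: ucstar D by (rule ucstar_D)

sublocale A: ucstar A
proof
  show cA: "unital_cstar_algebra A" using qA by (simp add: qcms_def)
  show "cone A \<noteq> czero A"
  proof
    assume 0: "cone A = czero A"
    have "cadd A (czero A) (czero A) = czero A" using cA by (simp add: unital_cstar_algebra_def)
    then have "cadd D (cone D) (cone D) = cone D" using hom_simps(1,5) 0 by metis
    then show False using D.one_neq_zero D.rng.add_cancel_left_right by metis
  qed
qed

sublocale B: ucstar B
proof
  show cB: "unital_cstar_algebra B" using qB by (simp add: qcms_def)
  show "cone B \<noteq> czero B"
  proof
    assume 0: "cone B = czero B"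
    have "cadd B (czero B) (czero B) = czero B" using cB by (simp add: unital_cstar_algebra_def)
    then have "cadd D (cone D) (cone D) = cone D" using hom_simps(6,10) 0 by metis
    then show False using D.one_neq_zero D.rng.add_cancel_left_right by metis
  qed
qed

sublocale E: ucstar "dsum A B"
  by (rule ucstar_dsum) unfold_locales

lemma hom_sc [simp]: "\<pi>A (A.sc r) = D.sc r" "\<pi>B (B.sc r) = D.sc r"
  by (simp_all add: A.sc_def B.sc_def D.sc_def)

lemma E_sc: "E.sc r = (A.sc r, B.sc r)"
  by (simp add: A.sc_def B.sc_def E.sc_def)

lemma homA_cnorm_le: "a \<in> sa A \<Longrightarrow> cnorm D (\<pi>A a) \<le> cnorm A a"
  by (rule star_hom_cnorm_le[OF _ _ homA]) unfold_locales

lemma homB_cnorm_le: "b \<in> sa B \<Longrightarrow> cnorm D (\<pi>B b) \<le> cnorm B b"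
  by (rule star_hom_cnorm_le[OF _ _ homB]) unfold_locales

section \<open>The gap of a pair and the 1-level\<close>

definition gap :: "'a \<Rightarrow> 'b \<Rightarrow> 'd" where
  "gap a b = csub D (cmult D (\<pi>A a) \<omega>) (cmult D \<omega> (\<pi>B b))"

abbreviation N :: "'a \<Rightarrow> 'b \<Rightarrow> real" where "N a b \<equiv> cnorm D (gap a b)"

lemma gap_add: "gap (cadd A a a') (cadd B b b') = cadd D (gap a b) (gap a' b')"
  by (simp add: gap_def D.ring_simps)

lemma gap_csmult: "gap (csmult A c a) (csmult B c b) = csmult D c (gap a b)"
  by (simp add: gap_def D.csmult_diff_right)

lemma gap_diff: "gap (csub A a a') (csub B b b') = csub D (gap a b) (gap a' b')"
  by (simp add: gap_def D.ring_simps)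

text \<open>The gap is a commutator with the pivot, hence a derivation:
  \<open>\<pi>A a \<omega> \<pi>B b'\<close> is subtracted and added. This is the source of the
  Leibniz inequality.\<close>

lemma gap_mult: "gap (cmult A a a') (cmult B b b')
    = cadd D (cmult D (\<pi>A a) (gap a' b')) (cmult D (gap a b) (\<pi>B b'))"
  by (simp add: gap_def D.ring_simps)

lemma gap_sc: "gap (A.sc r) (B.sc s) = csmult D (complex_of_real (r - s)) \<omega>"
  by (simp add: gap_def D.csmult_diff_left)

lemma N_mult_le:
  assumes "a \<in> sa A" "b' \<in> sa B"
  shows "N (cmult A a a') (cmult B b b') \<le> cnorm A a * N a' b' + cnorm B b' * N a b"
proof -
  have "cnorm D (cmult D (\<pi>A a) (gap a' b')) \<le> cnorm A a * N a' b'"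
    by (intro order_trans[OF D.cnorm_mult] mult_right_mono homA_cnorm_le assms D.cnorm_ge_0)
  moreover have "cnorm D (cmult D (gap a b) (\<pi>B b')) \<le> N a b * cnorm B b'"
    by (intro order_trans[OF D.cnorm_mult] mult_left_mono homB_cnorm_le assms D.cnorm_ge_0)
  ultimately show ?thesis
    unfolding gap_mult using D.cnorm_triangle[of "cmult D (\<pi>A a) (gap a' b')" "cmult D (gap a b) (\<pi>B b')"]
    by (simp add: mult.commute)
qed

lemma level1_pullback:
  assumes "\<theta> \<in> level1 D \<omega>"
  shows "\<theta> \<in> states D" "\<theta> \<circ> \<pi>A \<in> states A" "\<theta> \<circ> \<pi>B \<in> states B"
  using assms by (auto simp: level1_def states_def)

text \<open>Each of the two conditions on the 1-level serves one side: with
  \<open>z = 1 - \<omega>\<close>, one removes the pivot on the right of \<open>\<pi>A a\<close>,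
  the other on the left of \<open>\<pi>B b\<close>.\<close>

lemma level1_gap:
  assumes "\<theta> \<in> level1 D \<omega>"
  shows "\<theta> (gap a b) = \<theta> (\<pi>A a) - \<theta> (\<pi>B b)"
proof -
  define z where "z = csub D (cone D) \<omega>"
  have \<theta>: "\<theta> \<in> states D" and z: "\<theta> (cmult D (cstar D z) z) = 0" "\<theta> (cmult D z (cstar D z)) = 0"
    using assms by (auto simp: level1_def z_def)
  have "\<theta> (cmult D (\<pi>A a) z) = 0" by (rule D.state_mult_null[OF \<theta> z(1)])
  then have "\<theta> (cmult D (\<pi>A a) \<omega>) = \<theta> (\<pi>A a)"
    by (simp add: z_def D.rng.right_diff_distrib D.state_diff[OF \<theta>])
  moreover have "\<theta> (cmult D z (\<pi>B b)) = 0" by (rule D.state_null_mult[OF \<theta> z(2)])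
  then have "\<theta> (cmult D \<omega> (\<pi>B b)) = \<theta> (\<pi>B b)"
    by (simp add: z_def D.rng.left_diff_distrib D.state_diff[OF \<theta>])
  ultimately show ?thesis by (simp add: gap_def D.state_diff[OF \<theta>])
qed

lemma level1_diff_le:
  assumes "\<theta> \<in> level1 D \<omega>"
  shows "cmod (\<theta> (\<pi>A a) - \<theta> (\<pi>B b)) \<le> N a b"
  using level1_gap[OF assms] D.state_le_cnorm[OF level1_pullback(1)[OF assms]] by metis

text \<open>The pivot is the gap of the pair \<open>(1, 0)\<close>, at which a state in the 1-level
  has value 1.\<close>

lemma pivot_nonzero: "cnorm D \<omega> > 0"
proof -
  obtain \<theta> where \<theta>: "\<theta> \<in> level1 D \<omega>" using level1_nonempty by blast
  note st = level1_pullback(1)[OF \<theta>]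
  have "gap (cone A) (czero B) = \<omega>" using gap_sc[of 1 0] by simp
  moreover have "\<theta> (gap (cone A) (czero B)) = 1"
    using level1_gap[OF \<theta>, of "cone A" "czero B"] D.state_one[OF st] D.state_zero[OF st] hom_sc(2)[of 0]
    by simp
  ultimately show ?thesis using D.state_le_cnorm[OF st, of \<omega>] by simp
qed

section \<open>Finiteness of the length\<close>

abbreviation len :: ereal where "len \<equiv> bridge_length A LA B LB D \<omega> \<pi>A \<pi>B"

lemma LA_sc: "LA (A.sc r) = 0" and LB_sc: "LB (B.sc r) = 0"
  using A.qcms_kernel[OF qA, of "A.sc r"] B.qcms_kernel[OF qB, of "B.sc r"] by auto

text \<open>A member \<open>a\<close> of \<open>Lip1 A LA\<close> is compared with the scalar
  \<open>t = Re (\<theta> (\<pi>A a))\<close> in the other algebra. Scalars have Lip-norm 0 and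
  commute with the pivot, and \<open>a - t\<close> is bounded in norm.\<close>

lemma reach_bounded: "\<exists>K. bridge_reach A LA B LB D \<omega> \<pi>A \<pi>B \<le> ereal K"
proof -
  obtain \<theta> where \<theta>: "\<theta> \<in> level1 D \<omega>" using level1_nonempty by blast
  obtain KA where KA: "\<And>a. a \<in> Lip1 A LA \<Longrightarrow> cnorm A (csub A a (A.sc (Re ((\<theta> \<circ> \<pi>A) a)))) \<le> KA"
    using A.Lip1_cnorm_bounded[OF qA level1_pullback(2)[OF \<theta>]] by metis
  obtain KB where KB: "\<And>b. b \<in> Lip1 B LB \<Longrightarrow> cnorm B (csub B b (B.sc (Re ((\<theta> \<circ> \<pi>B) b)))) \<le> KB"
    using B.Lip1_cnorm_bounded[OF qB level1_pullback(3)[OF \<theta>]] by metis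
  define K where "K = max (KA * cnorm D \<omega>) (KB * cnorm D \<omega>)"
  have "haus (\<lambda>x y. ereal (cnorm D (csub D x y)))
       ((\<lambda>a. cmult D (\<pi>A a) \<omega>) ` Lip1 A LA) ((\<lambda>b. cmult D \<omega> (\<pi>B b)) ` Lip1 B LB) \<le> ereal K"
  proof (rule haus_leI)
    fix x and r :: real assume "x \<in> (\<lambda>a. cmult D (\<pi>A a) \<omega>) ` Lip1 A LA" and r: "r > 0"
    then obtain a where a: "a \<in> Lip1 A LA" "x = cmult D (\<pi>A a) \<omega>" by blast
    define t where "t = Re ((\<theta> \<circ> \<pi>A) a)"
    have "csub D x (cmult D \<omega> (\<pi>B (B.sc t))) = cmult D (\<pi>A (csub A a (A.sc t))) \<omega>"
      by (simp add: a(2) D.rng.left_diff_distrib)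
    moreover have "csub A a (A.sc t) \<in> sa A" using a by (simp add: Lip1_def A.sa_diff)
    ultimately have "cnorm D (csub D x (cmult D \<omega> (\<pi>B (B.sc t)))) \<le> KA * cnorm D \<omega>"
      using order_trans[OF homA_cnorm_le KA[OF a(1), folded t_def]]
      by (metis D.cnorm_mult D.cnorm_ge_0 mult_right_mono order_trans)
    moreover have "B.sc t \<in> Lip1 B LB" by (simp add: Lip1_def LB_sc)
    ultimately show "\<exists>y\<in>(\<lambda>b. cmult D \<omega> (\<pi>B b)) ` Lip1 B LB. ereal (cnorm D (csub D x y)) \<le> ereal (K + r)"
      using r by (intro bexI[OF _ imageI[of "B.sc t"]]) (auto simp: K_def)
  next
    fix y and r :: real assume "y \<in> (\<lambda>b. cmult D \<omega> (\<pi>B b)) ` Lip1 B LB" and r: "r > 0"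
    then obtain b where b: "b \<in> Lip1 B LB" "y = cmult D \<omega> (\<pi>B b)" by blast
    define t where "t = Re ((\<theta> \<circ> \<pi>B) b)"
    have "csub D y (cmult D (\<pi>A (A.sc t)) \<omega>) = cmult D \<omega> (\<pi>B (csub B b (B.sc t)))"
      by (simp add: b(2) D.rng.right_diff_distrib)
    moreover have "csub B b (B.sc t) \<in> sa B" using b by (simp add: Lip1_def B.sa_diff)
    ultimately have "cnorm D (csub D y (cmult D (\<pi>A (A.sc t)) \<omega>)) \<le> cnorm D \<omega> * KB"
      using order_trans[OF homB_cnorm_le KB[OF b(1), folded t_def]]
      by (metis D.cnorm_mult D.cnorm_ge_0 mult_left_mono order_trans)
    then have "cnorm D (csub D (cmult D (\<pi>A (A.sc t)) \<omega>) y) \<le> KB * cnorm D \<omega>"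
      by (metis D.cnorm_minus_commute mult.commute)
    moreover have "A.sc t \<in> Lip1 A LA" by (simp add: Lip1_def LA_sc)
    ultimately show "\<exists>x\<in>(\<lambda>a. cmult D (\<pi>A a) \<omega>) ` Lip1 A LA. ereal (cnorm D (csub D x y)) \<le> ereal (K + r)"
      using r by (intro bexI[OF _ imageI[of "A.sc t"]]) (auto simp: K_def)
  qed
  then show ?thesis unfolding bridge_reach_def by blast
qed

text \<open>Both Hausdorff distances are at most the diameter of the state space concerned, because
  the 1-level is nonempty.\<close>

lemma height_bounded: "\<exists>K. bridge_height A LA B LB D \<omega> \<pi>A \<pi>B \<le> ereal K"
proof -
  obtain \<theta> where \<theta>: "\<theta> \<in> level1 D \<omega>" using level1_nonempty by blast
  obtain KA where KA: "\<And>\<phi> \<psi>. \<phi> \<in> states A \<Longrightarrow> \<psi> \<in> states A \<Longrightarrow> mk A LA \<phi> \<psi> \<le> ereal KA"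
    using A.mk_bounded[OF qA] by metis
  obtain KB where KB: "\<And>\<phi> \<psi>. \<phi> \<in> states B \<Longrightarrow> \<psi> \<in> states B \<Longrightarrow> mk B LB \<phi> \<psi> \<le> ereal KB"
    using B.mk_bounded[OF qB] by metis
  have le: "ereal c \<le> ereal (c + r)" if "r > 0" for c r :: real using that by simp
  have hA: "haus (mk A LA) (states A) ((\<lambda>\<phi>. \<phi> \<circ> \<pi>A) ` level1 D \<omega>) \<le> ereal KA"
  proof (rule haus_leI)
    show "\<exists>y\<in>(\<lambda>\<phi>. \<phi> \<circ> \<pi>A) ` level1 D \<omega>. mk A LA \<phi> y \<le> ereal (KA + r)" if "\<phi> \<in> states A" "r > 0" for \<phi> r
      using order_trans[OF KA[OF that(1) level1_pullback(2)[OF \<theta>]] le[OF that(2)]] \<theta> by blast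
    show "\<exists>\<phi>\<in>states A. mk A LA \<phi> y \<le> ereal (KA + r)"
      if "y \<in> (\<lambda>\<phi>. \<phi> \<circ> \<pi>A) ` level1 D \<omega>" "r > 0" for y r
      using that order_trans[OF KA le[OF that(2)]] level1_pullback(2) by blast
  qed
  have hB: "haus (mk B LB) (states B) ((\<lambda>\<phi>. \<phi> \<circ> \<pi>B) ` level1 D \<omega>) \<le> ereal KB"
  proof (rule haus_leI)
    show "\<exists>y\<in>(\<lambda>\<phi>. \<phi> \<circ> \<pi>B) ` level1 D \<omega>. mk B LB \<phi> y \<le> ereal (KB + r)" if "\<phi> \<in> states B" "r > 0" for \<phi> r
      using order_trans[OF KB[OF that(1) level1_pullback(3)[OF \<theta>]] le[OF that(2)]] \<theta> by blast
    show "\<exists>\<phi>\<in>states B. mk B LB \<phi> y \<le> ereal (KB + r)"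
      if "y \<in> (\<lambda>\<phi>. \<phi> \<circ> \<pi>B) ` level1 D \<omega>" "r > 0" for y r
      using that order_trans[OF KB le[OF that(2)]] level1_pullback(3) by blast
  qed
  have "bridge_height A LA B LB D \<omega> \<pi>A \<pi>B \<le> ereal (max KA KB)"
    unfolding bridge_height_def by (intro max.boundedI order_trans[OF hA] order_trans[OF hB]) simp_all
  then show ?thesis by blast
qed

text \<open>The element 0 is exhibited in \<open>Lip1 A LA\<close> because the supremum over the
  empty set would be minus infinity.\<close>

lemma length_finite: obtains l where "len = ereal l" "0 \<le> l"
proof -
  obtain K where "len \<le> ereal K"
    using reach_bounded height_bounded unfolding bridge_length_def
    by (metis max.boundedI ereal_max max.coboundedI1 max.coboundedI2)
  moreover have "0 \<le> len"
  proof -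
    have "cmult D (\<pi>A (A.sc 0)) \<omega> \<in> (\<lambda>a. cmult D (\<pi>A a) \<omega>) ` Lip1 A LA"
      using LA_sc[of 0] A.sa_sc[of 0] by (intro imageI) (simp add: Lip1_def)
    then have "0 \<le> (SUP x\<in>(\<lambda>a. cmult D (\<pi>A a) \<omega>) ` Lip1 A LA.
        INF y\<in>(\<lambda>b. cmult D \<omega> (\<pi>B b)) ` Lip1 B LB. ereal (cnorm D (csub D x y)))"
      by (rule SUP_upper2) (intro INF_greatest, simp)
    then show ?thesis unfolding bridge_length_def bridge_reach_def haus_def by (simp add: le_max_iff_disj)
  qed
  ultimately show ?thesis using that by (cases len) auto
qed

section \<open>The Lip-norm attached to the bridge\<close>

text \<open>The divisor is a free real number, so that the same lemmas serve the given \<epsilon>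
  and the arbitrary positive numbers in the bound on \<open>dist_q\<close>.\<close>

definition bridge_norm :: "real \<Rightarrow> 'a \<times> 'b \<Rightarrow> ereal" where
  "bridge_norm l = (\<lambda>(a, b). if a \<in> sa A \<and> b \<in> sa B
     then max (max (LA a) (LB b)) (ereal (N a b / l)) else \<infinity>)"

lemma bridge_lipnorm_eq:
  assumes "len + ereal \<epsilon> = ereal l" "l > 0"
  shows "bridge_lipnorm A LA B LB D \<omega> \<pi>A \<pi>B \<epsilon> = bridge_norm l"
  using assms by (auto simp: bridge_lipnorm_def bridge_norm_def gap_def fun_eq_iff)

lemma bridge_norm_ge:
  "LA a \<le> bridge_norm l (a, b)" "LB b \<le> bridge_norm l (a, b)" "ereal (N a b / l) \<le> bridge_norm l (a, b)"
  by (auto simp: bridge_norm_def le_max_iff_disj)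

lemma bridge_norm_leI:
  assumes "a \<in> sa A" "b \<in> sa B" "LA a \<le> c" "LB b \<le> c" "ereal (N a b / l) \<le> c"
  shows "bridge_norm l (a, b) \<le> c"
  using assms by (simp add: bridge_norm_def)

lemma bridge_norm_nonneg: "0 \<le> bridge_norm l x"
  using order_trans[OF A.qcms_nonneg[OF qA] bridge_norm_ge(1)] by (cases x) blast

lemma Lip1_bridge_norm:
  assumes "(a, b) \<in> Lip1 (dsum A B) (bridge_norm l)" "l > 0"
  shows "a \<in> Lip1 A LA" "b \<in> Lip1 B LB" "N a b \<le> l"
proof -
  have sa: "a \<in> sa A" "b \<in> sa B" and le: "bridge_norm l (a, b) \<le> 1" using assms by (auto simp: Lip1_def)
  show "a \<in> Lip1 A LA" "b \<in> Lip1 B LB"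
    using sa order_trans[OF bridge_norm_ge(1) le] order_trans[OF bridge_norm_ge(2) le] by (simp_all add: Lip1_def)
  show "N a b \<le> l" using order_trans[OF bridge_norm_ge(3) le] assms(2) by simp
qed

lemma qcms_bridge_norm:
  assumes l: "l > 0"
  shows "qcms (dsum A B) (bridge_norm l)"
proof -
  obtain \<theta> where \<theta>: "\<theta> \<in> level1 D \<omega>" using level1_nonempty by blast
  show ?thesis
  proof (rule E.qcms_of_totally_bounded)
    show "bridge_norm l x = \<infinity>" if "x \<notin> sa (dsum A B)" for x
      using that by (cases x) (auto simp: bridge_norm_def)
    show "0 \<le> bridge_norm l x" for x by (rule bridge_norm_nonneg)
  next
    fix x y assume xy: "x \<in> sa (dsum A B)" "y \<in> sa (dsum A B)"
    obtain a b a' b' where x: "x = (a, b)" and y: "y = (a', b')" by (metis surj_pair)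
    have sa: "a \<in> sa A" "b \<in> sa B" "a' \<in> sa A" "b' \<in> sa B" using xy by (auto simp: x y)
    show "bridge_norm l (cadd (dsum A B) x y) \<le> bridge_norm l x + bridge_norm l y"
      unfolding x y dsum_simps
    proof (rule bridge_norm_leI)
      show "LA (cadd A a a') \<le> bridge_norm l (a, b) + bridge_norm l (a', b')"
        by (rule order_trans[OF A.qcms_add[OF qA]]) (auto intro!: add_mono bridge_norm_ge sa)
      show "LB (cadd B b b') \<le> bridge_norm l (a, b) + bridge_norm l (a', b')"
        by (rule order_trans[OF B.qcms_add[OF qB]]) (auto intro!: add_mono bridge_norm_ge sa)
      have "N (cadd A a a') (cadd B b b') / l \<le> N a b / l + N a' b' / l"
        using l D.cnorm_triangle[of "gap a b" "gap a' b'"]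
        by (simp add: gap_add add_divide_distrib[symmetric] divide_right_mono)
      then have "ereal (N (cadd A a a') (cadd B b b') / l) \<le> ereal (N a b / l) + ereal (N a' b' / l)" by simp
      also have "\<dots> \<le> bridge_norm l (a, b) + bridge_norm l (a', b')"
        by (intro add_mono bridge_norm_ge)
      finally show "ereal (N (cadd A a a') (cadd B b b') / l) \<le> bridge_norm l (a, b) + bridge_norm l (a', b')" .
    qed (use sa in \<open>simp_all add: A.sa_add B.sa_add\<close>)
  next
    fix x and r :: real assume "x \<in> sa (dsum A B)"
    then obtain a b where x: "x = (a, b)" and sa: "a \<in> sa A" "b \<in> sa B" by (metis surj_pair sa_dsum_iff)
    \<comment> \<open>A monotone map commutes with \<open>max\<close>, which yields homogeneity of
      all three terms at once.\<close>
    have mono: "mono (\<lambda>t. ereal \<bar>r\<bar> * t)" by (auto intro!: monoI ereal_mult_left_mono)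
    have "ereal (N (csmult A (complex_of_real r) a) (csmult B (complex_of_real r) b) / l) = ereal \<bar>r\<bar> * ereal (N a b / l)"
      by (simp add: gap_csmult D.cnorm_csmult)
    then show "bridge_norm l (csmult (dsum A B) (complex_of_real r) x) = ereal \<bar>r\<bar> * bridge_norm l x"
      using sa by (simp add: x bridge_norm_def A.sa_scale B.sa_scale A.qcms_scale[OF qA] B.qcms_scale[OF qB]
          max_of_mono[OF mono] del: times_ereal.simps)
  next
    fix x and e :: real assume "x \<in> sa (dsum A B)" and e: "e > 0"
    then obtain a b where x: "x = (a, b)" and sa: "a \<in> sa A" "b \<in> sa B" by (metis surj_pair sa_dsum_iff)
    obtain a' where a': "LA a' < \<infinity>" "cnorm A (csub A a' a) < e" using A.qcms_dense[OF qA sa(1) e] by blast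
    obtain b' where b': "LB b' < \<infinity>" "cnorm B (csub B b' b) < e" using B.qcms_dense[OF qB sa(2) e] by blast
    have "a' \<in> sa A" "b' \<in> sa B" using a' b' A.qcms_outside[OF qA] B.qcms_outside[OF qB] by fastforce+
    then have "bridge_norm l (a', b') < \<infinity>" using a' b' by (simp add: bridge_norm_def max_def)
    then show "\<exists>y. bridge_norm l y < \<infinity> \<and> cnorm (dsum A B) (csub (dsum A B) y x) < e"
      using a' b' by (intro exI[of _ "(a', b')"]) (simp add: x)
  next
    fix x assume "x \<in> sa (dsum A B)"
    then obtain a b where x: "x = (a, b)" and sa: "a \<in> sa A" "b \<in> sa B" by (metis surj_pair sa_dsum_iff)
    show "bridge_norm l x = 0 \<longleftrightarrow> (\<exists>r. x = E.sc r)"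
    proof
      assume 0: "bridge_norm l x = 0"
      have "LA a \<le> 0" "LB b \<le> 0" "ereal (N a b / l) \<le> 0"
        using bridge_norm_ge[where a = a and b = b and l = l] 0 x by simp_all
      then have "LA a = 0" "LB b = 0" and N0: "N a b \<le> 0"
        using A.qcms_nonneg[OF qA] B.qcms_nonneg[OF qB] l by (auto simp: order_antisym divide_le_0_iff)
      then obtain r s where rs: "a = A.sc r" "b = B.sc s"
        using A.qcms_kernel[OF qA sa(1)] B.qcms_kernel[OF qB sa(2)] by blast
      \<comment> \<open>So far \<open>a\<close> and \<open>b\<close> are scalars that may differ;
        their gap is \<open>(r - s) \<omega>\<close>.\<close>
      have "\<bar>r - s\<bar> * cnorm D \<omega> \<le> 0"
        using N0 by (simp only: rs gap_sc D.cnorm_csmult norm_of_real)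
      then have "r = s" using pivot_nonzero by (simp add: mult_le_0_iff)
      then show "\<exists>r. x = E.sc r" using x rs by (auto simp: E_sc)
    next
      assume "\<exists>r. x = E.sc r"
      then obtain r where r: "a = A.sc r" "b = B.sc r" using x by (auto simp: E_sc)
      show "bridge_norm l x = 0"
        by (simp add: bridge_norm_def x r LA_sc LB_sc gap_sc)
    qed
  next
    show "inclA (\<theta> \<circ> \<pi>A) \<in> states (dsum A B)" by (intro inclA_state level1_pullback \<theta>)
  next
    fix e :: real assume e: "e > 0"
    obtain FA where FA: "finite FA"
        "\<And>a. a \<in> Lip1 A LA \<Longrightarrow> cmod ((\<theta> \<circ> \<pi>A) a) \<le> 0 \<Longrightarrow> \<exists>a'\<in>FA. cnorm A (csub A a a') < e"
      using A.Lip1_totally_bounded[OF qA level1_pullback(2)[OF \<theta>] e, of 0] by metis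
    \<comment> \<open>The bound is \<open>l\<close> here, not 0 as for \<open>FA\<close>:
      normalization makes \<theta> vanish at \<open>\<pi>A a\<close>, and the gap then allows a
      value of modulus up to \<open>l\<close> at \<open>\<pi>B b\<close>.\<close>
    obtain FB where FB: "finite FB"
        "\<And>b. b \<in> Lip1 B LB \<Longrightarrow> cmod ((\<theta> \<circ> \<pi>B) b) \<le> l \<Longrightarrow> \<exists>b'\<in>FB. cnorm B (csub B b b') < e"
      using B.Lip1_totally_bounded[OF qB level1_pullback(3)[OF \<theta>] e, of l] by metis
    show "\<exists>F. finite F \<and> (\<forall>x\<in>Lip1 (dsum A B) (bridge_norm l). inclA (\<theta> \<circ> \<pi>A) x = 0 \<longrightarrow>
        (\<exists>y\<in>F. cnorm (dsum A B) (csub (dsum A B) x y) < e))"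
    proof (intro exI conjI ballI impI)
      show "finite (FA \<times> FB)" using FA FB by simp
      fix x assume x: "x \<in> Lip1 (dsum A B) (bridge_norm l)" and 0: "inclA (\<theta> \<circ> \<pi>A) x = 0"
      obtain a b where ab: "x = (a, b)" by (metis surj_pair)
      note lip = Lip1_bridge_norm[OF x[unfolded ab] l]
      have a0: "\<theta> (\<pi>A a) = 0" using 0 by (simp add: ab inclA_def)
      then have "cmod (\<theta> (\<pi>B b)) \<le> l"
        using level1_diff_le[OF \<theta>, of a b] lip(3) by simp
      then obtain a' b' where "a' \<in> FA" "cnorm A (csub A a a') < e" "b' \<in> FB" "cnorm B (csub B b b') < e"
        using FA(2)[OF lip(1)] FB(2)[OF lip(2)] a0 by auto
      then show "\<exists>y\<in>FA \<times> FB. cnorm (dsum A B) (csub (dsum A B) x y) < e"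
        by (intro bexI[of _ "(a', b')"]) (simp_all add: ab)
    qed
  qed
qed

section \<open>Consequences of reach and height\<close>

lemma reachD1:
  assumes "len = ereal \<rho>" "a \<in> Lip1 A LA" "r > 0"
  shows "\<exists>b\<in>Lip1 B LB. N a b < \<rho> + r"
proof -
  have "bridge_reach A LA B LB D \<omega> \<pi>A \<pi>B \<le> ereal \<rho>"
    unfolding assms(1)[symmetric] bridge_length_def by simp
  from haus_leD1[OF this[unfolded bridge_reach_def] imageI[OF assms(2)] assms(3)]
  show ?thesis by (auto simp: gap_def)
qed

lemma reachD2:
  assumes "len = ereal \<rho>" "b \<in> Lip1 B LB" "r > 0"
  shows "\<exists>a\<in>Lip1 A LA. N a b < \<rho> + r"
proof -
  have "bridge_reach A LA B LB D \<omega> \<pi>A \<pi>B \<le> ereal \<rho>"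
    unfolding assms(1)[symmetric] bridge_length_def by simp
  from haus_leD2[OF this[unfolded bridge_reach_def] imageI[OF assms(2)] assms(3)]
  show ?thesis by (auto simp: gap_def)
qed

lemma heightD:
  assumes "len = ereal \<rho>" "r > 0"
  shows "\<phi> \<in> states A \<Longrightarrow> \<exists>\<theta>\<in>level1 D \<omega>. mk A LA \<phi> (\<theta> \<circ> \<pi>A) < ereal (\<rho> + r)"
    and "\<psi> \<in> states B \<Longrightarrow> \<exists>\<theta>\<in>level1 D \<omega>. mk B LB \<psi> (\<theta> \<circ> \<pi>B) < ereal (\<rho> + r)"
proof -
  have h: "haus (mk A LA) (states A) ((\<lambda>\<phi>. \<phi> \<circ> \<pi>A) ` level1 D \<omega>) \<le> ereal \<rho>"
    "haus (mk B LB) (states B) ((\<lambda>\<phi>. \<phi> \<circ> \<pi>B) ` level1 D \<omega>) \<le> ereal \<rho>"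
    unfolding assms(1)[symmetric] bridge_length_def bridge_height_def by (simp_all add: le_max_iff_disj)
  show "\<phi> \<in> states A \<Longrightarrow> \<exists>\<theta>\<in>level1 D \<omega>. mk A LA \<phi> (\<theta> \<circ> \<pi>A) < ereal (\<rho> + r)"
    using haus_leD1[OF h(1) _ assms(2)] by blast
  show "\<psi> \<in> states B \<Longrightarrow> \<exists>\<theta>\<in>level1 D \<omega>. mk B LB \<psi> (\<theta> \<circ> \<pi>B) < ereal (\<rho> + r)"
    using haus_leD1[OF h(2) _ assms(2)] by blast
qed

text \<open>A state \<phi> of \<open>A\<close> is moved first to
  \<open>\<theta> \<circ> \<pi>A\<close>, at cost \<rho> by the height, then to
  \<open>\<theta> \<circ> \<pi>B\<close>, at cost \<open>l\<close> by the gap. The first cost may be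
  measured in \<open>A\<close> alone since the first coordinates of the unit ball lie in
  \<open>Lip1 A LA\<close>.\<close>

lemma haus_bridge_norm_le:
  assumes len: "len = ereal \<rho>" and l: "l > 0"
  shows "haus (mk (dsum A B) (bridge_norm l)) (inclA ` states A) (inclB ` states B) \<le> ereal (\<rho> + l)"
proof (rule haus_leI)
  fix x :: "'a \<times> 'b \<Rightarrow> complex" and r :: real assume "x \<in> inclA ` states A" and r: "r > 0"
  then obtain \<phi> where \<phi>: "\<phi> \<in> states A" "x = inclA \<phi>" by blast
  obtain \<theta> where \<theta>: "\<theta> \<in> level1 D \<omega>" "mk A LA \<phi> (\<theta> \<circ> \<pi>A) < ereal (\<rho> + r)"
    using heightD(1)[OF len r \<phi>(1)] by blast
  have "mk (dsum A B) (bridge_norm l) x (inclB (\<theta> \<circ> \<pi>B)) \<le> ereal (\<rho> + l + r)"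
    unfolding mk_def
  proof (rule SUP_least)
    fix y assume y: "y \<in> Lip1 (dsum A B) (bridge_norm l)"
    obtain a b where ab: "y = (a, b)" by (metis surj_pair)
    note lip = Lip1_bridge_norm[OF y[unfolded ab] l]
    have "cmod (\<phi> a - \<theta> (\<pi>A a)) < \<rho> + r"
      using le_less_trans[OF A.mk_ge[OF lip(1)] \<theta>(2)] by simp
    moreover have "cmod (\<phi> a - \<theta> (\<pi>B b)) \<le> cmod (\<phi> a - \<theta> (\<pi>A a)) + cmod (\<theta> (\<pi>A a) - \<theta> (\<pi>B b))"
      using norm_triangle_ineq[of "\<phi> a - \<theta> (\<pi>A a)" "\<theta> (\<pi>A a) - \<theta> (\<pi>B b)"] by simp
    ultimately show "ereal (cmod (x y - inclB (\<theta> \<circ> \<pi>B) y)) \<le> ereal (\<rho> + l + r)"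
      using level1_diff_le[OF \<theta>(1), of a b] lip(3) by (simp add: \<phi>(2) ab inclA_def inclB_def)
  qed
  then show "\<exists>y\<in>inclB ` states B. mk (dsum A B) (bridge_norm l) x y \<le> ereal (\<rho> + l + r)"
    using level1_pullback(3)[OF \<theta>(1)] by blast
next
  fix x :: "'a \<times> 'b \<Rightarrow> complex" and r :: real assume "x \<in> inclB ` states B" and r: "r > 0"
  then obtain \<psi> where \<psi>: "\<psi> \<in> states B" "x = inclB \<psi>" by blast
  obtain \<theta> where \<theta>: "\<theta> \<in> level1 D \<omega>" "mk B LB \<psi> (\<theta> \<circ> \<pi>B) < ereal (\<rho> + r)"
    using heightD(2)[OF len r \<psi>(1)] by blast
  have "mk (dsum A B) (bridge_norm l) (inclA (\<theta> \<circ> \<pi>A)) x \<le> ereal (\<rho> + l + r)"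
    unfolding mk_def
  proof (rule SUP_least)
    fix y assume y: "y \<in> Lip1 (dsum A B) (bridge_norm l)"
    obtain a b where ab: "y = (a, b)" by (metis surj_pair)
    note lip = Lip1_bridge_norm[OF y[unfolded ab] l]
    have "cmod (\<psi> b - \<theta> (\<pi>B b)) < \<rho> + r"
      using le_less_trans[OF B.mk_ge[OF lip(2)] \<theta>(2)] by simp
    moreover have "cmod (\<theta> (\<pi>A a) - \<psi> b) \<le> cmod (\<theta> (\<pi>A a) - \<theta> (\<pi>B b)) + cmod (\<psi> b - \<theta> (\<pi>B b))"
      using norm_triangle_ineq[of "\<theta> (\<pi>A a) - \<theta> (\<pi>B b)" "\<theta> (\<pi>B b) - \<psi> b"] by (simp add: norm_minus_commute)
    ultimately show "ereal (cmod (inclA (\<theta> \<circ> \<pi>A) y - x y)) \<le> ereal (\<rho> + l + r)"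
      using level1_diff_le[OF \<theta>(1), of a b] lip(3) by (simp add: \<psi>(2) ab inclA_def inclB_def)
  qed
  then show "\<exists>y\<in>inclA ` states A. mk (dsum A B) (bridge_norm l) y x \<le> ereal (\<rho> + l + r)"
    using level1_pullback(2)[OF \<theta>(1)] by blast
qed

text \<open>The element is scaled into \<open>Lip1 A LA\<close>, a partner is taken from the reach,
  and the pair is scaled back. The factor is \<open>m = p + e / 2\<close> instead of
  \<open>p\<close>, so that it is positive even for scalars.\<close>

lemma bridge_norm_approx1:
  assumes len: "len = ereal \<rho>" and l: "\<rho> \<le> l" "l > 0" and a: "a \<in> sa A" "LA a = ereal p" and e: "e > 0"
  shows "\<exists>b\<in>sa B. bridge_norm l (a, b) \<le> ereal (p + e)"
proof -
  let ?s = "\<lambda>t. csmult A (complex_of_real t)" and ?t = "\<lambda>t. csmult B (complex_of_real t)"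
  have p: "p \<ge> 0" using A.qcms_nonneg[OF qA, of a] a by simp
  define m where "m = p + e / 2"
  have m: "m > 0" "p \<le> m" using p e by (simp_all add: m_def)
  have "LA (?s (1/m) a) \<le> 1" using A.qcms_scale[OF qA a(1), of "1/m"] a(2) m by simp
  then have "?s (1/m) a \<in> Lip1 A LA" using A.sa_scale[OF a(1), of "1/m"] by (simp add: Lip1_def)
  \<comment> \<open>This slack in the reach becomes \<open>e / 2 * l\<close> after multiplication by
    \<open>m\<close>, so the gap is at most \<open>(m + e / 2) * l = (p + e) * l\<close>.\<close>
  moreover have "e / 2 * l / m > 0" using e l m by simp
  ultimately obtain b where b: "b \<in> Lip1 B LB" "N (?s (1/m) a) b < \<rho> + e / 2 * l / m"
    using reachD1[OF len] by blast
  have bsa: "b \<in> sa B" "LB b \<le> 1" using b by (auto simp: Lip1_def)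
  have "bridge_norm l (a, ?t m b) \<le> ereal (p + e)"
  proof (rule bridge_norm_leI)
    show "LA a \<le> ereal (p + e)" using a e by simp
    have "LB (?t m b) = ereal m * LB b" using B.qcms_scale[OF qB bsa(1), of m] m by simp
    also have "\<dots> \<le> ereal m * 1" using bsa m by (intro ereal_mult_left_mono) auto
    also have "\<dots> \<le> ereal (p + e)" using e by (simp add: m_def)
    finally show "LB (?t m b) \<le> ereal (p + e)" .
    have "gap a (?t m b) = csmult D (complex_of_real m) (gap (?s (1/m) a) b)"
      unfolding gap_csmult[symmetric] using m by simp
    then have "N a (?t m b) = m * N (?s (1/m) a) b" using m by (simp add: D.cnorm_csmult)
    also have "\<dots> \<le> m * (l + e / 2 * l / m)" using b(2) l m by (intro mult_left_mono) auto
    also have "\<dots> = (p + e) * l" using m by (simp add: distrib_left) (simp add: m_def algebra_simps)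
    finally show "ereal (N a (?t m b) / l) \<le> ereal (p + e)" using l by (simp add: divide_le_eq)
  qed (use a bsa in \<open>simp_all add: B.sa_scale\<close>)
  then show ?thesis using B.sa_scale[OF bsa(1)] by blast
qed

lemma bridge_norm_approx2:
  assumes len: "len = ereal \<rho>" and l: "\<rho> \<le> l" "l > 0" and b: "b \<in> sa B" "LB b = ereal p" and e: "e > 0"
  shows "\<exists>a\<in>sa A. bridge_norm l (a, b) \<le> ereal (p + e)"
proof -
  let ?s = "\<lambda>t. csmult A (complex_of_real t)" and ?t = "\<lambda>t. csmult B (complex_of_real t)"
  have p: "p \<ge> 0" using B.qcms_nonneg[OF qB, of b] b by simp
  define m where "m = p + e / 2"
  have m: "m > 0" "p \<le> m" using p e by (simp_all add: m_def)
  have "LB (?t (1/m) b) \<le> 1" using B.qcms_scale[OF qB b(1), of "1/m"] b(2) m by simp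
  then have "?t (1/m) b \<in> Lip1 B LB" using B.sa_scale[OF b(1), of "1/m"] by (simp add: Lip1_def)
  moreover have "e / 2 * l / m > 0" using e l m by simp
  ultimately obtain a where a: "a \<in> Lip1 A LA" "N a (?t (1/m) b) < \<rho> + e / 2 * l / m"
    using reachD2[OF len] by blast
  have asa: "a \<in> sa A" "LA a \<le> 1" using a by (auto simp: Lip1_def)
  have "bridge_norm l (?s m a, b) \<le> ereal (p + e)"
  proof (rule bridge_norm_leI)
    show "LB b \<le> ereal (p + e)" using b e by simp
    have "LA (?s m a) = ereal m * LA a" using A.qcms_scale[OF qA asa(1), of m] m by simp
    also have "\<dots> \<le> ereal m * 1" using asa m by (intro ereal_mult_left_mono) auto
    also have "\<dots> \<le> ereal (p + e)" using e by (simp add: m_def)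
    finally show "LA (?s m a) \<le> ereal (p + e)" .
    have "gap (?s m a) b = csmult D (complex_of_real m) (gap a (?t (1/m) b))"
      unfolding gap_csmult[symmetric] using m by simp
    then have "N (?s m a) b = m * N a (?t (1/m) b)" using m by (simp add: D.cnorm_csmult)
    also have "\<dots> \<le> m * (l + e / 2 * l / m)" using a(2) l m by (intro mult_left_mono) auto
    also have "\<dots> = (p + e) * l" using m by (simp add: distrib_left) (simp add: m_def algebra_simps)
    finally show "ereal (N (?s m a) b / l) \<le> ereal (p + e)" using l by (simp add: divide_le_eq)
  qed (use b asa in \<open>simp_all add: A.sa_scale\<close>)
  then show ?thesis using A.sa_scale[OF asa(1)] by blast
qed

text \<open>The bounds from below hold because the norm is a maximum. The bounds from above use
  \<open>\<rho> \<le> l\<close>: the divisor must be at least the reach.\<close>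

lemma admissible_bridge_norm:
  assumes len: "len = ereal \<rho>" and l: "\<rho> \<le> l" "l > 0"
  shows "admissible A LA B LB (bridge_norm l)"
  unfolding admissible_def
proof (intro conjI ballI antisym)
  fix a assume a: "a \<in> sa A"
  show "LA a \<le> (INF b\<in>sa B. bridge_norm l (a, b))" by (intro INF_greatest bridge_norm_ge)
  show "(INF b\<in>sa B. bridge_norm l (a, b)) \<le> LA a"
  proof (cases "LA a")
    case (real p)
    show ?thesis unfolding real
    proof (rule ereal_le_epsilon2)
      fix e :: real assume "0 < e"
      then obtain b where "b \<in> sa B" "bridge_norm l (a, b) \<le> ereal (p + e)"
        using bridge_norm_approx1[OF len l a real] by blast
      then show "(INF b\<in>sa B. bridge_norm l (a, b)) \<le> ereal p + ereal e" by (auto intro: INF_lower2)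
    qed
  qed (use A.qcms_nonneg[OF qA, of a] in auto)
next
  fix b assume b: "b \<in> sa B"
  show "LB b \<le> (INF a\<in>sa A. bridge_norm l (a, b))" by (intro INF_greatest bridge_norm_ge)
  show "(INF a\<in>sa A. bridge_norm l (a, b)) \<le> LB b"
  proof (cases "LB b")
    case (real p)
    show ?thesis unfolding real
    proof (rule ereal_le_epsilon2)
      fix e :: real assume "0 < e"
      then obtain a where "a \<in> sa A" "bridge_norm l (a, b) \<le> ereal (p + e)"
        using bridge_norm_approx2[OF len l b real] by blast
      then show "(INF a\<in>sa A. bridge_norm l (a, b)) \<le> ereal p + ereal e" by (auto intro: INF_lower2)
    qed
  qed (use B.qcms_nonneg[OF qB, of b] in auto)
qed

section \<open>The Leibniz inequalities\<close>

text \<open>Treats the Jordan and the Lie product together: the pair \<open>(p, q)\<close> is known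
  only through its component inequalities and an estimate of its gap by the gaps of the two
  products.\<close>

lemma bridge_norm_product_le:
  assumes l: "l > 0" and sa: "a \<in> sa A" "b \<in> sa B" "a' \<in> sa A" "b' \<in> sa B" "p \<in> sa A" "q \<in> sa B"
    and p: "LA p \<le> ereal (cnorm A a) * LA a' + ereal (cnorm A a') * LA a"
    and q: "LB q \<le> ereal (cnorm B b) * LB b' + ereal (cnorm B b') * LB b"
    and N: "2 * N p q \<le> N (cmult A a a') (cmult B b b') + N (cmult A a' a) (cmult B b' b)"
  shows "bridge_norm l (p, q) \<le> ereal (cnorm (dsum A B) (a, b)) * bridge_norm l (a', b')
    + ereal (cnorm (dsum A B) (a', b')) * bridge_norm l (a, b)"
proof -
  define X where "X = max (cnorm A a) (cnorm B b)"
  define Y where "Y = max (cnorm A a') (cnorm B b')"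
  have X: "cnorm A a \<le> X" "cnorm B b \<le> X" and Y: "cnorm A a' \<le> Y" "cnorm B b' \<le> Y"
    by (simp_all add: X_def Y_def)
  have XY: "0 \<le> X" "0 \<le> Y" using X Y A.cnorm_ge_0 order_trans by blast+
  have mono: "ereal s * u + ereal t * v \<le> ereal X * bridge_norm l (a', b') + ereal Y * bridge_norm l (a, b)"
    if "0 \<le> s" "s \<le> X" "0 \<le> t" "t \<le> Y" "0 \<le> u" "u \<le> bridge_norm l (a', b')" "0 \<le> v" "v \<le> bridge_norm l (a, b)"
    for s t :: real and u v :: ereal
    using that by (intro add_mono ereal_mult_mono) auto
  have "bridge_norm l (p, q) \<le> ereal X * bridge_norm l (a', b') + ereal Y * bridge_norm l (a, b)"
  proof (rule bridge_norm_leI)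
    show "LA p \<le> ereal X * bridge_norm l (a', b') + ereal Y * bridge_norm l (a, b)"
      by (rule order_trans[OF p mono]) (auto intro: bridge_norm_ge A.qcms_nonneg[OF qA] X Y)
    show "LB q \<le> ereal X * bridge_norm l (a', b') + ereal Y * bridge_norm l (a, b)"
      by (rule order_trans[OF q mono]) (auto intro: bridge_norm_ge B.qcms_nonneg[OF qB] X Y)
    have "cnorm A a * N a' b' \<le> X * N a' b'" "cnorm B b * N a' b' \<le> X * N a' b'"
        "cnorm A a' * N a b \<le> Y * N a b" "cnorm B b' * N a b \<le> Y * N a b"
      using X Y by (simp_all add: mult_right_mono)
    \<comment> \<open>In each order the derivation rule mixes a norm from \<open>A\<close> with one
      from \<open>B\<close>; the maxima \<open>X\<close> and \<open>Y\<close> absorb both, and the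
      two orders add up to twice the right-hand side.\<close>
    then have "N p q \<le> X * N a' b' + Y * N a b"
      using N N_mult_le[OF sa(1,4), of a' b] N_mult_le[OF sa(3,2), of a b'] by linarith
    then have "N p q / l \<le> X * (N a' b' / l) + Y * (N a b / l)"
      using l by (simp add: add_divide_distrib[symmetric] divide_right_mono)
    then have "ereal (N p q / l) \<le> ereal X * ereal (N a' b' / l) + ereal Y * ereal (N a b / l)" by simp
    also have "\<dots> \<le> ereal X * bridge_norm l (a', b') + ereal Y * bridge_norm l (a, b)"
      using XY l by (intro mono bridge_norm_ge) auto
    finally show "ereal (N p q / l) \<le> ereal X * bridge_norm l (a', b') + ereal Y * bridge_norm l (a, b)" .
  qed (use sa in auto)
  then show ?thesis by (simp add: X_def Y_def)
qed

text \<open>The gap is linear in the pair, and the factors \<open>1/2\<close> and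
  \<open>1/(2\<i>)\<close> have the same modulus, so both products satisfy the same gap
  estimate.\<close>

lemma leibniz_bridge_norm:
  assumes l: "l > 0" and leibA: "leibniz_ineqs A LA" and leibB: "leibniz_ineqs B LB"
  shows "leibniz_ineqs (dsum A B) (bridge_norm l)"
  unfolding leibniz_ineqs_def
proof (intro ballI)
  fix x y assume "x \<in> sa (dsum A B)" "y \<in> sa (dsum A B)"
  then obtain a b a' b' where x: "x = (a, b)" and y: "y = (a', b')"
    and sa: "a \<in> sa A" "b \<in> sa B" "a' \<in> sa A" "b' \<in> sa B" by (metis surj_pair sa_dsum_iff)
  have star: "cstar A a = a" "cstar B b = b" "cstar A a' = a'" "cstar B b' = b'"
    using sa by (simp_all add: sa_def)
  have jordan: "jordan (dsum A B) (a, b) (a', b') = (jordan A a a', jordan B b b')"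
    by (simp add: jordan_def)
  have lie: "lie (dsum A B) (a, b) (a', b') = (lie A a a', lie B b b')"
    by (simp add: lie_def)
  have "jordan A a a' \<in> sa A" "jordan B b b' \<in> sa B"
    by (simp_all add: jordan_def A.sa_iff B.sa_iff A.cstar_csmult B.cstar_csmult A.cstar_add B.cstar_add
        A.cstar_mult B.cstar_mult star A.cadd_commute B.cadd_commute)
  moreover have "2 * N (jordan A a a') (jordan B b b')
      \<le> N (cmult A a a') (cmult B b b') + N (cmult A a' a) (cmult B b' b)"
    unfolding jordan_def gap_csmult gap_add
    using D.cnorm_triangle[of "gap (cmult A a a') (cmult B b b')" "gap (cmult A a' a) (cmult B b' b)"]
    by (simp add: D.cnorm_csmult)
  ultimately have J: "bridge_norm l (jordan A a a', jordan B b b')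
      \<le> ereal (cnorm (dsum A B) (a, b)) * bridge_norm l (a', b')
        + ereal (cnorm (dsum A B) (a', b')) * bridge_norm l (a, b)"
    using leibA leibB sa by (intro bridge_norm_product_le[OF l sa]) (auto simp: leibniz_ineqs_def)
  have "lie A a a' \<in> sa A" "lie B b b' \<in> sa B"
    by (simp_all add: lie_def A.sa_iff B.sa_iff A.cstar_csmult B.cstar_csmult A.cstar_diff B.cstar_diff
        A.cstar_mult B.cstar_mult star)
       (simp_all add: csub_def A.csmult_add_right B.csmult_add_right A.cadd_commute B.cadd_commute)
  moreover have "2 * N (lie A a a') (lie B b b')
      \<le> N (cmult A a a') (cmult B b b') + N (cmult A a' a) (cmult B b' b)"
    unfolding lie_def gap_csmult gap_diff
    using D.cnorm_triangle_diff[of "gap (cmult A a a') (cmult B b b')" "gap (cmult A a' a) (cmult B b' b)"]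
    by (simp add: D.cnorm_csmult norm_divide norm_mult)
  ultimately have "bridge_norm l (lie A a a', lie B b b')
      \<le> ereal (cnorm (dsum A B) (a, b)) * bridge_norm l (a', b')
        + ereal (cnorm (dsum A B) (a', b')) * bridge_norm l (a, b)"
    using leibA leibB sa by (intro bridge_norm_product_le[OF l sa]) (auto simp: leibniz_ineqs_def)
  with J show "bridge_norm l (jordan (dsum A B) x y) \<le> ereal (cnorm (dsum A B) x) * bridge_norm l y
        + ereal (cnorm (dsum A B) y) * bridge_norm l x \<and>
      bridge_norm l (lie (dsum A B) x y) \<le> ereal (cnorm (dsum A B) x) * bridge_norm l y
        + ereal (cnorm (dsum A B) y) * bridge_norm l x"
    by (simp only: jordan lie x y)
qed

section \<open>Rieffel's distance\<close>

text \<open>The divisor \<open>\<rho> + e\<close> is positive even for a bridge of length 0, and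
  each \<open>e\<close> gives an admissible Lip-norm with Hausdorff distance at most
  \<open>2 \<rho> + e\<close>.\<close>

lemma dist_q_le_twice_length:
  assumes len: "len = ereal \<rho>" and \<rho>: "0 \<le> \<rho>"
  shows "dist_q A LA B LB \<le> ereal (2 * \<rho>)"
proof (rule ereal_le_epsilon2)
  fix e :: real assume e: "0 < e"
  have "qcms (dsum A B) (bridge_norm (\<rho> + e)) \<and> admissible A LA B LB (bridge_norm (\<rho> + e))"
    using e \<rho> by (intro conjI qcms_bridge_norm admissible_bridge_norm[OF len]) auto
  then have "dist_q A LA B LB
      \<le> haus (mk (dsum A B) (bridge_norm (\<rho> + e))) (inclA ` states A) (inclB ` states B)"
    unfolding dist_q_def by (intro INF_lower) simp
  also have "\<dots> \<le> ereal (\<rho> + (\<rho> + e))" using e \<rho> by (intro haus_bridge_norm_le len) simp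
  finally show "dist_q A LA B LB \<le> ereal (2 * \<rho>) + ereal e" by (simp add: algebra_simps)
qed

end

theorem mainTheorem14:
  fixes A :: "'a cstar_alg" and LA :: "'a \<Rightarrow> ereal"
    and B :: "'b cstar_alg" and LB :: "'b \<Rightarrow> ereal"
    and D :: "'d cstar_alg" and \<omega> :: 'd
    and \<pi>A :: "'a \<Rightarrow> 'd" and \<pi>B :: "'b \<Rightarrow> 'd" and \<epsilon> :: real
  assumes "leibniz_qcms A LA" and "leibniz_qcms B LB"
    and "bridge A B D \<omega> \<pi>A \<pi>B"
    and "0 \<le> \<epsilon>"
    and "bridge_length A LA B LB D \<omega> \<pi>A \<pi>B + ereal \<epsilon> > 0"
  shows "qcms (dsum A B) (bridge_lipnorm A LA B LB D \<omega> \<pi>A \<pi>B \<epsilon>)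
       \<and> admissible A LA B LB (bridge_lipnorm A LA B LB D \<omega> \<pi>A \<pi>B \<epsilon>)
       \<and> leibniz_ineqs (dsum A B) (bridge_lipnorm A LA B LB D \<omega> \<pi>A \<pi>B \<epsilon>)
       \<and> haus (mk (dsum A B) (bridge_lipnorm A LA B LB D \<omega> \<pi>A \<pi>B \<epsilon>))
              (inclA ` states A) (inclB ` states B)
           \<le> 2 * bridge_length A LA B LB D \<omega> \<pi>A \<pi>B + ereal \<epsilon>
       \<and> dist_q A LA B LB \<le> 2 * bridge_length A LA B LB D \<omega> \<pi>A \<pi>B"
proof -
  have A: "qcms A LA" "leibniz_ineqs A LA" and B: "qcms B LB" "leibniz_ineqs B LB"
    using assms(1,2) by (auto simp: leibniz_qcms_def)
  interpret lip_bridge A LA B LB D \<omega> \<pi>A \<pi>B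
    using A(1) B(1) assms(3) by unfold_locales
  obtain \<rho> where \<rho>: "bridge_length A LA B LB D \<omega> \<pi>A \<pi>B = ereal \<rho>" "0 \<le> \<rho>" by (rule length_finite)
  have l: "\<rho> + \<epsilon> > 0" "\<rho> \<le> \<rho> + \<epsilon>" using assms(4,5) \<rho> by auto
  have "bridge_lipnorm A LA B LB D \<omega> \<pi>A \<pi>B \<epsilon> = bridge_norm (\<rho> + \<epsilon>)"
    using l \<rho> by (intro bridge_lipnorm_eq) auto
  moreover have "haus (mk (dsum A B) (bridge_norm (\<rho> + \<epsilon>))) (inclA ` states A) (inclB ` states B)
      \<le> 2 * ereal \<rho> + ereal \<epsilon>"
    using haus_bridge_norm_le[OF \<rho>(1) l(1)] by (simp add: algebra_simps)
  ultimately show ?thesis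
    using qcms_bridge_norm[OF l(1)] admissible_bridge_norm[OF \<rho>(1) l(2,1)]
      leibniz_bridge_norm[OF l(1) A(2) B(2)] dist_q_le_twice_length[OF \<rho>] \<rho>(1) by simp
qed

end
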